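(* If $G$ is an infinite finitely generated amenable group and $H$ is a finitely generated group of quadratic growth, then $$\alpha^*(G\wr H)=\min\left\{\tfrac12,\alpha^*(G)\right\}.$$ Moreover, $$\alpha^*\left(C_2\wr \mathbb{Z}^2\right)=\alpha^*\left(\mathbb{Z}\wr \mathbb{Z}^2\right)=\tfrac12.$$
   Context: For a finitely generated group $G$ with left-invariant word metric $d_G$ (induced by a finite symmetric generating set), the Hilbert compression exponent $\alpha^*(G)$ is the supremum of all $\alpha\ge 0$ for which there exist a Lipschitz map $f:G\to L_2$ and $c>0$ with $\|f(x)-f(y)\|_2\ge c\,d_G(x,y)^\alpha$ for all distinct $x,y\in G$. It does not depend on the generating set. $H$ has quadratic growth if the cardinality of the ball of radius $r$ in $H$ is bounded above and below by positive constant multiples of $r^2$ for all $r\ge 1$. $C_2$ is the cyclic group of order $2$. The wreath product $G\wr H$ is the group of all pairs $(f,x)$ with $f:H\to G$ finitely supported and $x\in H$, with product $(f,x)(g,y)=(z\mapsto f(z)g(x^{-1}z),\,xy)$. *)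

theory Defs
  imports "HOL-Analysis.Analysis" "HOL-Algebra.Elementary_Groups"
begin

section \<open>Word metrics\<close>

definition finitely_generated :: "('a, 'm) monoid_scheme \<Rightarrow> bool" where
  "finitely_generated G \<longleftrightarrow> (\<exists>S. finite S \<and> S \<subseteq> carrier G \<and> generate G S = carrier G)"

definition fin_sym_generating :: "('a, 'm) monoid_scheme \<Rightarrow> 'a set \<Rightarrow> bool" where
  "fin_sym_generating G S \<longleftrightarrow>
     finite S \<and> S \<subseteq> carrier G \<and> (\<forall>s\<in>S. inv\<^bsub>G\<^esub> s \<in> S) \<and> generate G S = carrier G"

definition word_length :: "('a, 'm) monoid_scheme \<Rightarrow> 'a set \<Rightarrow> 'a \<Rightarrow> nat" where
  "word_length G S x =
     (LEAST n. \<exists>ws. set ws \<subseteq> S \<and> length ws = n \<and> foldr (\<otimes>\<^bsub>G\<^esub>) ws \<one>\<^bsub>G\<^esub> = x)"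

definition word_dist :: "('a, 'm) monoid_scheme \<Rightarrow> 'a set \<Rightarrow> 'a \<Rightarrow> 'a \<Rightarrow> nat" where
  "word_dist G S x y = word_length G S (inv\<^bsub>G\<^esub> x \<otimes>\<^bsub>G\<^esub> y)"


section \<open>Hilbert compression exponent\<close>

text \<open>The space \<open>L\<^sub>2\<close> is the real space \<open>L\<^sub>2([0,1])\<close>. Its elements are represented by functions,
  without passing to classes modulo null sets; only norms of differences are used.\<close>

definition L2_fun :: "(real \<Rightarrow> real) set" where
  "L2_fun = {g. g \<in> borel_measurable (lebesgue_on {0..1}) \<and>
                integrable (lebesgue_on {0..1}) (\<lambda>t. (g t)\<^sup>2)}"

definition L2_norm :: "(real \<Rightarrow> real) \<Rightarrow> real" where
  "L2_norm g = sqrt (integral\<^sup>L (lebesgue_on {0..1}) (\<lambda>t. (g t)\<^sup>2))"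

definition L2_dist :: "(real \<Rightarrow> real) \<Rightarrow> (real \<Rightarrow> real) \<Rightarrow> real" where
  "L2_dist g h = L2_norm (\<lambda>t. g t - h t)"

definition compression_admissible :: "('a, 'm) monoid_scheme \<Rightarrow> 'a set \<Rightarrow> real \<Rightarrow> bool" where
  "compression_admissible G S \<alpha> \<longleftrightarrow>
     (\<exists>f :: 'a \<Rightarrow> real \<Rightarrow> real.
        f ` carrier G \<subseteq> L2_fun \<and>
        (\<exists>L. \<forall>x\<in>carrier G. \<forall>y\<in>carrier G.
            L2_dist (f x) (f y) \<le> L * real (word_dist G S x y)) \<and>
        (\<exists>c>0. \<forall>x\<in>carrier G. \<forall>y\<in>carrier G. x \<noteq> y \<longrightarrow>
            L2_dist (f x) (f y) \<ge> c * real (word_dist G S x y) powr \<alpha>))"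

text \<open>The supremum is taken in the extended reals, because it is infinite for a finite group.\<close>

definition hilbert_compression_wrt :: "('a, 'm) monoid_scheme \<Rightarrow> 'a set \<Rightarrow> ereal" where
  "hilbert_compression_wrt G S = (SUP \<alpha> \<in> {\<alpha>. 0 \<le> \<alpha> \<and> compression_admissible G S \<alpha>}. ereal \<alpha>)"

text \<open>For a finitely generated group the choice of the generating set is immaterial;
  see \<open>hilbert_compression_eq\<close> below.\<close>

definition hilbert_compression :: "('a, 'm) monoid_scheme \<Rightarrow> ereal" where
  "hilbert_compression G = hilbert_compression_wrt G (SOME S. fin_sym_generating G S)"


section \<open>Amenability, quadratic growth, wreath products\<close>

text \<open>Amenability of a discrete group: there is a left-invariant mean on the bounded real functions
  on the group. A function on the group is represented by any of its extensions to the ambient type;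
  positivity forces \<open>m f\<close> to depend only on the values of \<open>f\<close> on the carrier.\<close>

definition amenable :: "('a, 'm) monoid_scheme \<Rightarrow> bool" where
  "amenable G \<longleftrightarrow>
     (\<exists>m :: ('a \<Rightarrow> real) \<Rightarrow> real.
        (\<forall>f g. bounded (f ` carrier G) \<longrightarrow> bounded (g ` carrier G) \<longrightarrow>
            m (\<lambda>x. f x + g x) = m f + m g) \<and>
        (\<forall>a f. bounded (f ` carrier G) \<longrightarrow> m (\<lambda>x. a * f x) = a * m f) \<and>
        (\<forall>f. bounded (f ` carrier G) \<longrightarrow> (\<forall>x\<in>carrier G. 0 \<le> f x) \<longrightarrow> 0 \<le> m f) \<and>
        m (\<lambda>x. 1) = 1 \<and>
        (\<forall>g\<in>carrier G. \<forall>f. bounded (f ` carrier G) \<longrightarrow> m (\<lambda>x. f (g \<otimes>\<^bsub>G\<^esub> x)) = m f))"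

text \<open>Quadratic growth with respect to one finite symmetric generating set implies it for all,
  with other constants. By left invariance it suffices to consider balls around \<open>\<one>\<close>. As \<open>card\<close> of
  an infinite set is \<open>0\<close>, note that balls of a word metric are finite.\<close>

definition quadratic_growth :: "('a, 'm) monoid_scheme \<Rightarrow> bool" where
  "quadratic_growth G \<longleftrightarrow>
     (\<exists>S. fin_sym_generating G S \<and>
        (\<exists>a>0. \<exists>b>0. \<forall>r::real. r \<ge> 1 \<longrightarrow>
           a * r\<^sup>2 \<le> real (card {x \<in> carrier G. real (word_dist G S \<one>\<^bsub>G\<^esub> x) \<le> r}) \<and>
           real (card {x \<in> carrier G. real (word_dist G S \<one>\<^bsub>G\<^esub> x) \<le> r}) \<le> b * r\<^sup>2))"

text \<open>Functions on \<open>H\<close> are represented by elements of \<open>carrier H \<rightarrow>\<^sub>E carrier G\<close>, that is, they take the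
  value \<open>undefined\<close> outside the carrier, so that each of them has a unique representative.\<close>

definition wreath_product ::
  "('a, 'm) monoid_scheme \<Rightarrow> ('b, 'n) monoid_scheme \<Rightarrow> (('b \<Rightarrow> 'a) \<times> 'b) monoid"
  (infixr \<open>\<wr>\<close> 80) where
  "G \<wr> H =
     \<lparr>carrier = {f \<in> carrier H \<rightarrow>\<^sub>E carrier G. finite {z \<in> carrier H. f z \<noteq> \<one>\<^bsub>G\<^esub>}} \<times> carrier H,
      mult = (\<lambda>(f, x) (g, y).
                (\<lambda>z\<in>carrier H. f z \<otimes>\<^bsub>G\<^esub> g (inv\<^bsub>H\<^esub> x \<otimes>\<^bsub>H\<^esub> z), x \<otimes>\<^bsub>H\<^esub> y)),
      one = (\<lambda>z\<in>carrier H. \<one>\<^bsub>G\<^esub>, \<one>\<^bsub>H\<^esub>)\<rparr>"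


section \<open>Basic facts\<close>

lemma group_wreath_product:
  assumes "group G" "group H"
  shows "group (G \<wr> H)"
proof -
  interpret G: group G by fact
  interpret H: group H by fact
  have mem: "f z \<in> carrier G" if "f \<in> carrier H \<rightarrow>\<^sub>E carrier G" "z \<in> carrier H" for f z
    using that by auto
  have fin: "finite {z \<in> carrier H. f (x \<otimes>\<^bsub>H\<^esub> z) \<noteq> \<one>\<^bsub>G\<^esub>}"
    if "finite {z \<in> carrier H. f z \<noteq> \<one>\<^bsub>G\<^esub>}" "x \<in> carrier H" for f x
  proof (rule finite_subset)
    show "{z \<in> carrier H. f (x \<otimes>\<^bsub>H\<^esub> z) \<noteq> \<one>\<^bsub>G\<^esub>}
        \<subseteq> (\<lambda>w. inv\<^bsub>H\<^esub> x \<otimes>\<^bsub>H\<^esub> w) ` {z \<in> carrier H. f z \<noteq> \<one>\<^bsub>G\<^esub>}"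
    proof
      fix z assume z: "z \<in> {z \<in> carrier H. f (x \<otimes>\<^bsub>H\<^esub> z) \<noteq> \<one>\<^bsub>G\<^esub>}"
      then have "z = inv\<^bsub>H\<^esub> x \<otimes>\<^bsub>H\<^esub> (x \<otimes>\<^bsub>H\<^esub> z)"
        using that(2) by (simp add: H.m_assoc [symmetric])
      with z that(2) show "z \<in> (\<lambda>w. inv\<^bsub>H\<^esub> x \<otimes>\<^bsub>H\<^esub> w) ` {z \<in> carrier H. f z \<noteq> \<one>\<^bsub>G\<^esub>}"
        by blast
    qed
  qed (use that in simp)
  show ?thesis
  proof (rule groupI)
    fix p q assume p: "p \<in> carrier (G \<wr> H)" and q: "q \<in> carrier (G \<wr> H)"
    obtain f x where [simp]: "p = (f, x)" by (cases p)
    obtain g y where [simp]: "q = (g, y)" by (cases q)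
    have f: "f \<in> carrier H \<rightarrow>\<^sub>E carrier G" "finite {z \<in> carrier H. f z \<noteq> \<one>\<^bsub>G\<^esub>}" "x \<in> carrier H"
      using p by (auto simp: wreath_product_def)
    have g: "g \<in> carrier H \<rightarrow>\<^sub>E carrier G" "finite {z \<in> carrier H. g z \<noteq> \<one>\<^bsub>G\<^esub>}" "y \<in> carrier H"
      using q by (auto simp: wreath_product_def)
    have "finite {z \<in> carrier H. f z \<otimes>\<^bsub>G\<^esub> g (inv\<^bsub>H\<^esub> x \<otimes>\<^bsub>H\<^esub> z) \<noteq> \<one>\<^bsub>G\<^esub>}"
      by (rule finite_subset [of _ "{z \<in> carrier H. f z \<noteq> \<one>\<^bsub>G\<^esub>} \<union>
             {z \<in> carrier H. g (inv\<^bsub>H\<^esub> x \<otimes>\<^bsub>H\<^esub> z) \<noteq> \<one>\<^bsub>G\<^esub>}"])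
         (use f g fin [of g "inv\<^bsub>H\<^esub> x"] in auto)
    moreover have "{z \<in> carrier H. (\<lambda>z\<in>carrier H. f z \<otimes>\<^bsub>G\<^esub> g (inv\<^bsub>H\<^esub> x \<otimes>\<^bsub>H\<^esub> z)) z \<noteq> \<one>\<^bsub>G\<^esub>}
        = {z \<in> carrier H. f z \<otimes>\<^bsub>G\<^esub> g (inv\<^bsub>H\<^esub> x \<otimes>\<^bsub>H\<^esub> z) \<noteq> \<one>\<^bsub>G\<^esub>}" by auto
    ultimately show "p \<otimes>\<^bsub>G \<wr> H\<^esub> q \<in> carrier (G \<wr> H)"
      using f g by (simp add: wreath_product_def mem [OF f(1)] mem [OF g(1)])
  next
    show "\<one>\<^bsub>G \<wr> H\<^esub> \<in> carrier (G \<wr> H)"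
      by (simp add: wreath_product_def cong: conj_cong)
  next
    fix p q r
    assume p: "p \<in> carrier (G \<wr> H)" and q: "q \<in> carrier (G \<wr> H)" and r: "r \<in> carrier (G \<wr> H)"
    obtain f x where [simp]: "p = (f, x)" by (cases p)
    obtain g y where [simp]: "q = (g, y)" by (cases q)
    obtain h w where [simp]: "r = (h, w)" by (cases r)
    have x: "x \<in> carrier H" "y \<in> carrier H" "w \<in> carrier H"
      and f: "f \<in> carrier H \<rightarrow>\<^sub>E carrier G" "g \<in> carrier H \<rightarrow>\<^sub>E carrier G"
        "h \<in> carrier H \<rightarrow>\<^sub>E carrier G"
      using p q r by (auto simp: wreath_product_def)
    show "p \<otimes>\<^bsub>G \<wr> H\<^esub> q \<otimes>\<^bsub>G \<wr> H\<^esub> r = p \<otimes>\<^bsub>G \<wr> H\<^esub> (q \<otimes>\<^bsub>G \<wr> H\<^esub> r)"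
      using x by (auto simp: wreath_product_def restrict_def fun_eq_iff H.m_assoc G.m_assoc
           H.inv_mult_group mem [OF f(1)] mem [OF f(2)] mem [OF f(3)])
  next
    fix p assume p: "p \<in> carrier (G \<wr> H)"
    obtain f x where [simp]: "p = (f, x)" by (cases p)
    have f: "f \<in> carrier H \<rightarrow>\<^sub>E carrier G" "x \<in> carrier H"
      using p by (auto simp: wreath_product_def)
    have "(\<lambda>z\<in>carrier H. (\<lambda>z\<in>carrier H. \<one>\<^bsub>G\<^esub>) z \<otimes>\<^bsub>G\<^esub> f (inv\<^bsub>H\<^esub> \<one>\<^bsub>H\<^esub> \<otimes>\<^bsub>H\<^esub> z)) = f"
    proof
      fix z
      show "(\<lambda>z\<in>carrier H. (\<lambda>z\<in>carrier H. \<one>\<^bsub>G\<^esub>) z \<otimes>\<^bsub>G\<^esub> f (inv\<^bsub>H\<^esub> \<one>\<^bsub>H\<^esub> \<otimes>\<^bsub>H\<^esub> z)) z = f z"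
        using mem [OF f(1), of z] PiE_arb [OF f(1), of z] by (cases "z \<in> carrier H") simp_all
    qed
    then show "\<one>\<^bsub>G \<wr> H\<^esub> \<otimes>\<^bsub>G \<wr> H\<^esub> p = p"
      using f(2) by (simp add: wreath_product_def)
  next
    fix p assume p: "p \<in> carrier (G \<wr> H)"
    obtain f x where [simp]: "p = (f, x)" by (cases p)
    have f: "f \<in> carrier H \<rightarrow>\<^sub>E carrier G" "finite {z \<in> carrier H. f z \<noteq> \<one>\<^bsub>G\<^esub>}" "x \<in> carrier H"
      using p by (auto simp: wreath_product_def)
    let ?g = "\<lambda>z\<in>carrier H. inv\<^bsub>G\<^esub> f (x \<otimes>\<^bsub>H\<^esub> z)"
    have "{z \<in> carrier H. ?g z \<noteq> \<one>\<^bsub>G\<^esub>} \<subseteq> {z \<in> carrier H. f (x \<otimes>\<^bsub>H\<^esub> z) \<noteq> \<one>\<^bsub>G\<^esub>}"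
      using f by auto
    then have "finite {z \<in> carrier H. ?g z \<noteq> \<one>\<^bsub>G\<^esub>}"
      using fin [OF f(2,3)] finite_subset by blast
    moreover have "?g \<in> carrier H \<rightarrow>\<^sub>E carrier G" using f by (auto simp: mem [OF f(1)])
    ultimately have "(?g, inv\<^bsub>H\<^esub> x) \<in> carrier (G \<wr> H)"
      using f(3) unfolding wreath_product_def by (simp del: restrict_apply)
    moreover have "(?g, inv\<^bsub>H\<^esub> x) \<otimes>\<^bsub>G \<wr> H\<^esub> p = \<one>\<^bsub>G \<wr> H\<^esub>"
      using f by (auto simp: wreath_product_def restrict_def fun_eq_iff mem [OF f(1)])
    ultimately show "\<exists>q\<in>carrier (G \<wr> H). q \<otimes>\<^bsub>G \<wr> H\<^esub> p = \<one>\<^bsub>G \<wr> H\<^esub>" by blast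
  qed
qed

context group begin

lemma finitely_generated_iff: "finitely_generated G \<longleftrightarrow> (\<exists>S. fin_sym_generating G S)"
proof
  assume "finitely_generated G"
  then obtain S where S: "finite S" "S \<subseteq> carrier G" "generate G S = carrier G"
    by (auto simp: finitely_generated_def)
  let ?T = "S \<union> (\<lambda>s. inv s) ` S"
  have "?T \<subseteq> carrier G" using S by auto
  moreover have "generate G ?T = carrier G"
    using mono_generate [of S ?T] generate_incl [OF \<open>?T \<subseteq> carrier G\<close>] S(3) by blast
  moreover have "inv t \<in> ?T" if "t \<in> ?T" for t
    using that S(2) by auto
  ultimately have "fin_sym_generating G ?T"
    using S by (auto simp: fin_sym_generating_def)
  then show "\<exists>S. fin_sym_generating G S" ..
qed (auto simp: finitely_generated_def fin_sym_generating_def)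

lemma foldr_mult_append:
  assumes "set us \<subseteq> carrier G" "set vs \<subseteq> carrier G"
  shows "foldr (\<otimes>) us \<one> \<in> carrier G"
    and "foldr (\<otimes>) (us @ vs) \<one> = foldr (\<otimes>) us \<one> \<otimes> foldr (\<otimes>) vs \<one>"
proof -
  have closed: "foldr (\<otimes>) ws \<one> \<in> carrier G" if "set ws \<subseteq> carrier G" for ws
    using that by (induction ws) auto
  show "foldr (\<otimes>) us \<one> \<in> carrier G" using closed assms by blast
  show "foldr (\<otimes>) (us @ vs) \<one> = foldr (\<otimes>) us \<one> \<otimes> foldr (\<otimes>) vs \<one>"
    using assms(1)
  proof (induction us)
    case Nil then show ?case using closed [OF assms(2)] by simp
  next
    case (Cons u us)
    then show ?case using closed [OF assms(2)] closed [of us] by (simp add: m_assoc)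
  qed
qed

lemma word_exists:
  assumes "fin_sym_generating G S" "x \<in> carrier G"
  shows "\<exists>ws. set ws \<subseteq> S \<and> foldr (\<otimes>) ws \<one> = x"
proof -
  have S: "S \<subseteq> carrier G" "\<And>s. s \<in> S \<Longrightarrow> inv s \<in> S" and "x \<in> generate G S"
    using assms by (auto simp: fin_sym_generating_def)
  from \<open>x \<in> generate G S\<close> show ?thesis
  proof induction
    case one
    then show ?case by (intro exI [of _ "[]"]) simp
  next
    case (incl h)
    then show ?case using S by (intro exI [of _ "[h]"]) auto
  next
    case (inv h)
    then show ?case using S by (intro exI [of _ "[inv h]"]) auto
  next
    case (eng h1 h2)
    then obtain us vs where "set us \<subseteq> S" "foldr (\<otimes>) us \<one> = h1" "set vs \<subseteq> S" "foldr (\<otimes>) vs \<one> = h2"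
      by blast
    then show ?case using S foldr_mult_append(2) [of us vs]
      by (intro exI [of _ "us @ vs"]) auto
  qed
qed

lemma word_length_attained:
  assumes "fin_sym_generating G S" "x \<in> carrier G"
  obtains ws where "set ws \<subseteq> S" "length ws = word_length G S x" "foldr (\<otimes>) ws \<one> = x"
proof -
  have "\<exists>n ws. set ws \<subseteq> S \<and> length ws = n \<and> foldr (\<otimes>) ws \<one> = x"
    using word_exists [OF assms] by blast
  from LeastI_ex [OF this] show thesis
    using that unfolding word_length_def by blast
qed

lemma word_length_le:
  assumes "set ws \<subseteq> S" "foldr (\<otimes>) ws \<one> = x"
  shows "word_length G S x \<le> length ws"
  unfolding word_length_def using assms by (intro Least_le) blast

lemma word_length_mult_le:
  assumes "fin_sym_generating G S" "x \<in> carrier G" "y \<in> carrier G"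
  shows "word_length G S (x \<otimes> y) \<le> word_length G S x + word_length G S y"
proof -
  obtain us where us: "set us \<subseteq> S" "length us = word_length G S x" "foldr (\<otimes>) us \<one> = x"
    using word_length_attained [OF assms(1,2)] .
  obtain vs where vs: "set vs \<subseteq> S" "length vs = word_length G S y" "foldr (\<otimes>) vs \<one> = y"
    using word_length_attained [OF assms(1,3)] .
  have "S \<subseteq> carrier G" using assms(1) by (simp add: fin_sym_generating_def)
  then have "foldr (\<otimes>) (us @ vs) \<one> = x \<otimes> y"
    using foldr_mult_append(2) [of us vs] us vs by auto
  then show ?thesis using word_length_le [of "us @ vs" S] us vs by simp
qed

lemma word_length_comparable:
  assumes S: "fin_sym_generating G S" and T: "fin_sym_generating G T"
  shows "\<exists>K>0. \<forall>x\<in>carrier G. word_length G T x \<le> K * word_length G S x"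
proof -
  define K where "K = Suc (\<Sum>s\<in>S. word_length G T s)"
  have SG: "S \<subseteq> carrier G" "finite S" using S by (auto simp: fin_sym_generating_def)
  have K: "word_length G T s \<le> K" if "s \<in> S" for s
    using that SG member_le_sum [of s S "word_length G T"] by (simp add: K_def)
  have *: "word_length G T (foldr (\<otimes>) ws \<one>) \<le> K * length ws" if "set ws \<subseteq> S" for ws
    using that
  proof (induction ws)
    case Nil
    then show ?case using word_length_le [of "[]" T \<one>] by simp
  next
    case (Cons w ws)
    have "foldr (\<otimes>) ws \<one> \<in> carrier G" using Cons SG foldr_mult_append(1) [of ws ws] by auto
    then have "word_length G T (w \<otimes> foldr (\<otimes>) ws \<one>)
        \<le> word_length G T w + word_length G T (foldr (\<otimes>) ws \<one>)"
      using Cons SG by (intro word_length_mult_le [OF T]) auto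
    then show ?case using Cons K [of w] by simp
  qed
  have "word_length G T x \<le> K * word_length G S x" if x: "x \<in> carrier G" for x
  proof -
    obtain ws where "set ws \<subseteq> S" "length ws = word_length G S x" "foldr (\<otimes>) ws \<one> = x"
      by (rule word_length_attained [OF S x])
    then show ?thesis using * [of ws] by simp
  qed
  then show ?thesis by (intro exI [of _ K]) (simp add: K_def)
qed

lemma compression_admissible_mono:
  assumes S: "fin_sym_generating G S" and T: "fin_sym_generating G T"
    and \<alpha>: "0 \<le> \<alpha>" and adm: "compression_admissible G S \<alpha>"
  shows "compression_admissible G T \<alpha>"
proof -
  obtain K where K: "K > 0" "\<And>x. x \<in> carrier G \<Longrightarrow> word_length G T x \<le> K * word_length G S x"
    using word_length_comparable [OF S T] by blast
  obtain M where M: "M > 0" "\<And>x. x \<in> carrier G \<Longrightarrow> word_length G S x \<le> M * word_length G T x"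
    using word_length_comparable [OF T S] by blast
  have Kd: "word_dist G T x y \<le> K * word_dist G S x y"
    and Md: "word_dist G S x y \<le> M * word_dist G T x y"
    if "x \<in> carrier G" "y \<in> carrier G" for x y
    using that unfolding word_dist_def by (intro K M; simp)+
  obtain f L c where f: "f ` carrier G \<subseteq> L2_fun"
    and L': "\<forall>x\<in>carrier G. \<forall>y\<in>carrier G.
              L2_dist (f x) (f y) \<le> L * real (word_dist G S x y)"
    and c: "c > 0"
    and c': "\<forall>x\<in>carrier G. \<forall>y\<in>carrier G. x \<noteq> y \<longrightarrow>
              L2_dist (f x) (f y) \<ge> c * real (word_dist G S x y) powr \<alpha>"
    using adm unfolding compression_admissible_def by (elim exE conjE)
  note L = L' [rule_format]
  have "L2_dist (f x) (f y) \<le> (\<bar>L\<bar> * real M) * real (word_dist G T x y)"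
    if "x \<in> carrier G" "y \<in> carrier G" for x y
  proof -
    have "L2_dist (f x) (f y) \<le> \<bar>L\<bar> * real (word_dist G S x y)"
      by (rule order_trans [OF L [OF that]]) (simp add: mult_right_mono)
    also have "real (word_dist G S x y) \<le> real M * real (word_dist G T x y)"
      using Md [OF that] by (metis of_nat_le_iff of_nat_mult)
    then have "\<bar>L\<bar> * real (word_dist G S x y) \<le> \<bar>L\<bar> * (real M * real (word_dist G T x y))"
      by (rule mult_left_mono) simp
    finally show ?thesis by (simp add: mult.assoc)
  qed
  moreover have "L2_dist (f x) (f y) \<ge> (c / real K powr \<alpha>) * real (word_dist G T x y) powr \<alpha>"
    if "x \<in> carrier G" "y \<in> carrier G" "x \<noteq> y" for x y
  proof -
    have "real (word_dist G T x y) \<le> real K * real (word_dist G S x y)"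
      using Kd [OF that(1,2)] by (metis of_nat_le_iff of_nat_mult)
    then have "real (word_dist G T x y) powr \<alpha> \<le> (real K * real (word_dist G S x y)) powr \<alpha>"
      using \<alpha> by (intro powr_mono2) auto
    also have "\<dots> = real K powr \<alpha> * real (word_dist G S x y) powr \<alpha>"
      by (rule powr_mult)
    finally have "(c / real K powr \<alpha>) * real (word_dist G T x y) powr \<alpha>
        \<le> (c / real K powr \<alpha>) * (real K powr \<alpha> * real (word_dist G S x y) powr \<alpha>)"
      using c by (intro mult_left_mono) auto
    also have "\<dots> = c * real (word_dist G S x y) powr \<alpha>" using K(1) by simp
    also have "\<dots> \<le> L2_dist (f x) (f y)" using c' that by blast
    finally show ?thesis .
  qed
  moreover have "c / real K powr \<alpha> > 0" using c K(1) by simp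
  ultimately show ?thesis
    unfolding compression_admissible_def
    by (intro exI [of _ f] conjI f exI [of _ "\<bar>L\<bar> * real M"]
        exI [of _ "c / real K powr \<alpha>"] ballI impI)
qed

lemma hilbert_compression_eq:
  assumes "fin_sym_generating G S"
  shows "hilbert_compression G = hilbert_compression_wrt G S"
proof -
  have "fin_sym_generating G (SOME S. fin_sym_generating G S)"
    by (rule someI [of "fin_sym_generating G", OF assms])
  then have "{\<alpha>. 0 \<le> \<alpha> \<and> compression_admissible G (SOME S. fin_sym_generating G S) \<alpha>}
      = {\<alpha>. 0 \<le> \<alpha> \<and> compression_admissible G S \<alpha>}"
    using assms compression_admissible_mono by blast
  then show ?thesis
    unfolding hilbert_compression_def hilbert_compression_wrt_def by simp
qed

end

end

theory Submission
  imports Defs "HOL-Real_Asymp.Real_Asymp"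
begin

text \<open>
  Let \<open>H\<close> have quadratic growth, let \<open>G\<close> be a nontrivial finitely generated group, and think of an element
  \<open>(\<eta>, x)\<close> of \<open>G \<wr> H\<close> as a lamp configuration \<open>\<eta>\<close> together with a position \<open>x\<close> of the lamplighter. Up to
  constants, the distance from \<open>(\<eta>, x)\<close> to \<open>(\<eta>', x')\<close> is the length of a shortest travelling salesman tour
  from \<open>x\<close> through all positions of changed lamps to \<open>x'\<close>, plus the sum of the distances in \<open>G\<close> between
  \<open>\<eta> z\<close> and \<open>\<eta>' z\<close>. The proof that the exponent of \<open>G \<wr> H\<close> is \<open>min (1 / 2) (\<alpha>\<^sup>*(G))\<close> has three parts
  (\<open>hilbert_compression_wreath\<close>); the two examples then need only that \<open>\<alpha>\<^sup>*(G) \<ge> 1 / 2\<close> for \<open>\<int>\<close> and \<open>C\<^sub>2\<close>.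

  The bound by \<open>\<alpha>\<^sup>*(G)\<close> holds because \<open>G\<close> is isometric to its copy over the identity of \<open>H\<close>
  (\<open>compression_admissible_base\<close>).

  The bound by \<open>1 / 2\<close> rests on Markov type \<open>2\<close>: for a stationary reversible Markov chain \<open>Z\<close> and a map \<open>f\<close>
  into Hilbert space, \<open>E |f (Z (2 n)) - f (Z 0)|\<^sup>2 \<le> 2 E |f (Z n) - f (Z 0)|\<^sup>2\<close>, so that mean squared
  displacements grow at most linearly along powers of two (\<open>energy_pow2\<close>). This is applied to a lamplighter
  on a ball of radius \<open>2 ^ K\<close> in \<open>H\<close> who carries two lamp states. He jumps at scale \<open>j \<le> K\<close> with probability
  proportional to \<open>1 / 4 ^ j\<close>, and resamples the lamps at both ends of each jump. The mean square length of a
  jump is of order \<open>K\<close>; and since balls of radius \<open>r\<close> have at least about \<open>r\<^sup>2\<close> points, the expected number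
  of returns to a point within \<open>4 ^ K\<close> steps is of order \<open>K\<close> as well (\<open>green_mix_le\<close>). So about
  \<open>4 ^ K / K\<close> positions are visited, half of whose lamps end up changed, and distances are at least the number
  of changed lamps. An exponent above \<open>1 / 2\<close> would contradict the linear growth of the energy
  (\<open>lamplighter_bound\<close>, \<open>compression_admissible_le_half\<close>). Working with finite chains avoids any passage to
  equivariant maps.

  For the lower bound, let \<open>\<alpha> < 1 / 2\<close> be admissible for \<open>G\<close>. The Hilbert sum over all lamps of an embedding of
  \<open>G\<close> controls the second term of the distance, because \<open>2 \<alpha> \<le> 1\<close>. For the tour, choose a net of scale
  \<open>2 ^ k\<close> in \<open>H\<close> for every \<open>k\<close>. A tour can be built by adding to a tour through the cells of scale
  \<open>k + 1\<close> that contain changed lamps one short detour for each such cell of scale \<open>k\<close>. So its length is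
  bounded by the sum over \<open>k\<close> of \<open>2 ^ k\<close> times the number of these cells, up to the scale of the diameter
  (\<open>salesman_scales\<close>). At each scale, \<open>0\<close>-\<open>1\<close> coordinates detect the changed cells with weight \<open>2 ^ k\<close>, in
  such a way that a generator changes boundedly many coordinates (\<open>coord_diff_boxes\<close>,
  \<open>coord_diff_move\<close>). The number of differing coordinates is a distance of \<open>L\<^sub>1\<close> type, hence the square of
  a Hilbert distance; this is where the exponent \<open>1 / 2\<close> comes from
  (\<open>W_dst_powr_le\<close>, \<open>compression_admissible_wreath\<close>).
\<close>

section \<open>Word metrics\<close>

locale word_metric = group G for G :: "('a, 'm) monoid_scheme" (structure) +
  fixes S :: "'a set"
  assumes gen: "fin_sym_generating G S"
begin

abbreviation len :: "'a \<Rightarrow> nat" where "len \<equiv> word_length G S"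
abbreviation dst :: "'a \<Rightarrow> 'a \<Rightarrow> nat" where "dst \<equiv> word_dist G S"

lemma S_carrier: "S \<subseteq> carrier G" and S_finite: "finite S" and S_inv: "s \<in> S \<Longrightarrow> inv s \<in> S"
  using gen by (auto simp: fin_sym_generating_def)

lemma len_one [simp]: "len \<one> = 0"
  using word_length_le [of "[]" S \<one>] by simp

lemma len_gen_le: "s \<in> S \<Longrightarrow> len s \<le> 1"
  using word_length_le [of "[s]" S s] S_carrier by auto

lemma len_eq_0_iff: "x \<in> carrier G \<Longrightarrow> len x = 0 \<longleftrightarrow> x = \<one>"
  by (metis foldr_Nil id_apply len_one length_0_conv word_length_attained gen)

lemma len_mult_le: "x \<in> carrier G \<Longrightarrow> y \<in> carrier G \<Longrightarrow> len (x \<otimes> y) \<le> len x + len y"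
  using word_length_mult_le gen by blast

lemma len_inv_le: assumes x: "x \<in> carrier G" shows "len (inv x) \<le> len x"
proof -
  obtain ws where ws: "set ws \<subseteq> S" "length ws = len x" "foldr (\<otimes>) ws \<one> = x"
    using word_length_attained [OF gen x] .
  have *: "foldr (\<otimes>) (rev (map (\<lambda>s. inv s) vs)) \<one> = inv (foldr (\<otimes>) vs \<one>)"
    if "set vs \<subseteq> carrier G" for vs
    using that
  proof (induction vs)
    case (Cons v vs)
    then have c: "set (rev (map (\<lambda>s. inv s) vs)) \<subseteq> carrier G" "set [inv v] \<subseteq> carrier G" "v \<in> carrier G"
      "foldr (\<otimes>) vs \<one> \<in> carrier G"
      using foldr_mult_append(1) [of vs vs] by auto
    have "foldr (\<otimes>) (rev (map (\<lambda>s. inv s) (v # vs))) \<one> =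
        foldr (\<otimes>) (rev (map (\<lambda>s. inv s) vs) @ [inv v]) \<one>" by simp
    also have "\<dots> = inv (foldr (\<otimes>) vs \<one>) \<otimes> inv v"
      unfolding foldr_mult_append(2) [OF c(1,2)] using Cons c by simp
    also have "\<dots> = inv (foldr (\<otimes>) (v # vs) \<one>)" using c by (simp add: inv_mult_group)
    finally show ?case .
  qed simp
  have "len (inv x) \<le> length (rev (map (\<lambda>s. inv s) ws))"
    using * [of ws] ws S_carrier S_inv by (intro word_length_le) auto
  then show ?thesis using ws by simp
qed

lemma len_inv: "x \<in> carrier G \<Longrightarrow> len (inv x) = len x"
  by (metis inv_closed inv_inv le_antisym len_inv_le)

lemma dst_self [simp]: "x \<in> carrier G \<Longrightarrow> dst x x = 0"
  by (simp add: word_dist_def)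

lemma dst_eq_0_iff: "x \<in> carrier G \<Longrightarrow> y \<in> carrier G \<Longrightarrow> dst x y = 0 \<longleftrightarrow> x = y"
  unfolding word_dist_def using len_eq_0_iff [of "inv x \<otimes> y"]
  by (metis inv_closed inv_equality inv_inv l_inv m_closed)

lemma dst_commute: "x \<in> carrier G \<Longrightarrow> y \<in> carrier G \<Longrightarrow> dst x y = dst y x"
  unfolding word_dist_def using len_inv [of "inv x \<otimes> y"] by (simp add: inv_mult_group)

lemma dst_triangle:
  assumes "x \<in> carrier G" "y \<in> carrier G" "z \<in> carrier G"
  shows "dst x z \<le> dst x y + dst y z"
proof -
  have "inv x \<otimes> z = (inv x \<otimes> y) \<otimes> (inv y \<otimes> z)"
    using assms by (simp add: m_assoc) (simp add: m_assoc [symmetric])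
  then show ?thesis unfolding word_dist_def using assms by (simp add: len_mult_le)
qed

lemma dst_one: "x \<in> carrier G \<Longrightarrow> dst \<one> x = len x"
  by (simp add: word_dist_def)

lemma dst_gen_le: "x \<in> carrier G \<Longrightarrow> s \<in> S \<Longrightarrow> dst x (x \<otimes> s) \<le> 1"
  using S_carrier len_gen_le by (auto simp: word_dist_def m_assoc [symmetric] subset_iff)

lemma dst_walk:
  assumes "x \<in> carrier G" "y \<in> carrier G"
  obtains ws where "set ws \<subseteq> S" "length ws = dst x y" "foldl (\<otimes>) x ws = y"
proof -
  have foldl: "foldl (\<otimes>) u ws = u \<otimes> foldr (\<otimes>) ws \<one>" if "u \<in> carrier G" "set ws \<subseteq> carrier G" for u ws
    using that
  proof (induction ws arbitrary: u)
    case (Cons w ws)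
    then show ?case using foldr_mult_append(1) [of ws ws] by (simp add: m_assoc)
  qed simp
  obtain ws where ws: "set ws \<subseteq> S" "length ws = dst x y" "foldr (\<otimes>) ws \<one> = inv x \<otimes> y"
    using word_length_attained [OF gen, of "inv x \<otimes> y"] assms by (auto simp: word_dist_def)
  have "foldl (\<otimes>) x ws = y"
    using ws assms foldl [of x ws] S_carrier by (simp add: m_assoc [symmetric])
  then show thesis using that ws by blast
qed

lemma dst_foldl_le: "x \<in> carrier G \<Longrightarrow> set ws \<subseteq> S \<Longrightarrow>
    foldl (\<otimes>) x ws \<in> carrier G \<and> dst x (foldl (\<otimes>) x ws) \<le> length ws"
proof (induction ws arbitrary: x)
  case (Cons w ws)
  then have "w \<in> carrier G" using S_carrier by auto
  then show ?case
    using Cons.IH [of "x \<otimes> w"] Cons.prems dst_gen_le [of x w]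
      dst_triangle [of x "x \<otimes> w" "foldl (\<otimes>) (x \<otimes> w) ws"] by auto
qed simp

text \<open>Points part of the way along a geodesic to the identity serve as centres of balls that lie both
  in a large ball around the identity and near a given point of it.\<close>

lemma geodesic_point:
  assumes "x \<in> carrier G" "m \<le> len x"
  obtains y where "y \<in> carrier G" "dst x y \<le> m" "len y \<le> len x - m"
proof -
  obtain ws where ws: "set ws \<subseteq> S" "length ws = dst x \<one>" "foldl (\<otimes>) x ws = \<one>"
    using dst_walk [of x \<one>] assms by auto
  have n: "dst x \<one> = len x" using assms dst_commute dst_one by auto
  define y where "y = foldl (\<otimes>) x (take m ws)"
  have y: "y \<in> carrier G" "dst x y \<le> m"
    using dst_foldl_le [of x "take m ws"] ws assms set_take_subset [of m ws] by (auto simp: y_def)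
  have "foldl (\<otimes>) y (drop m ws) = \<one>"
    by (metis append_take_drop_id foldl_append ws(3) y_def)
  then have "dst y \<one> \<le> len x - m"
    using dst_foldl_le [of y "drop m ws"] y ws n set_drop_subset [of m ws] by auto
  then show thesis using that y dst_commute [of y \<one>] dst_one by auto
qed

lemma finite_ball: "finite {x \<in> carrier G. len x \<le> n}"
proof (rule finite_subset)
  show "{x \<in> carrier G. len x \<le> n} \<subseteq> (\<lambda>ws. foldr (\<otimes>) ws \<one>) ` {ws. set ws \<subseteq> S \<and> length ws \<le> n}"
  proof
    fix x assume "x \<in> {x \<in> carrier G. len x \<le> n}"
    then show "x \<in> (\<lambda>ws. foldr (\<otimes>) ws \<one>) ` {ws. set ws \<subseteq> S \<and> length ws \<le> n}"
      using word_length_attained [OF gen, of x] by (metis (mono_tags, lifting) image_eqI mem_Collect_eq)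
  qed
qed (simp add: S_finite finite_lists_length_le)

lemma countable_carrier: "countable (carrier G)"
proof -
  have "carrier G = (\<Union>n. {x \<in> carrier G. len x \<le> n})" by auto
  moreover have "countable (\<Union>n. {x \<in> carrier G. len x \<le> n})"
    by (intro countable_UN [OF countableI_type] countable_finite [OF finite_ball])
  ultimately show ?thesis by simp
qed

lemma ball_translate:
  assumes "z \<in> carrier G"
  shows "{x \<in> carrier G. dst z x \<le> n} = (\<otimes>) z ` {x \<in> carrier G. len x \<le> n}"
proof (intro equalityI subsetI)
  fix x assume x: "x \<in> {x \<in> carrier G. dst z x \<le> n}"
  then have "x = z \<otimes> (inv z \<otimes> x)" using assms by (simp add: m_assoc [symmetric])
  then show "x \<in> (\<otimes>) z ` {x \<in> carrier G. len x \<le> n}"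
    using x assms by (auto simp: word_dist_def)
qed (use assms in \<open>auto simp: word_dist_def m_assoc [symmetric]\<close>)

lemma card_ball:
  assumes "z \<in> carrier G"
  shows "card {x \<in> carrier G. dst z x \<le> n} = card {x \<in> carrier G. len x \<le> n}"
    and "finite {x \<in> carrier G. dst z x \<le> n}"
proof -
  have "inj_on ((\<otimes>) z) {x \<in> carrier G. len x \<le> n}"
    using inj_on_cmult [OF assms] by (rule inj_on_subset) auto
  then show "card {x \<in> carrier G. dst z x \<le> n} = card {x \<in> carrier G. len x \<le> n}"
    unfolding ball_translate [OF assms] by (rule card_image)
  show "finite {x \<in> carrier G. dst z x \<le> n}"
    unfolding ball_translate [OF assms] by (intro finite_imageI finite_ball)
qed

end

section \<open>Kernels realised by maps into \<open>L\<^sub>2\<close>\<close>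

text \<open>Embeddings are handled through their squared distances: these add up under Hilbert sums, and all
  estimates below are linear in them.\<close>

definition L2_kernel :: "'g set \<Rightarrow> ('g \<Rightarrow> 'g \<Rightarrow> real) \<Rightarrow> bool" where
  "L2_kernel X \<psi> \<longleftrightarrow> (\<exists>F. F ` X \<subseteq> L2_fun \<and> (\<forall>x\<in>X. \<forall>y\<in>X. (L2_dist (F x) (F y))\<^sup>2 = \<psi> x y))"

abbreviation I01 :: "real measure" where "I01 \<equiv> lebesgue_on {0..1}"

lemma diff_sq_le: "((a::real) - b)\<^sup>2 \<le> 2 * a\<^sup>2 + 2 * b\<^sup>2"
    using zero_le_power2 [of "a+b"] unfolding power2_sum power2_diff by linarith

lemma L2_fun_diff:
  assumes "f \<in> L2_fun" "g \<in> L2_fun"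
  shows "(\<lambda>t. f t - g t) \<in> L2_fun"
proof -
  have m: "f \<in> borel_measurable I01" "g \<in> borel_measurable I01"
    and i: "integrable I01 (\<lambda>t. (f t)\<^sup>2)" "integrable I01 (\<lambda>t. (g t)\<^sup>2)"
    using assms unfolding L2_fun_def by auto
  have mm: "(\<lambda>t. f t - g t) \<in> borel_measurable I01"
    by (rule borel_measurable_diff [OF m])
  have "integrable I01 (\<lambda>t. (f t - g t)\<^sup>2)"
  proof (rule Bochner_Integration.integrable_bound)
    show "integrable I01 (\<lambda>t. 2 * (f t)\<^sup>2 + 2 * (g t)\<^sup>2)"
      using i by (intro Bochner_Integration.integrable_add integrable_mult_right)
    show "(\<lambda>t. (f t - g t)\<^sup>2) \<in> borel_measurable I01"
      by (rule borel_measurable_power [OF mm])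
    show "AE x in I01. norm ((f x - g x)\<^sup>2) \<le> norm (2 * (f x)\<^sup>2 + 2 * (g x)\<^sup>2)"
      using diff_sq_le by (intro AE_I2) simp
  qed
  with mm show ?thesis by (simp add: L2_fun_def)
qed

lemma L2_norm_sq: "(L2_norm f)\<^sup>2 = integral\<^sup>L I01 (\<lambda>t. (f t)\<^sup>2)"
  by (simp add: L2_norm_def)

lemma L2_dist_sq: "(L2_dist f g)\<^sup>2 = integral\<^sup>L I01 (\<lambda>t. (f t - g t)\<^sup>2)"
  by (simp add: L2_norm_sq L2_dist_def)

lemma L2_dist_nonneg [simp]: "0 \<le> L2_dist f g"
  by (simp add: L2_dist_def L2_norm_def)

lemma L2_fun_integrable_diff:
  "f \<in> L2_fun \<Longrightarrow> g \<in> L2_fun \<Longrightarrow> integrable I01 (\<lambda>t. (f t - g t)\<^sup>2)"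
  using L2_fun_diff by (auto simp: L2_fun_def)

lemma L2_kernel_nonneg: "L2_kernel X \<psi> \<Longrightarrow> x \<in> X \<Longrightarrow> y \<in> X \<Longrightarrow> 0 \<le> \<psi> x y"
  unfolding L2_kernel_def by (metis zero_le_power2)

lemma L2_kernel_refl: "L2_kernel X \<psi> \<Longrightarrow> x \<in> X \<Longrightarrow> \<psi> x x = 0"
  unfolding L2_kernel_def by (force simp: L2_dist_sq)

text \<open>Inequalities that are linear in squared distances need a proof on the real line only: the real
  inequality is applied at each point of the unit interval and then integrated.\<close>

lemma L2_kernel_quadratic:
  assumes "L2_kernel X \<psi>" "I \<subseteq> X"
    and pos: "\<And>v :: 'g \<Rightarrow> real. 0 \<le> (\<Sum>i\<in>I. \<Sum>j\<in>I. a i j * (v i - v j)\<^sup>2)"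
  shows "0 \<le> (\<Sum>i\<in>I. \<Sum>j\<in>I. a i j * \<psi> i j)"
proof -
  obtain F where F: "F ` X \<subseteq> L2_fun" "\<And>x y. x \<in> X \<Longrightarrow> y \<in> X \<Longrightarrow> (L2_dist (F x) (F y))\<^sup>2 = \<psi> x y"
    using assms(1) by (auto simp: L2_kernel_def)
  have int: "integrable I01 (\<lambda>t. a i j * (F i t - F j t)\<^sup>2)" if "i \<in> I" "j \<in> I" for i j
    using L2_fun_integrable_diff [of "F i" "F j"] F(1) that assms(2) by auto
  have "(\<Sum>i\<in>I. \<Sum>j\<in>I. a i j * \<psi> i j) = (\<Sum>i\<in>I. \<Sum>j\<in>I. integral\<^sup>L I01 (\<lambda>t. a i j * (F i t - F j t)\<^sup>2))"
  proof (intro sum.cong refl)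
    fix i j assume "i \<in> I" "j \<in> I"
    then have "\<psi> i j = integral\<^sup>L I01 (\<lambda>t. (F i t - F j t)\<^sup>2)"
      using F(2) [of i j] assms(2) L2_dist_sq [of "F i" "F j"] by (metis subsetD)
    then show "a i j * \<psi> i j = integral\<^sup>L I01 (\<lambda>t. a i j * (F i t - F j t)\<^sup>2)" by simp
  qed
  also have "\<dots> = integral\<^sup>L I01 (\<lambda>t. \<Sum>i\<in>I. \<Sum>j\<in>I. a i j * (F i t - F j t)\<^sup>2)"
    using int by (subst Bochner_Integration.integral_sum, simp)
      (intro sum.cong refl Bochner_Integration.integral_sum [symmetric], simp)
  also have "\<dots> \<ge> 0"
    using pos by (intro integral_nonneg_AE AE_I2)
  finally show ?thesis .
qed

text \<open>The triangle inequality for squared distances, from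
  \<open>(a + b)\<^sup>2 \<le> (1 + t) a\<^sup>2 + (1 + 1 / t) b\<^sup>2\<close>.\<close>

lemma L2_kernel_triangle:
  assumes k: "L2_kernel X \<psi>" and X: "x \<in> X" "y \<in> X" "z \<in> X" and t: "t > 0"
  shows "\<psi> x z \<le> (1 + t) * \<psi> x y + (1 + 1 / t) * \<psi> y z"
proof -
  obtain F where F: "F ` X \<subseteq> L2_fun" "\<And>x y. x \<in> X \<Longrightarrow> y \<in> X \<Longrightarrow> (L2_dist (F x) (F y))\<^sup>2 = \<psi> x y"
    using assms(1) by (auto simp: L2_kernel_def)
  have i: "integrable I01 (\<lambda>s. (F u s - F v s)\<^sup>2)" if "u \<in> X" "v \<in> X" for u v
    using L2_fun_integrable_diff [of "F u" "F v"] F(1) that by auto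
  have *: "(F x s - F z s)\<^sup>2 \<le> (1 + t) * (F x s - F y s)\<^sup>2 + (1 + 1 / t) * (F y s - F z s)\<^sup>2" for s
  proof -
    define a b where "a = F x s - F y s" and "b = F y s - F z s"
    have "(1 + t) * a\<^sup>2 + (1 + 1 / t) * b\<^sup>2 - (a + b)\<^sup>2 = (t * a - b)\<^sup>2 / t"
      using t by (simp add: power2_eq_square field_simps)
    also have "\<dots> \<ge> 0" using t by simp
    finally show ?thesis by (simp add: a_def b_def)
  qed
  have "\<psi> x z = integral\<^sup>L I01 (\<lambda>s. (F x s - F z s)\<^sup>2)"
    using F X by (simp add: L2_dist_sq [symmetric])
  also have "\<dots> \<le> integral\<^sup>L I01 (\<lambda>s. (1 + t) * (F x s - F y s)\<^sup>2 + (1 + 1 / t) * (F y s - F z s)\<^sup>2)"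
    using i X by (intro integral_mono *) auto
  also have "\<dots> = (1 + t) * \<psi> x y + (1 + 1 / t) * \<psi> y z"
    using i F X by (simp add: L2_dist_sq [symmetric])
  finally show ?thesis .
qed

lemma L2_kernel_pullback:
  assumes "L2_kernel Y \<psi>" "h ` X \<subseteq> Y"
  shows "L2_kernel X (\<lambda>x y. \<psi> (h x) (h y))"
proof -
  obtain F where F: "F ` Y \<subseteq> L2_fun" "\<forall>x\<in>Y. \<forall>y\<in>Y. (L2_dist (F x) (F y))\<^sup>2 = \<psi> x y"
    using assms(1) by (auto simp: L2_kernel_def)
  show ?thesis
    unfolding L2_kernel_def using F assms(2) by (intro exI [of _ "\<lambda>x. F (h x)"]) blast
qed

lemma L2_kernel_cong:
  "L2_kernel X \<psi> \<Longrightarrow> (\<And>x y. x \<in> X \<Longrightarrow> y \<in> X \<Longrightarrow> \<psi> x y = \<psi>' x y) \<Longrightarrow> L2_kernel X \<psi>'"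
  unfolding L2_kernel_def by auto

lemma L2_fun_const: "(\<lambda>t. c) \<in> L2_fun"
  by (simp add: L2_fun_def finite_measure.integrable_const finite_measure_lebesgue_on)

lemma L2_kernel_scalar: "L2_kernel X (\<lambda>x y. (\<phi> x - \<phi> y)\<^sup>2)"
  unfolding L2_kernel_def
  by (intro exI [of _ "\<lambda>x t. \<phi> x"]) (auto simp: L2_fun_const L2_dist_sq measure_restrict_space)

lemma L2_kernel_mult:
  assumes "L2_kernel X \<psi>" "0 \<le> c"
  shows "L2_kernel X (\<lambda>x y. c * \<psi> x y)"
proof -
  obtain F where F: "F ` X \<subseteq> L2_fun" "\<And>x y. x \<in> X \<Longrightarrow> y \<in> X \<Longrightarrow> (L2_dist (F x) (F y))\<^sup>2 = \<psi> x y"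
    using assms(1) by (auto simp: L2_kernel_def)
  have "(\<lambda>t. sqrt c * F x t) \<in> L2_fun" if "x \<in> X" for x
    using F(1) that by (auto simp: L2_fun_def power_mult_distrib)
  moreover have "(L2_dist (\<lambda>t. sqrt c * F x t) (\<lambda>t. sqrt c * F y t))\<^sup>2 = c * \<psi> x y" if "x \<in> X" "y \<in> X" for x y
    using F(2) [OF that] assms(2)
    by (simp add: L2_dist_sq right_diff_distrib [symmetric] power_mult_distrib)
  ultimately show ?thesis
    unfolding L2_kernel_def by (intro exI [of _ "\<lambda>x t. sqrt c * F x t"]) auto
qed

text \<open>To realise a Hilbert sum of countably many copies of \<open>L\<^sub>2([0,1])\<close> inside \<open>L\<^sub>2([0,1])\<close>, the \<open>i\<close>-th
  function is rescaled to the dyadic interval from \<open>1 / 2 ^ (i + 1)\<close> to \<open>1 / 2 ^ i\<close>. The left endpoint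
  is excluded, so that these intervals are disjoint.\<close>

definition piece :: "(nat \<Rightarrow> real \<Rightarrow> real) \<Rightarrow> nat \<Rightarrow> real \<Rightarrow> real" where
  "piece fs i t = (if 2 ^ (i + 1) * t - 1 \<in> {0<..1} then sqrt (2 ^ (i + 1)) * fs i (2 ^ (i + 1) * t - 1) else 0)"

definition spread :: "(nat \<Rightarrow> real \<Rightarrow> real) \<Rightarrow> real \<Rightarrow> real" where
  "spread fs t = (\<Sum>i. piece fs i t)"

lemma piece_unique:
  fixes t :: real
  assumes "2 ^ (i + 1) * t - 1 \<in> {0<..1}" "2 ^ (j + 1) * t - 1 \<in> {0<..1}"
  shows "i = j"
proof -
  have *: False if "a < b" "2 ^ (a + 1) * t - 1 \<in> {0<..1}" "2 ^ (b + 1) * t - 1 \<in> {0<..1}" for a b :: nat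
  proof -
    have "2 ^ (a + 1) * t > 0" using that(2) unfolding greaterThanAtMost_iff by linarith
    then have "t > 0" by (simp add: zero_less_mult_iff)
    have "2 * 2 ^ (a + 1) \<le> (2::real) ^ (b + 1)"
      using that(1) power_increasing [of "Suc (a + 1)" "b + 1" "2::real"] by simp
    then have "2 * 2 ^ (a + 1) * t \<le> 2 ^ (b + 1) * t"
      using \<open>t > 0\<close> by (intro mult_right_mono) auto
    moreover have "1 < 2 ^ (a + 1) * t" "2 ^ (b + 1) * t \<le> 2" using that by auto
    ultimately show False unfolding mult.assoc by linarith
  qed
  show ?thesis using * [of i j] * [of j i] assms by (meson linorder_neqE_nat)
qed

lemma spread_eq:
  "(\<forall>i fs. piece fs i t = 0) \<and> (\<forall>fs. spread fs t = 0) \<or>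
   (\<exists>i. (\<forall>fs j. j \<noteq> i \<longrightarrow> piece fs j t = 0) \<and> (\<forall>fs. spread fs t = piece fs i t))"
proof (cases "\<exists>i. 2 ^ (i + 1) * t - 1 \<in> {0<..1}")
  case True
  then obtain i where i: "2 ^ (i + 1) * t - 1 \<in> {0<..1}" ..
  have "piece fs j t = 0" if "j \<noteq> i" for fs j
    using piece_unique [OF i, of j] that by (auto simp: piece_def)
  moreover from this have "spread fs t = piece fs i t" for fs
    unfolding spread_def by (subst suminf_finite [of "{i}"]) auto
  ultimately show ?thesis by blast
next
  case False
  then have "piece fs j t = 0" for fs j by (auto simp: piece_def)
  then show ?thesis by (auto simp: spread_def)
qed

lemma spread_diff: "spread f t - spread g t = spread (\<lambda>i s. f i s - g i s) t"
proof -
  have "piece f i t - piece g i t = piece (\<lambda>i s. f i s - g i s) i t" for i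
    by (auto simp: piece_def algebra_simps)
  then show ?thesis using spread_eq [of t] by auto
qed

lemma spread_sq: "ennreal ((spread fs t)\<^sup>2) = (\<Sum>i. ennreal ((piece fs i t)\<^sup>2))"
  using spread_eq [of t]
proof (elim disjE exE conjE)
  fix i assume i: "\<forall>fs j. j \<noteq> i \<longrightarrow> piece fs j t = 0" "\<forall>fs. spread fs t = piece fs i t"
  have "(\<Sum>i. ennreal ((piece fs i t)\<^sup>2)) = (\<Sum>i\<in>{i}. ennreal ((piece fs i t)\<^sup>2))"
    using i by (intro suminf_finite) auto
  then show ?thesis using i by simp
qed auto

lemma piece_outside: "t \<notin> {0..1} \<Longrightarrow> piece fs i t = 0"
proof (rule ccontr)
  assume t: "t \<notin> {0..1}" "piece fs i t \<noteq> 0"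
  then have s: "0 < 2 ^ (i + 1) * t - 1" "2 ^ (i + 1) * t - 1 \<le> 1" by (auto simp: piece_def split: if_splits)
  have p: "(2::real) \<le> 2 ^ (i + 1)" by simp
  show False
  proof (cases "t < 0")
    case True then show False using s(1) p mult_pos_neg [of "2 ^ (i + 1)" t] by linarith
  next
    case False
    then have "t > 1" using t by auto
    then have "2 * 1 < 2 ^ (i + 1) * t" using p by (intro mult_le_less_imp_less) auto
    then show False using s by simp
  qed
qed

lemma nn_integral_piece:
  assumes "fs i \<in> borel_measurable I01"
  shows "piece fs i \<in> borel_measurable lebesgue"
    and "(\<integral>\<^sup>+t. ennreal ((piece fs i t)\<^sup>2) \<partial>lebesgue) = (\<integral>\<^sup>+t. ennreal ((fs i t)\<^sup>2) \<partial>I01)"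
proof -
  define g where "g t = (if t \<in> {0<..1} then fs i t else 0)" for t :: real
  have "fs i \<in> borel_measurable (lebesgue_on {0<..1})"
    using assms by (rule measurable_restrict_mono) auto
  then have g: "g \<in> borel_measurable lebesgue"
    unfolding g_def by (rule borel_measurable_if_I) auto
  define c :: real where "c = 2 ^ (i + 1)"
  have c: "c > 0" by (simp add: c_def)
  have eq: "piece fs i t = sqrt c * g (- 1 + c * t)" for t
    by (auto simp: piece_def g_def c_def)
  have "(\<lambda>t. g (- 1 + c *\<^sub>R t)) \<in> borel_measurable lebesgue"
    using c by (intro borel_measurable_affine g) auto
  then have gc [measurable]: "(\<lambda>t. g (- 1 + c * t)) \<in> borel_measurable lebesgue" by simp
  then show "piece fs i \<in> borel_measurable lebesgue"
    unfolding eq [abs_def] by measurable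
  have "(\<integral>\<^sup>+t. ennreal ((piece fs i t)\<^sup>2) \<partial>lebesgue) = (\<integral>\<^sup>+t. ennreal c * ennreal ((g (- 1 + c * t))\<^sup>2) \<partial>lebesgue)"
    using c by (intro nn_integral_cong) (simp add: eq power_mult_distrib ennreal_mult)
  also have "\<dots> = ennreal c * (\<integral>\<^sup>+t. ennreal ((g (- 1 + c * t))\<^sup>2) \<partial>lebesgue)"
    by (intro nn_integral_cmult) measurable
  also have "\<dots> = (\<integral>\<^sup>+t. ennreal ((g t)\<^sup>2) \<partial>lebesgue)"
    using c g by (subst (2) nn_integral_real_affine_lebesgue [of _ c "-1"]) auto
  also have "\<dots> = (\<integral>\<^sup>+t. ennreal ((fs i t)\<^sup>2) * indicator {0..1} t \<partial>lebesgue)"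
  proof (rule nn_integral_cong_AE)
    have "AE t in lebesgue. t \<noteq> (0::real)"
      by (rule AE_I [of _ _ "{0}"]) (auto simp: emeasure_completion)
    then show "AE t in lebesgue. ennreal ((g t)\<^sup>2) = ennreal ((fs i t)\<^sup>2) * indicator {0..1} t"
      by eventually_elim (auto simp: g_def split: split_indicator)
  qed
  also have "\<dots> = (\<integral>\<^sup>+t. ennreal ((fs i t)\<^sup>2) \<partial>I01)"
    by (subst nn_integral_restrict_space) auto
  finally show "(\<integral>\<^sup>+t. ennreal ((piece fs i t)\<^sup>2) \<partial>lebesgue) = (\<integral>\<^sup>+t. ennreal ((fs i t)\<^sup>2) \<partial>I01)" .
qed

lemma spread_L2:
  assumes fs: "\<And>i. fs i \<in> L2_fun" and sm: "summable (\<lambda>i. (L2_norm (fs i))\<^sup>2)"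
  shows "spread fs \<in> L2_fun" "(L2_norm (spread fs))\<^sup>2 = (\<Sum>i. (L2_norm (fs i))\<^sup>2)"
proof -
  have m: "fs i \<in> borel_measurable I01" for i using fs by (auto simp: L2_fun_def)
  note pm [measurable] = nn_integral_piece(1) [of fs, OF m]
  have "(\<lambda>t. spread fs t) \<in> borel_measurable lebesgue"
    unfolding spread_def by measurable
  then have sp [measurable]: "spread fs \<in> borel_measurable I01"
    by (simp add: measurable_restrict_space1)
  have out: "spread fs t = 0" if "t \<notin> {0..1}" for t
    using piece_outside [OF that] by (simp add: spread_def)
  have "(\<integral>\<^sup>+t. ennreal ((spread fs t)\<^sup>2) \<partial>I01) = (\<integral>\<^sup>+t. ennreal ((spread fs t)\<^sup>2) * indicator {0..1} t \<partial>lebesgue)"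
    by (subst nn_integral_restrict_space) auto
  also have "\<dots> = (\<integral>\<^sup>+t. (\<Sum>i. ennreal ((piece fs i t)\<^sup>2)) \<partial>lebesgue)"
    using out by (intro nn_integral_cong) (auto simp: spread_sq [symmetric] split: split_indicator)
  also have "\<dots> = (\<Sum>i. \<integral>\<^sup>+t. ennreal ((piece fs i t)\<^sup>2) \<partial>lebesgue)"
    by (intro nn_integral_suminf) measurable
  also have "\<dots> = (\<Sum>i. ennreal ((L2_norm (fs i))\<^sup>2))"
    using fs by (simp add: nn_integral_piece(2) [OF m] L2_norm_sq nn_integral_eq_integral L2_fun_def)
  also have "\<dots> = ennreal (\<Sum>i. (L2_norm (fs i))\<^sup>2)"
    using sm by (intro suminf_ennreal2) auto
  finally have eq: "(\<integral>\<^sup>+t. ennreal ((spread fs t)\<^sup>2) \<partial>I01) = ennreal (\<Sum>i. (L2_norm (fs i))\<^sup>2)" .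
  then have "integrable I01 (\<lambda>t. (spread fs t)\<^sup>2)"
    by (intro integrableI_nonneg) auto
  then show "spread fs \<in> L2_fun" by (simp add: L2_fun_def)
  show "(L2_norm (spread fs))\<^sup>2 = (\<Sum>i. (L2_norm (fs i))\<^sup>2)"
    unfolding L2_norm_sq [of "spread fs"] using sm
    by (subst integral_eq_nn_integral) (auto simp: eq suminf_nonneg)
qed

lemma L2_kernel_suminf:
  assumes k: "\<And>i::nat. L2_kernel X (\<psi> i)"
    and sm: "\<And>x y. x \<in> X \<Longrightarrow> y \<in> X \<Longrightarrow> summable (\<lambda>i. \<psi> i x y)"
  shows "L2_kernel X (\<lambda>x y. \<Sum>i. \<psi> i x y)"
proof (cases "X = {}")
  case False
  then obtain o' where o': "o' \<in> X" by auto
  obtain F where F: "\<And>i. F i ` X \<subseteq> L2_fun"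
    "\<And>i x y. x \<in> X \<Longrightarrow> y \<in> X \<Longrightarrow> (L2_dist (F i x) (F i y))\<^sup>2 = \<psi> i x y"
    using k unfolding L2_kernel_def by metis
  \<comment> \<open>Subtracting the value at a base point makes the pieces square summable.\<close>
  define f where "f x i t = F i x t - F i o' t" for x i t
  have fL: "f x i \<in> L2_fun" if "x \<in> X" for x i
    unfolding f_def using F(1) o' that by (intro L2_fun_diff) auto
  have nf: "(L2_norm (f x i))\<^sup>2 = \<psi> i x o'" if "x \<in> X" for x i
    using F(2) [OF that o', of i] by (simp add: f_def [abs_def] L2_dist_def)
  have nd: "(L2_norm (\<lambda>t. f x i t - f y i t))\<^sup>2 = \<psi> i x y" if "x \<in> X" "y \<in> X" for x y i
    using F(2) [OF that, of i] by (simp add: f_def [abs_def] L2_dist_def)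
  have "spread (f x) \<in> L2_fun" if "x \<in> X" for x
    using fL nf that sm o' by (intro spread_L2) auto
  moreover have "(L2_dist (spread (f x)) (spread (f y)))\<^sup>2 = (\<Sum>i. \<psi> i x y)" if "x \<in> X" "y \<in> X" for x y
  proof -
    have "(L2_dist (spread (f x)) (spread (f y)))\<^sup>2 = (L2_norm (spread (\<lambda>i t. f x i t - f y i t)))\<^sup>2"
      by (simp add: L2_dist_def spread_diff)
    also have "\<dots> = (\<Sum>i. (L2_norm (\<lambda>t. f x i t - f y i t))\<^sup>2)"
      using that fL nd sm by (intro spread_L2 L2_fun_diff) auto
    finally show ?thesis using nd that by simp
  qed
  ultimately show ?thesis
    unfolding L2_kernel_def by (intro exI [of _ "\<lambda>x. spread (f x)"]) auto
qed (simp add: L2_kernel_def)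

text \<open>Countably many pairs, each with finitely many nonzero terms, involve countably many indices only;
  so the index type itself may be uncountable.\<close>

lemma L2_kernel_sum_finite_support:
  assumes X: "countable X" and k: "\<And>i. L2_kernel X (\<psi> i)"
    and fin: "\<And>x y. x \<in> X \<Longrightarrow> y \<in> X \<Longrightarrow> finite {i. \<psi> i x y \<noteq> 0}"
  shows "L2_kernel X (\<lambda>x y. \<Sum>i | \<psi> i x y \<noteq> 0. \<psi> i x y)"
proof -
  define J where "J = (\<Union>x\<in>X. \<Union>y\<in>X. {i. \<psi> i x y \<noteq> 0})"
  have J: "countable J"
    unfolding J_def using fin by (intro countable_UN [OF X] countable_finite)
  define e where "e = to_nat_on J"
  have e: "inj_on e J" using J unfolding e_def by (rule inj_on_to_nat_on)
  define \<phi> where "\<phi> n = (if n \<in> e ` J then \<psi> (inv_into J e n) else (\<lambda>x y. 0))" for n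
  have "L2_kernel X (\<phi> n)" for n
    using k L2_kernel_scalar [of X "\<lambda>_. 0"] by (simp add: \<phi>_def)
  moreover have sums: "(\<lambda>n. \<phi> n x y) sums (\<Sum>i | \<psi> i x y \<noteq> 0. \<psi> i x y)" if "x \<in> X" "y \<in> X" for x y
  proof -
    let ?A = "{i. \<psi> i x y \<noteq> 0}"
    have A: "?A \<subseteq> J" using that by (auto simp: J_def)
    have "(\<lambda>n. \<phi> n x y) sums (\<Sum>n\<in>e ` ?A. \<phi> n x y)"
    proof (intro sums_finite)
      fix n assume n: "n \<notin> e ` ?A"
      show "\<phi> n x y = 0"
      proof (cases "n \<in> e ` J")
        case True
        then have "inv_into J e n \<notin> ?A" using n f_inv_into_f by (metis imageI)
        then show ?thesis by (simp add: \<phi>_def)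
      qed (simp add: \<phi>_def)
    qed (use fin [OF that] in simp)
    also have "(\<Sum>n\<in>e ` ?A. \<phi> n x y) = (\<Sum>i\<in>?A. \<phi> (e i) x y)"
      using inj_on_subset [OF e A] by (simp add: sum.reindex)
    also have "\<dots> = (\<Sum>i\<in>?A. \<psi> i x y)"
    proof (intro sum.cong refl)
      fix i assume "i \<in> ?A"
      then have "i \<in> J" using A by auto
      then show "\<phi> (e i) x y = \<psi> i x y"
        using inv_into_f_f [OF e] by (simp add: \<phi>_def)
    qed
    finally show ?thesis .
  qed
  ultimately have "L2_kernel X (\<lambda>x y. \<Sum>n. \<phi> n x y)"
    by (intro L2_kernel_suminf) (auto simp: sums_iff)
  then show ?thesis
    by (rule L2_kernel_cong) (use sums in \<open>auto simp: sums_iff\<close>)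
qed

lemma L2_kernel_card:
  fixes P :: "'i \<Rightarrow> 'g \<Rightarrow> bool"
  assumes X: "countable X" and fin: "\<And>x y. x \<in> X \<Longrightarrow> y \<in> X \<Longrightarrow> finite {i. P i x \<noteq> P i y}"
  shows "L2_kernel X (\<lambda>x y. real (card {i. P i x \<noteq> P i y}))"
proof -
  define \<psi> where "\<psi> i x y = (of_bool (P i x) - of_bool (P i y) :: real)\<^sup>2" for i x y
  have eq: "{i. \<psi> i x y \<noteq> 0} = {i. P i x \<noteq> P i y}" for x y by (auto simp: \<psi>_def)
  have "L2_kernel X (\<lambda>x y. \<Sum>i | \<psi> i x y \<noteq> 0. \<psi> i x y)"
  proof (rule L2_kernel_sum_finite_support [OF X])
    show "L2_kernel X (\<psi> i)" for i
      unfolding \<psi>_def by (rule L2_kernel_scalar)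
  qed (unfold eq, rule fin)
  then show ?thesis
  proof (rule L2_kernel_cong)
    fix x y
    have "(\<Sum>i | P i x \<noteq> P i y. \<psi> i x y) = (\<Sum>i | P i x \<noteq> P i y. 1)"
      by (intro sum.cong refl) (auto simp: \<psi>_def)
    then show "(\<Sum>i | \<psi> i x y \<noteq> 0. \<psi> i x y) = real (card {i. P i x \<noteq> P i y})"
      unfolding eq by simp
  qed
qed

section \<open>Compression exponents through kernels\<close>

context word_metric
begin

text \<open>Along a path of length \<open>n + 1\<close> the weighted triangle inequality with \<open>t = 1 / n\<close> reproduces the
  bound exactly: \<open>(1 + 1 / n) n\<^sup>2 + (1 + n) = (n + 1)\<^sup>2\<close>. Hence it suffices to bound a kernel on
  generators.\<close>

lemma L2_kernel_lipschitz:
  assumes k: "L2_kernel (carrier G) \<psi>"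
    and C: "\<And>x s. x \<in> carrier G \<Longrightarrow> s \<in> S \<Longrightarrow> \<psi> x (x \<otimes> s) \<le> C"
    and xy: "x \<in> carrier G" "y \<in> carrier G"
  shows "\<psi> x y \<le> C * (real (dst x y))\<^sup>2"
proof -
  have *: "\<psi> x (foldl (\<otimes>) x ws) \<le> C * (real (length ws))\<^sup>2" if "set ws \<subseteq> S" for ws
    using that
  proof (induction ws rule: rev_induct)
    case Nil
    then show ?case using L2_kernel_refl [OF k xy(1)] by simp
  next
    case (snoc s ws)
    define z where "z = foldl (\<otimes>) x ws"
    define n where "n = real (length ws)"
    have z: "z \<in> carrier G" using dst_foldl_le [of x ws] xy snoc by (auto simp: z_def)
    have s: "s \<in> S" "s \<in> carrier G" using snoc S_carrier by auto
    have IH: "\<psi> x z \<le> C * n\<^sup>2" using snoc by (simp add: z_def n_def)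
    have "\<psi> x (z \<otimes> s) \<le> C * (n + 1)\<^sup>2"
    proof (cases "n = 0")
      case True
      then show ?thesis using C [OF xy(1) s(1)] by (simp add: z_def n_def)
    next
      case False
      then have n: "n > 0" by (simp add: n_def)
      have "\<psi> x (z \<otimes> s) \<le> (1 + 1 / n) * \<psi> x z + (1 + 1 / (1 / n)) * \<psi> z (z \<otimes> s)"
        using n xy z s by (intro L2_kernel_triangle [OF k]) auto
      also have "\<dots> \<le> (1 + 1 / n) * (C * n\<^sup>2) + (1 + 1 / (1 / n)) * C"
        using n IH C [OF z s(1)] by (intro add_mono mult_left_mono) auto
      also have "\<dots> = C * (n + 1)\<^sup>2"
        using n by (simp add: power2_eq_square field_simps)
      finally show ?thesis .
    qed
    then show ?case by (simp add: z_def n_def add.commute)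
  qed
  obtain ws where "set ws \<subseteq> S" "length ws = dst x y" "foldl (\<otimes>) x ws = y"
    using dst_walk [OF xy] .
  then show ?thesis using * [of ws] by simp
qed

lemma compression_admissible_iff:
  "compression_admissible G S \<alpha> \<longleftrightarrow>
     (\<exists>\<psi> C c. L2_kernel (carrier G) \<psi> \<and> 0 < c \<and>
        (\<forall>x\<in>carrier G. \<forall>y\<in>carrier G. \<psi> x y \<le> C * (real (dst x y))\<^sup>2) \<and>
        (\<forall>x\<in>carrier G. \<forall>y\<in>carrier G. x \<noteq> y \<longrightarrow> c * real (dst x y) powr (2 * \<alpha>) \<le> \<psi> x y))"
    (is "?L \<longleftrightarrow> ?R")
proof
  assume ?L
  then obtain f L c where f: "f ` carrier G \<subseteq> L2_fun"
    and L': "\<forall>x\<in>carrier G. \<forall>y\<in>carrier G. L2_dist (f x) (f y) \<le> L * real (dst x y)"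
    and c1: "c > 0"
    and c': "\<forall>x\<in>carrier G. \<forall>y\<in>carrier G. x \<noteq> y \<longrightarrow>
        c * real (dst x y) powr \<alpha> \<le> L2_dist (f x) (f y)"
    unfolding compression_admissible_def by (elim exE conjE)
  note L = L' [rule_format] and c = c1 c' [rule_format]
  have "L2_kernel (carrier G) (\<lambda>x y. (L2_dist (f x) (f y))\<^sup>2)"
    using f by (auto simp: L2_kernel_def)
  moreover have "(L2_dist (f x) (f y))\<^sup>2 \<le> L\<^sup>2 * (real (dst x y))\<^sup>2"
    if "x \<in> carrier G" "y \<in> carrier G" for x y
    using power_mono [OF L [OF that], of 2] by (simp add: power_mult_distrib)
  moreover have "c\<^sup>2 * real (dst x y) powr (2 * \<alpha>) \<le> (L2_dist (f x) (f y))\<^sup>2"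
    if "x \<in> carrier G" "y \<in> carrier G" "x \<noteq> y" for x y
  proof -
    have "(c * real (dst x y) powr \<alpha>)\<^sup>2 \<le> (L2_dist (f x) (f y))\<^sup>2"
      using c(2) [OF that] c(1) by (intro power_mono) auto
    moreover have "(real (dst x y) powr \<alpha>)\<^sup>2 = real (dst x y) powr (2 * \<alpha>)"
      by (simp add: power2_eq_square powr_add [symmetric])
    ultimately show ?thesis by (simp add: power_mult_distrib)
  qed
  moreover have "0 < c\<^sup>2" using c by simp
  ultimately show ?R
    by (intro exI [of _ "\<lambda>x y. (L2_dist (f x) (f y))\<^sup>2"] exI [of _ "L\<^sup>2"] exI [of _ "c\<^sup>2"]
        conjI ballI impI)
next
  assume ?R
  then obtain \<psi> C c where k: "L2_kernel (carrier G) \<psi>" and c: "0 < c"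
    and C1: "\<forall>x\<in>carrier G. \<forall>y\<in>carrier G. \<psi> x y \<le> C * (real (dst x y))\<^sup>2"
    and c1: "\<forall>x\<in>carrier G. \<forall>y\<in>carrier G. x \<noteq> y \<longrightarrow> c * real (dst x y) powr (2 * \<alpha>) \<le> \<psi> x y"
    by (elim exE conjE)
  note C = C1 [rule_format] and c' = c1 [rule_format]
  obtain f where f: "f ` carrier G \<subseteq> L2_fun"
    "\<And>x y. x \<in> carrier G \<Longrightarrow> y \<in> carrier G \<Longrightarrow> (L2_dist (f x) (f y))\<^sup>2 = \<psi> x y"
    using k unfolding L2_kernel_def by blast
  have "L2_dist (f x) (f y) \<le> sqrt \<bar>C\<bar> * real (dst x y)" if "x \<in> carrier G" "y \<in> carrier G" for x y
  proof (rule power2_le_imp_le)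
    have "(L2_dist (f x) (f y))\<^sup>2 \<le> C * (real (dst x y))\<^sup>2" using f(2) C that by simp
    also have "\<dots> \<le> \<bar>C\<bar> * (real (dst x y))\<^sup>2" by (intro mult_right_mono) auto
    finally show "(L2_dist (f x) (f y))\<^sup>2 \<le> (sqrt \<bar>C\<bar> * real (dst x y))\<^sup>2"
      by (simp add: power_mult_distrib)
  qed simp
  moreover have "sqrt c * real (dst x y) powr \<alpha> \<le> L2_dist (f x) (f y)"
    if "x \<in> carrier G" "y \<in> carrier G" "x \<noteq> y" for x y
  proof (rule power2_le_imp_le)
    have "(real (dst x y) powr \<alpha>)\<^sup>2 = real (dst x y) powr (2 * \<alpha>)"
      by (simp add: power2_eq_square powr_add [symmetric])
    then show "(sqrt c * real (dst x y) powr \<alpha>)\<^sup>2 \<le> (L2_dist (f x) (f y))\<^sup>2"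
      using c' [OF that] c f(2) that by (simp add: power_mult_distrib)
  qed simp
  moreover have "sqrt c > 0" using c by simp
  ultimately show ?L
    unfolding compression_admissible_def
    by (intro exI [of _ f] conjI f(1) exI [of _ "sqrt \<bar>C\<bar>"] exI [of _ "sqrt c"]
        ballI impI)
qed

lemma compression_admissible_antimono:
  assumes "compression_admissible G S \<alpha>" "\<beta> \<le> \<alpha>"
  shows "compression_admissible G S \<beta>"
proof -
  have *: "real (dst x y) powr \<beta> \<le> real (dst x y) powr \<alpha>"
    if "x \<in> carrier G" "y \<in> carrier G" "x \<noteq> y" for x y
  proof -
    have "dst x y \<noteq> 0" using that dst_eq_0_iff by blast
    then show ?thesis using assms(2) by (intro powr_mono) auto
  qed
  obtain f L c where f: "f ` carrier G \<subseteq> L2_fun"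
    and L: "\<forall>x\<in>carrier G. \<forall>y\<in>carrier G. L2_dist (f x) (f y) \<le> L * real (dst x y)"
    and c: "c > 0" "\<forall>x\<in>carrier G. \<forall>y\<in>carrier G. x \<noteq> y \<longrightarrow>
        c * real (dst x y) powr \<alpha> \<le> L2_dist (f x) (f y)"
    using assms(1) unfolding compression_admissible_def by (elim exE conjE)
  have "c * real (dst x y) powr \<beta> \<le> L2_dist (f x) (f y)"
    if xy: "x \<in> carrier G" "y \<in> carrier G" "x \<noteq> y" for x y
  proof -
    have "c * real (dst x y) powr \<beta> \<le> c * real (dst x y) powr \<alpha>"
      using * [OF xy] c(1) by (intro mult_left_mono) auto
    also have "\<dots> \<le> L2_dist (f x) (f y)" using c(2) xy by blast
    finally show ?thesis .
  qed
  then have "\<forall>x\<in>carrier G. \<forall>y\<in>carrier G. x \<noteq> y \<longrightarrow>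
      c * real (dst x y) powr \<beta> \<le> L2_dist (f x) (f y)" by (intro ballI impI)
  then show ?thesis
    unfolding compression_admissible_def using f L c(1)
    by (intro exI [of _ f] conjI exI [of _ L] exI [of _ c])
qed

lemma hilbert_compression_SUP:
  "hilbert_compression G = (SUP \<alpha> \<in> {\<alpha>. 0 \<le> \<alpha> \<and> compression_admissible G S \<alpha>}. ereal \<alpha>)"
  using hilbert_compression_eq [OF gen] by (simp add: hilbert_compression_wrt_def)

section \<open>Tours\<close>

primrec visited :: "'a \<Rightarrow> 'a list \<Rightarrow> 'a set" where
  "visited x [] = {x}"
| "visited x (t # ts) = insert x (visited (x \<otimes> t) ts)"

lemma visited_start: "x \<in> visited x ts"
  by (cases ts) auto

lemma visited_append: "visited x (us @ vs) = visited x us \<union> visited (foldl (\<otimes>) x us) vs"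
  by (induction us arbitrary: x) (auto simp: visited_start)

lemma visited_split: "q \<in> visited x ts \<Longrightarrow> \<exists>us vs. ts = us @ vs \<and> foldl (\<otimes>) x us = q"
proof (induction ts arbitrary: x)
  case (Cons t ts)
  show ?case
  proof (cases "q = x")
    case False
    then have "q \<in> visited (x \<otimes> t) ts" using Cons.prems by simp
    from Cons.IH [OF this] obtain us vs where "ts = us @ vs" "foldl (\<otimes>) (x \<otimes> t) us = q"
      by blast
    then show ?thesis by (intro exI [of _ "t # us"] exI [of _ vs]) simp
  qed (intro exI [of _ "[]"] exI [of _ "t # ts"], simp)
qed simp

definition tour :: "'a \<Rightarrow> 'a set \<Rightarrow> nat \<Rightarrow> bool" where
  "tour x A n \<longleftrightarrow>
     (\<exists>ts. set ts \<subseteq> S \<and> length ts \<le> n \<and> foldl (\<otimes>) x ts = x \<and> A \<subseteq> visited x ts)"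

lemma tour_start: "tour x {x} 0"
  unfolding tour_def by (intro exI [of _ "[]"]) simp

lemma tour_mono: "tour x A n \<Longrightarrow> B \<subseteq> A \<Longrightarrow> n \<le> m \<Longrightarrow> tour x B m"
  unfolding tour_def by (meson order_trans)

lemma tour_insert:
  assumes t: "tour x A n" and q: "q \<in> A" "q \<in> carrier G" and p: "p \<in> carrier G"
  shows "tour x (insert p A) (n + 2 * dst q p)"
proof -
  obtain ts where ts: "set ts \<subseteq> S" "length ts \<le> n" "foldl (\<otimes>) x ts = x" "A \<subseteq> visited x ts"
    using t by (auto simp: tour_def)
  obtain us vs where uv: "ts = us @ vs" "foldl (\<otimes>) x us = q"
    using visited_split [of q x ts] ts q by blast
  obtain l1 where l1: "set l1 \<subseteq> S" "length l1 = dst q p" "foldl (\<otimes>) q l1 = p"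
    using dst_walk [OF q(2) p] .
  obtain l2 where l2: "set l2 \<subseteq> S" "length l2 = dst p q" "foldl (\<otimes>) p l2 = q"
    using dst_walk [OF p q(2)] .
  let ?ts = "us @ l1 @ l2 @ vs"
  have "foldl (\<otimes>) q vs = x" using ts(3) uv by simp
  moreover have "insert p A \<subseteq> visited x ?ts"
    using ts(4) uv l1 l2 visited_start [of p l2] by (auto simp: visited_append)
  moreover have "length ?ts \<le> n + 2 * dst q p"
    using ts(2) uv l1 l2 dst_commute [OF q(2) p] by simp
  moreover have "set ?ts \<subseteq> S" using ts uv l1 l2 by auto
  ultimately show ?thesis
    unfolding tour_def using uv l1 l2 by (intro exI [of _ ?ts]) auto
qed

text \<open>Each new point costs one detour, there and back, from a point that the tour already visits.\<close>

lemma tour_extend: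
  assumes "finite A" "tour x M n" "A \<subseteq> carrier G" "M \<subseteq> carrier G"
    and "\<And>p. p \<in> A \<Longrightarrow> \<exists>q\<in>M. dst q p \<le> r"
  shows "tour x (A \<union> M) (n + 2 * r * card A)"
  using assms(1,3,5)
proof (induction A rule: finite_induct)
  case empty
  then show ?case using assms by simp
next
  case (insert p A)
  obtain q where q: "q \<in> M" "dst q p \<le> r" using insert by blast
  have "tour x (insert p (A \<union> M)) (n + 2 * r * card A + 2 * dst q p)"
    using insert q assms by (intro tour_insert [of _ _ _ q]) auto
  then show ?case using insert q by (elim tour_mono) auto
qed

lemma tour_exists:
  assumes "finite A" "x \<in> carrier G" "A \<subseteq> carrier G"
  shows "\<exists>n. tour x A n"
proof -
  have "tour x (A \<union> {x}) (0 + 2 * Max (insert 0 (dst x ` A)) * card A)"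
    using assms by (intro tour_extend tour_start) auto
  then show ?thesis by (blast intro: tour_mono)
qed

end

section \<open>The word metric of a wreath product\<close>

locale wreath_metric = G: word_metric G S + H: word_metric H T
  for G :: "('a, 'm) monoid_scheme" and S and H :: "('b, 'n) monoid_scheme" and T
begin

abbreviation W where "W \<equiv> G \<wr> H"

sublocale W: group W
  by (rule group_wreath_product) unfold_locales

definition no_lamps :: "'b \<Rightarrow> 'a" where "no_lamps = (\<lambda>z\<in>carrier H. \<one>\<^bsub>G\<^esub>)"

definition lamp :: "'a \<Rightarrow> 'b \<Rightarrow> 'a" where
  "lamp s = (\<lambda>z\<in>carrier H. if z = \<one>\<^bsub>H\<^esub> then s else \<one>\<^bsub>G\<^esub>)"

definition SW :: "(('b \<Rightarrow> 'a) \<times> 'b) set" where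
  "SW = (\<lambda>s. (lamp s, \<one>\<^bsub>H\<^esub>)) ` S \<union> (\<lambda>t. (no_lamps, t)) ` T"

definition diff :: "('b \<Rightarrow> 'a) \<Rightarrow> ('b \<Rightarrow> 'a) \<Rightarrow> 'b set" where
  "diff \<eta> \<eta>' = {z \<in> carrier H. \<eta> z \<noteq> \<eta>' z}"

definition lamp_dist :: "('b \<Rightarrow> 'a) \<Rightarrow> ('b \<Rightarrow> 'a) \<Rightarrow> nat" where
  "lamp_dist \<eta> \<eta>' = (\<Sum>z\<in>diff \<eta> \<eta>'. G.dst (\<eta> z) (\<eta>' z))"

lemma W_carrier_iff: "(\<eta>, x) \<in> carrier W \<longleftrightarrow>
    \<eta> \<in> carrier H \<rightarrow>\<^sub>E carrier G \<and> finite {z \<in> carrier H. \<eta> z \<noteq> \<one>\<^bsub>G\<^esub>} \<and> x \<in> carrier H"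
  by (auto simp: wreath_product_def)

lemma W_carrierD:
  assumes "(\<eta>, x) \<in> carrier W"
  shows "x \<in> carrier H" "z \<in> carrier H \<Longrightarrow> \<eta> z \<in> carrier G" "\<eta> \<in> extensional (carrier H)"
    "finite {z \<in> carrier H. \<eta> z \<noteq> \<one>\<^bsub>G\<^esub>}"
  using assms by (auto simp: W_carrier_iff PiE_iff)

lemma W_update:
  assumes "(\<eta>, x) \<in> carrier W" "z \<in> carrier H" "g \<in> carrier G" "y \<in> carrier H"
  shows "(\<eta>(z := g), y) \<in> carrier W"
proof -
  have "{w \<in> carrier H. (\<eta>(z := g)) w \<noteq> \<one>\<^bsub>G\<^esub>} \<subseteq> insert z {w \<in> carrier H. \<eta> w \<noteq> \<one>\<^bsub>G\<^esub>}" by auto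
  then have "finite {w \<in> carrier H. (\<eta>(z := g)) w \<noteq> \<one>\<^bsub>G\<^esub>}"
    using W_carrierD(4) [OF assms(1)] finite_subset by blast
  moreover have "\<eta>(z := g) \<in> carrier H \<rightarrow>\<^sub>E carrier G"
    using assms by (auto simp: W_carrier_iff PiE_iff extensional_def)
  ultimately show ?thesis using assms(4) by (simp only: W_carrier_iff)
qed

lemma W_no_lamps: "x \<in> carrier H \<Longrightarrow> (no_lamps, x) \<in> carrier W"
  by (simp add: W_carrier_iff no_lamps_def cong: conj_cong)

lemma W_one: "\<one>\<^bsub>W\<^esub> = (no_lamps, \<one>\<^bsub>H\<^esub>)"
  by (simp add: wreath_product_def no_lamps_def)

lemma lamp_eq: "lamp s = no_lamps(\<one>\<^bsub>H\<^esub> := s)"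
  by (auto simp: lamp_def no_lamps_def fun_eq_iff)

lemma W_lamp: "s \<in> carrier G \<Longrightarrow> (lamp s, \<one>\<^bsub>H\<^esub>) \<in> carrier W"
  unfolding lamp_eq by (intro W_update [OF W_no_lamps [of "\<one>\<^bsub>H\<^esub>"]]) auto

lemma mult_lamp:
  assumes "(\<eta>, x) \<in> carrier W" "s \<in> carrier G"
  shows "(\<eta>, x) \<otimes>\<^bsub>W\<^esub> (lamp s, \<one>\<^bsub>H\<^esub>) = (\<eta>(x := \<eta> x \<otimes>\<^bsub>G\<^esub> s), x)"
proof -
  note c = W_carrierD [OF assms(1)]
  have "(\<lambda>z\<in>carrier H. \<eta> z \<otimes>\<^bsub>G\<^esub> lamp s (inv\<^bsub>H\<^esub> x \<otimes>\<^bsub>H\<^esub> z)) = \<eta>(x := \<eta> x \<otimes>\<^bsub>G\<^esub> s)"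
  proof
    fix z
    show "(\<lambda>z\<in>carrier H. \<eta> z \<otimes>\<^bsub>G\<^esub> lamp s (inv\<^bsub>H\<^esub> x \<otimes>\<^bsub>H\<^esub> z)) z = (\<eta>(x := \<eta> x \<otimes>\<^bsub>G\<^esub> s)) z"
    proof (cases "z \<in> carrier H")
      case True
      then have "inv\<^bsub>H\<^esub> x \<otimes>\<^bsub>H\<^esub> z = \<one>\<^bsub>H\<^esub> \<longleftrightarrow> z = x"
        using c(1) H.dst_eq_0_iff [of x z] H.len_eq_0_iff [of "inv\<^bsub>H\<^esub> x \<otimes>\<^bsub>H\<^esub> z"]
        by (auto simp: word_dist_def)
      then show ?thesis using True c by (auto simp: lamp_def)
    next
      case False
      then show ?thesis using c by (auto simp: extensional_def)
    qed
  qed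
  then show ?thesis using c(1) by (simp add: wreath_product_def)
qed

lemma mult_move:
  assumes "(\<eta>, x) \<in> carrier W" "t \<in> carrier H"
  shows "(\<eta>, x) \<otimes>\<^bsub>W\<^esub> (no_lamps, t) = (\<eta>, x \<otimes>\<^bsub>H\<^esub> t)"
proof -
  note c = W_carrierD [OF assms(1)]
  have "(\<lambda>z\<in>carrier H. \<eta> z \<otimes>\<^bsub>G\<^esub> no_lamps (inv\<^bsub>H\<^esub> x \<otimes>\<^bsub>H\<^esub> z)) = \<eta>"
    using c by (auto simp: fun_eq_iff no_lamps_def extensional_def)
  then show ?thesis by (simp add: wreath_product_def)
qed

lemma SW_carrier: "SW \<subseteq> carrier W"
  using W_lamp W_no_lamps G.S_carrier H.S_carrier by (auto simp: SW_def)

lemma SW_inv: "w \<in> SW \<Longrightarrow> inv\<^bsub>W\<^esub> w \<in> SW"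
  unfolding SW_def
proof (elim UnE imageE)
  fix s assume w: "w = (lamp s, \<one>\<^bsub>H\<^esub>)" and s: "s \<in> S"
  then have sc: "s \<in> carrier G" "inv\<^bsub>G\<^esub> s \<in> carrier G" using G.S_carrier by auto
  have "(lamp (inv\<^bsub>G\<^esub> s), \<one>\<^bsub>H\<^esub>) \<otimes>\<^bsub>W\<^esub> w = \<one>\<^bsub>W\<^esub>"
    unfolding w mult_lamp [OF W_lamp [OF sc(2)] sc(1)] using sc
    by (auto simp: W_one lamp_eq no_lamps_def)
  then have "inv\<^bsub>W\<^esub> w = (lamp (inv\<^bsub>G\<^esub> s), \<one>\<^bsub>H\<^esub>)"
    using W_lamp sc w by (intro W.inv_equality) auto
  then show "inv\<^bsub>W\<^esub> w \<in> (\<lambda>s. (lamp s, \<one>\<^bsub>H\<^esub>)) ` S \<union> (\<lambda>t. (no_lamps, t)) ` T"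
    using s G.S_inv by auto
next
  fix t assume w: "w = (no_lamps, t)" and t: "t \<in> T"
  then have tc: "t \<in> carrier H" "inv\<^bsub>H\<^esub> t \<in> carrier H" using H.S_carrier by auto
  have "(no_lamps, inv\<^bsub>H\<^esub> t) \<otimes>\<^bsub>W\<^esub> w = \<one>\<^bsub>W\<^esub>"
    unfolding w mult_move [OF W_no_lamps [OF tc(2)] tc(1)] using tc by (simp add: W_one)
  then have "inv\<^bsub>W\<^esub> w = (no_lamps, inv\<^bsub>H\<^esub> t)"
    using W_no_lamps tc w by (intro W.inv_equality) auto
  then show "inv\<^bsub>W\<^esub> w \<in> (\<lambda>s. (lamp s, \<one>\<^bsub>H\<^esub>)) ` S \<union> (\<lambda>t. (no_lamps, t)) ` T"
    using t H.S_inv by auto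
qed

text \<open>Distances are first expressed through words, without \<open>word_dist\<close>: it is these words that show
  that the set of generators does generate the wreath product.\<close>

definition reaches :: "('b \<Rightarrow> 'a) \<times> 'b \<Rightarrow> nat \<Rightarrow> ('b \<Rightarrow> 'a) \<times> 'b \<Rightarrow> bool" where
  "reaches p n q \<longleftrightarrow> (\<exists>ws. set ws \<subseteq> SW \<and> length ws \<le> n \<and> foldl (\<otimes>\<^bsub>W\<^esub>) p ws = q)"

lemma reaches_trans: "reaches p n q \<Longrightarrow> reaches q m r \<Longrightarrow> reaches p (n + m) r"
  unfolding reaches_def
proof (elim exE conjE)
  fix us vs assume "set us \<subseteq> SW" "length us \<le> n" "foldl (\<otimes>\<^bsub>W\<^esub>) p us = q"
    "set vs \<subseteq> SW" "length vs \<le> m" "foldl (\<otimes>\<^bsub>W\<^esub>) q vs = r"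
  then show "\<exists>ws. set ws \<subseteq> SW \<and> length ws \<le> n + m \<and> foldl (\<otimes>\<^bsub>W\<^esub>) p ws = r"
    by (intro exI [of _ "us @ vs"]) auto
qed

lemma reaches_mono: "reaches p n q \<Longrightarrow> n \<le> m \<Longrightarrow> reaches p m q"
  unfolding reaches_def by (elim exE conjE, rule exI, intro conjI) (assumption, erule order_trans)

lemma reaches_lamp:
  assumes p: "(\<eta>, x) \<in> carrier W" and g: "g \<in> carrier G"
  shows "reaches (\<eta>, x) (G.dst (\<eta> x) g) (\<eta>(x := g), x)"
proof -
  have x: "x \<in> carrier H" "\<eta> x \<in> carrier G" using W_carrierD [OF p] by auto
  obtain ws where ws: "set ws \<subseteq> S" "length ws = G.dst (\<eta> x) g" "foldl (\<otimes>\<^bsub>G\<^esub>) (\<eta> x) ws = g"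
    using G.dst_walk [OF x(2) g] .
  have *: "foldl (\<otimes>\<^bsub>W\<^esub>) (\<zeta>, x) (map (\<lambda>s. (lamp s, \<one>\<^bsub>H\<^esub>)) us) = (\<zeta>(x := foldl (\<otimes>\<^bsub>G\<^esub>) (\<zeta> x) us), x)"
    if "set us \<subseteq> S" "(\<zeta>, x) \<in> carrier W" for \<zeta> us
    using that
  proof (induction us arbitrary: \<zeta>)
    case (Cons u us)
    have u: "u \<in> carrier G" using Cons.prems G.S_carrier by auto
    have "(\<zeta>(x := \<zeta> x \<otimes>\<^bsub>G\<^esub> u), x) \<in> carrier W"
      using W_update [OF Cons.prems(2) x(1) _ x(1)] W_carrierD(2) [OF Cons.prems(2) x(1)] u by simp
    then have "foldl (\<otimes>\<^bsub>W\<^esub>) (\<zeta>(x := \<zeta> x \<otimes>\<^bsub>G\<^esub> u), x) (map (\<lambda>s. (lamp s, \<one>\<^bsub>H\<^esub>)) us) =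
        (\<zeta>(x := foldl (\<otimes>\<^bsub>G\<^esub>) (\<zeta> x \<otimes>\<^bsub>G\<^esub> u) us), x)"
      using Cons.IH [of "\<zeta>(x := \<zeta> x \<otimes>\<^bsub>G\<^esub> u)"] Cons.prems(1)
      unfolding fun_upd_same fun_upd_upd by (auto simp del: fun_upd_apply)
    then show ?case
      unfolding list.map foldl.simps mult_lamp [OF Cons.prems(2) u] .
  qed simp
  show ?thesis
    unfolding reaches_def using * [OF ws(1) p] ws
    by (intro exI [of _ "map (\<lambda>s. (lamp s, \<one>\<^bsub>H\<^esub>)) ws"]) (auto simp: SW_def)
qed

lemma reaches_move: "(\<eta>, x) \<in> carrier W \<Longrightarrow> t \<in> T \<Longrightarrow> reaches (\<eta>, x) 1 (\<eta>, x \<otimes>\<^bsub>H\<^esub> t)"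
  unfolding reaches_def using mult_move [of \<eta> x t] H.S_carrier
  by (intro exI [of _ "[(no_lamps, t)]"]) (auto simp: SW_def)

lemma finite_diff:
  assumes "(\<eta>, x) \<in> carrier W" "(\<eta>', x') \<in> carrier W"
  shows "finite (diff \<eta> \<eta>')"
proof (rule finite_subset)
  show "diff \<eta> \<eta>' \<subseteq> {z \<in> carrier H. \<eta> z \<noteq> \<one>\<^bsub>G\<^esub>} \<union> {z \<in> carrier H. \<eta>' z \<noteq> \<one>\<^bsub>G\<^esub>}"
    by (auto simp: diff_def)
qed (use assms W_carrierD in auto)

lemma lamp_dist_eq_sum:
  assumes "(\<eta>, x) \<in> carrier W" "(\<eta>', x') \<in> carrier W"
    "finite F" "diff \<eta> \<eta>' \<subseteq> F" "F \<subseteq> carrier H"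
  shows "lamp_dist \<eta> \<eta>' = (\<Sum>z\<in>F. G.dst (\<eta> z) (\<eta>' z))"
  unfolding lamp_dist_def
proof (rule sum.mono_neutral_left)
  show "\<forall>z\<in>F - diff \<eta> \<eta>'. G.dst (\<eta> z) (\<eta>' z) = 0"
    using assms W_carrierD(2) [OF assms(2)] by (auto simp: diff_def)
qed (use assms in auto)

lemma diff_empty_iff:
  assumes "(\<eta>, x) \<in> carrier W" "(\<eta>', x') \<in> carrier W"
  shows "diff \<eta> \<eta>' = {} \<longleftrightarrow> \<eta> = \<eta>'"
  using W_carrierD(3) [OF assms(1)] W_carrierD(3) [OF assms(2)]
  by (auto simp: diff_def intro: extensionalityI)

text \<open>Walking along the path, the lamplighter puts the lamp at each position into its final state.\<close>

lemma reaches_tour: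
  assumes "set ts \<subseteq> T" "(\<eta>, x) \<in> carrier W" "(\<eta>', y) \<in> carrier W" "diff \<eta> \<eta>' \<subseteq> H.visited x ts"
  shows "reaches (\<eta>, x) (length ts + lamp_dist \<eta> \<eta>') (\<eta>', foldl (\<otimes>\<^bsub>H\<^esub>) x ts)"
  using assms
proof (induction ts arbitrary: \<eta> x)
  case base: Nil
  have x: "x \<in> carrier H" "\<eta>' x \<in> carrier G"
    using W_carrierD [OF base.prems(2)] W_carrierD [OF base.prems(3)] by auto
  have c: "(\<eta>(x := \<eta>' x), x) \<in> carrier W" using W_update [OF base.prems(2)] x by simp
  have "diff (\<eta>(x := \<eta>' x)) \<eta>' = {}" using base by (auto simp: diff_def)
  then have "\<eta>(x := \<eta>' x) = \<eta>'" using diff_empty_iff c base by blast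
  moreover have "lamp_dist \<eta> \<eta>' = G.dst (\<eta> x) (\<eta>' x)"
    using base x by (subst lamp_dist_eq_sum [of _ x _ y "{x}"]) auto
  ultimately show ?case using reaches_lamp [OF base.prems(2) x(2)] by simp
next
  case (Cons t ts)
  have x: "x \<in> carrier H" "\<eta>' x \<in> carrier G"
    using W_carrierD [OF Cons.prems(2)] W_carrierD [OF Cons.prems(3)] by auto
  have t: "t \<in> T" "x \<otimes>\<^bsub>H\<^esub> t \<in> carrier H" using Cons.prems H.S_carrier x by auto
  let ?\<eta> = "\<eta>(x := \<eta>' x)"
  have c: "(?\<eta>, x) \<in> carrier W" "(?\<eta>, x \<otimes>\<^bsub>H\<^esub> t) \<in> carrier W"
    using W_update [OF Cons.prems(2)] x t by auto
  have d: "diff ?\<eta> \<eta>' = diff \<eta> \<eta>' - {x}" by (auto simp: diff_def)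
  let ?F = "insert x (diff \<eta> \<eta>' - {x})"
  have F: "finite ?F" "?F \<subseteq> carrier H"
    using finite_diff [OF Cons.prems(2,3)] x by (auto simp: diff_def)
  have "lamp_dist \<eta> \<eta>' = (\<Sum>z\<in>?F. G.dst (\<eta> z) (\<eta>' z))"
    using F by (intro lamp_dist_eq_sum [OF Cons.prems(2,3)]) auto
  also have "\<dots> = G.dst (\<eta> x) (\<eta>' x) + (\<Sum>z\<in>diff \<eta> \<eta>' - {x}. G.dst (\<eta> z) (\<eta>' z))"
    using F(1) by (subst sum.insert) (simp_all del: insert_Diff_single)
  also have "(\<Sum>z\<in>diff \<eta> \<eta>' - {x}. G.dst (\<eta> z) (\<eta>' z)) = lamp_dist ?\<eta> \<eta>'"
    unfolding lamp_dist_def d by (intro sum.cong) auto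
  finally have l: "lamp_dist \<eta> \<eta>' = G.dst (\<eta> x) (\<eta>' x) + lamp_dist ?\<eta> \<eta>'" .
  have "reaches (?\<eta>, x \<otimes>\<^bsub>H\<^esub> t) (length ts + lamp_dist ?\<eta> \<eta>') (\<eta>', foldl (\<otimes>\<^bsub>H\<^esub>) (x \<otimes>\<^bsub>H\<^esub> t) ts)"
  proof (rule Cons.IH [OF _ c(2) Cons.prems(3)])
    show "diff ?\<eta> \<eta>' \<subseteq> H.visited (x \<otimes>\<^bsub>H\<^esub> t) ts" using Cons.prems(4) unfolding d by auto
  qed (use Cons.prems(1) in simp)
  from reaches_trans [OF reaches_lamp [OF Cons.prems(2) x(2)] reaches_trans [OF reaches_move [OF c(1) t(1)] this]]
  have "reaches (\<eta>, x) (G.dst (\<eta> x) (\<eta>' x) + (1 + (length ts + lamp_dist ?\<eta> \<eta>')))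
      (\<eta>', foldl (\<otimes>\<^bsub>H\<^esub>) (x \<otimes>\<^bsub>H\<^esub> t) ts)" .
  then show ?case unfolding foldl.simps by (rule reaches_mono) (simp add: l)
qed

lemma reaches_salesman:
  assumes p: "(\<eta>, x) \<in> carrier W" "(\<eta>', x') \<in> carrier W"
    and t: "H.tour x A n" "diff \<eta> \<eta>' \<subseteq> A"
  shows "reaches (\<eta>, x) (n + H.dst x x' + lamp_dist \<eta> \<eta>') (\<eta>', x')"
proof -
  have x: "x \<in> carrier H" "x' \<in> carrier H" using p W_carrierD by auto
  obtain ts where ts: "set ts \<subseteq> T" "length ts \<le> n" "foldl (\<otimes>\<^bsub>H\<^esub>) x ts = x" "A \<subseteq> H.visited x ts"
    using t(1) by (auto simp: H.tour_def)
  obtain us where us: "set us \<subseteq> T" "length us = H.dst x x'" "foldl (\<otimes>\<^bsub>H\<^esub>) x us = x'"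
    using H.dst_walk [OF x] .
  have "reaches (\<eta>, x) (length (ts @ us) + lamp_dist \<eta> \<eta>') (\<eta>', foldl (\<otimes>\<^bsub>H\<^esub>) x (ts @ us))"
    using ts us t(2) by (intro reaches_tour [OF _ p]) (auto simp: H.visited_append)
  moreover have "foldl (\<otimes>\<^bsub>H\<^esub>) x (ts @ us) = x'" using ts us by simp
  ultimately have "reaches (\<eta>, x) (length (ts @ us) + lamp_dist \<eta> \<eta>') (\<eta>', x')" by (simp only:)
  then show ?thesis by (rule reaches_mono) (use ts us in simp)
qed

lemma fin_sym_generating_SW: "fin_sym_generating W SW"
proof -
  have "p \<in> generate W SW" if p: "p \<in> carrier W" for p
  proof -
    obtain \<eta> x where px: "p = (\<eta>, x)" by (cases p)
    have one: "(no_lamps, \<one>\<^bsub>H\<^esub>) \<in> carrier W" by (intro W_no_lamps) simp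
    have d: "finite (diff no_lamps \<eta>)" "diff no_lamps \<eta> \<subseteq> carrier H"
      using finite_diff [OF one] p px by (auto simp: diff_def)
    then obtain n where "H.tour \<one>\<^bsub>H\<^esub> (diff no_lamps \<eta>) n"
      using H.tour_exists [of "diff no_lamps \<eta>" "\<one>\<^bsub>H\<^esub>"] by auto
    then obtain ws where ws: "set ws \<subseteq> SW" "foldl (\<otimes>\<^bsub>W\<^esub>) \<one>\<^bsub>W\<^esub> ws = p"
      using reaches_salesman [OF one p [unfolded px] _ order_refl] px
      unfolding reaches_def W_one by blast
    have "q \<in> generate W SW \<Longrightarrow> set us \<subseteq> SW \<Longrightarrow> foldl (\<otimes>\<^bsub>W\<^esub>) q us \<in> generate W SW" for q us
    proof (induction us arbitrary: q)
      case (Cons u us)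
      have "u \<in> SW" using Cons.prems by simp
      from generate.eng [OF Cons.prems(1) generate.incl [OF this]]
      show ?case using Cons.IH [of "q \<otimes>\<^bsub>W\<^esub> u"] Cons.prems(2) by simp
    qed simp
    from this [OF generate.one ws(1)] show ?thesis using ws(2) by simp
  qed
  then show ?thesis
    using SW_carrier SW_inv G.S_finite H.S_finite W.generate_incl [OF SW_carrier]
    by (auto simp: fin_sym_generating_def SW_def)
qed

sublocale W: word_metric W SW
  by unfold_locales (rule fin_sym_generating_SW)

lemma W_dst_le_salesman:
  assumes "(\<eta>, x) \<in> carrier W" "(\<eta>', x') \<in> carrier W" "H.tour x A n" "diff \<eta> \<eta>' \<subseteq> A"
  shows "W.dst (\<eta>, x) (\<eta>', x') \<le> n + H.dst x x' + lamp_dist \<eta> \<eta>'"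
proof -
  note r = reaches_salesman [OF assms, unfolded reaches_def]
  obtain ws where ws: "set ws \<subseteq> SW" "length ws \<le> n + H.dst x x' + lamp_dist \<eta> \<eta>'"
    "foldl (\<otimes>\<^bsub>W\<^esub>) (\<eta>, x) ws = (\<eta>', x')"
    using r by (elim exE conjE)
  then show ?thesis using W.dst_foldl_le [OF assms(1) ws(1)] by simp
qed

lemma lamp_dist_triangle:
  assumes "(\<eta>1, x1) \<in> carrier W" "(\<eta>2, x2) \<in> carrier W" "(\<eta>3, x3) \<in> carrier W"
  shows "lamp_dist \<eta>1 \<eta>3 \<le> lamp_dist \<eta>1 \<eta>2 + lamp_dist \<eta>2 \<eta>3"
proof -
  let ?F = "diff \<eta>1 \<eta>2 \<union> diff \<eta>2 \<eta>3 \<union> diff \<eta>1 \<eta>3"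
  have F: "finite ?F" "?F \<subseteq> carrier H" using finite_diff assms by (auto simp: diff_def)
  have "lamp_dist \<eta>1 \<eta>3 = (\<Sum>z\<in>?F. G.dst (\<eta>1 z) (\<eta>3 z))"
    using F by (intro lamp_dist_eq_sum [OF assms(1,3)]) auto
  also have "\<dots> \<le> (\<Sum>z\<in>?F. G.dst (\<eta>1 z) (\<eta>2 z) + G.dst (\<eta>2 z) (\<eta>3 z))"
    using F assms W_carrierD(2) by (intro sum_mono G.dst_triangle) blast+
  also have "\<dots> = lamp_dist \<eta>1 \<eta>2 + lamp_dist \<eta>2 \<eta>3"
    unfolding sum.distrib
    using F by (subst (1 2) lamp_dist_eq_sum [of _ _ _ _ ?F]) (use assms in auto)
  finally show ?thesis .
qed

lemma lamp_dist_update: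
  assumes "(\<eta>, x) \<in> carrier W" "z \<in> carrier H" "g \<in> carrier G"
  shows "lamp_dist \<eta> (\<eta>(z := g)) = G.dst (\<eta> z) g"
proof -
  have "lamp_dist \<eta> (\<eta>(z := g)) = (\<Sum>w\<in>{z}. G.dst (\<eta> w) ((\<eta>(z := g)) w))"
    using assms W_carrierD(1) W_update by (intro lamp_dist_eq_sum [of _ x _ x]) (auto simp: diff_def)
  then show ?thesis by simp
qed

lemma lamp_dist_self: "lamp_dist \<eta> \<eta> = 0"
  by (simp add: lamp_dist_def diff_def)

text \<open>A generator changes at most one lamp, and this by a generator of the lamp group.\<close>

lemma lamp_dist_le_W_dst:
  assumes "(\<eta>, x) \<in> carrier W" "(\<eta>', x') \<in> carrier W"
  shows "lamp_dist \<eta> \<eta>' \<le> W.dst (\<eta>, x) (\<eta>', x')"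
proof -
  have *: "lamp_dist \<eta> (fst (foldl (\<otimes>\<^bsub>W\<^esub>) (\<eta>, x) ws)) \<le> length ws" if "set ws \<subseteq> SW" for ws
    using that
  proof (induction ws rule: rev_induct)
    case Nil
    then show ?case by (simp add: lamp_dist_self)
  next
    case (snoc w ws)
    obtain \<zeta> y where q: "foldl (\<otimes>\<^bsub>W\<^esub>) (\<eta>, x) ws = (\<zeta>, y)" by (cases "foldl (\<otimes>\<^bsub>W\<^esub>) (\<eta>, x) ws")
    have qc: "(\<zeta>, y) \<in> carrier W" using W.dst_foldl_le [OF assms(1), of ws] snoc.prems q by auto
    have IH: "lamp_dist \<eta> \<zeta> \<le> length ws" using snoc q by auto
    have "w \<in> SW" using snoc by auto
    then consider s where "s \<in> S" "w = (lamp s, \<one>\<^bsub>H\<^esub>)" | t where "t \<in> T" "w = (no_lamps, t)"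
      by (auto simp: SW_def)
    then show ?case
    proof cases
      case (1 s)
      then have s: "s \<in> carrier G" using G.S_carrier by auto
      have y: "y \<in> carrier H" "\<zeta> y \<in> carrier G" using W_carrierD [OF qc] by auto
      have c: "(\<zeta>(y := \<zeta> y \<otimes>\<^bsub>G\<^esub> s), y) \<in> carrier W" using W_update [OF qc] y s by simp
      have "lamp_dist \<eta> (\<zeta>(y := \<zeta> y \<otimes>\<^bsub>G\<^esub> s)) \<le> lamp_dist \<eta> \<zeta> + lamp_dist \<zeta> (\<zeta>(y := \<zeta> y \<otimes>\<^bsub>G\<^esub> s))"
        by (rule lamp_dist_triangle [OF assms(1) qc c])
      also have "\<dots> \<le> length ws + 1"
        using IH lamp_dist_update [OF qc y(1), of "\<zeta> y \<otimes>\<^bsub>G\<^esub> s"] y s G.dst_gen_le [OF y(2) 1(1)] by simp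
      finally show ?thesis using q 1 mult_lamp [OF qc s] by (simp del: fun_upd_apply)
    next
      case (2 t)
      then have "t \<in> carrier H" using H.S_carrier by auto
      then show ?thesis using q 2 mult_move [OF qc, of t] IH by simp
    qed
  qed
  obtain ws where "set ws \<subseteq> SW" "length ws = W.dst (\<eta>, x) (\<eta>', x')" "foldl (\<otimes>\<^bsub>W\<^esub>) (\<eta>, x) ws = (\<eta>', x')"
    using W.dst_walk [OF assms] .
  then show ?thesis using * [of ws] by simp
qed

end

section \<open>Symmetric Markov kernels\<close>

primrec kpow :: "'w set \<Rightarrow> ('w \<Rightarrow> 'w \<Rightarrow> real) \<Rightarrow> nat \<Rightarrow> 'w \<Rightarrow> 'w \<Rightarrow> real" where
  "kpow \<Omega> k 0 = (\<lambda>x y. of_bool (x = y))"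
| "kpow \<Omega> k (Suc n) = (\<lambda>x y. \<Sum>u\<in>\<Omega>. k x u * kpow \<Omega> k n u y)"

locale symmetric_kernel =
  fixes \<Omega> :: "'w set" and k :: "'w \<Rightarrow> 'w \<Rightarrow> real" and r :: real
  assumes fin: "finite \<Omega>"
    and nonneg: "x \<in> \<Omega> \<Longrightarrow> y \<in> \<Omega> \<Longrightarrow> 0 \<le> k x y"
    and sym: "x \<in> \<Omega> \<Longrightarrow> y \<in> \<Omega> \<Longrightarrow> k x y = k y x"
    and total: "x \<in> \<Omega> \<Longrightarrow> (\<Sum>y\<in>\<Omega>. k x y) = r"
begin

abbreviation kp where "kp \<equiv> kpow \<Omega> k"

lemma kp_nonneg: "x \<in> \<Omega> \<Longrightarrow> y \<in> \<Omega> \<Longrightarrow> 0 \<le> kp n x y"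
  by (induction n arbitrary: x) (auto intro!: sum_nonneg mult_nonneg_nonneg nonneg)

lemma kp_add: "x \<in> \<Omega> \<Longrightarrow> kp (m + n) x y = (\<Sum>u\<in>\<Omega>. kp m x u * kp n u y)"
proof (induction m arbitrary: x)
  case 0
  have "(\<Sum>u\<in>\<Omega>. kp 0 x u * kp n u y) = (\<Sum>u\<in>\<Omega>. if u = x then kp n u y else 0)"
    by (intro sum.cong) auto
  then show ?case using 0 fin by simp
next
  case (Suc m)
  have "kp (Suc m + n) x y = (\<Sum>u\<in>\<Omega>. k x u * (\<Sum>w\<in>\<Omega>. kp m u w * kp n w y))"
    using Suc.IH by simp
  also have "\<dots> = (\<Sum>u\<in>\<Omega>. \<Sum>w\<in>\<Omega>. k x u * kp m u w * kp n w y)"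
    by (simp add: sum_distrib_left mult.assoc)
  also have "\<dots> = (\<Sum>w\<in>\<Omega>. \<Sum>u\<in>\<Omega>. k x u * kp m u w * kp n w y)"
    by (rule sum.swap)
  also have "\<dots> = (\<Sum>w\<in>\<Omega>. kp (Suc m) x w * kp n w y)"
    by (simp add: sum_distrib_right)
  finally show ?case .
qed

lemma kp_one: "y \<in> \<Omega> \<Longrightarrow> kp 1 x y = k x y"
proof -
  assume y: "y \<in> \<Omega>"
  have "kp 1 x y = (\<Sum>u\<in>\<Omega>. if u = y then k x u else 0)"
    by (simp, intro sum.cong) auto
  then show "kp 1 x y = k x y" using y fin by simp
qed

lemma kp_sym: "x \<in> \<Omega> \<Longrightarrow> y \<in> \<Omega> \<Longrightarrow> kp n x y = kp n y x"
proof (induction n arbitrary: x y)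
  case (Suc n)
  have "kp (Suc n) x y = (\<Sum>u\<in>\<Omega>. kp n y u * k u x)"
    using Suc sym by (simp, intro sum.cong) auto
  also have "\<dots> = (\<Sum>u\<in>\<Omega>. kp n y u * kp 1 u x)"
    by (simp only: kp_one [OF Suc.prems(1)])
  also have "\<dots> = kp (n + 1) y x" by (rule kp_add [OF Suc.prems(2), symmetric])
  finally show ?case by (simp only: Suc_eq_plus1)
qed auto

lemma kp_total: "x \<in> \<Omega> \<Longrightarrow> (\<Sum>y\<in>\<Omega>. kp n x y) = r ^ n"
proof (induction n arbitrary: x)
  case 0
  then show ?case using fin by simp
next
  case (Suc n)
  have "(\<Sum>y\<in>\<Omega>. kp (Suc n) x y) = (\<Sum>u\<in>\<Omega>. \<Sum>y\<in>\<Omega>. k x u * kp n u y)"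
    unfolding kpow.simps by (rule sum.swap)
  also have "\<dots> = (\<Sum>u\<in>\<Omega>. k x u * r ^ n)"
    using Suc.IH by (simp add: sum_distrib_left [symmetric])
  also have "\<dots> = r ^ Suc n" using total [OF Suc.prems] by (simp add: sum_distrib_right [symmetric])
  finally show ?case .
qed

lemma kp_total': "y \<in> \<Omega> \<Longrightarrow> (\<Sum>x\<in>\<Omega>. kp n x y) = r ^ n"
  using kp_total [of y n] by (metis (no_types, lifting) kp_sym sum.cong)

end

locale symmetric_markov = symmetric_kernel \<Omega> k 1 for \<Omega> :: "'w set" and k
begin

definition energy :: "('w \<Rightarrow> 'w \<Rightarrow> real) \<Rightarrow> nat \<Rightarrow> real" where
  "energy \<psi> n = (\<Sum>x\<in>\<Omega>. \<Sum>y\<in>\<Omega>. kp n x y * \<psi> x y)"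

text \<open>Given the middle point of a path of length \<open>2n\<close> its two endpoints are independent and
  identically distributed, and \<open>E(X - Y)\<^sup>2 \<le> 2 E(X - c)\<^sup>2\<close> for i.i.d. \<open>X\<close>, \<open>Y\<close> and every constant \<open>c\<close>.
  This is the part of Ball's Markov type \<open>2\<close> property of Hilbert space that is needed here.\<close>

lemma energy_double_real:
  fixes v :: "'w \<Rightarrow> real"
  shows "energy (\<lambda>x y. (v x - v y)\<^sup>2) (2 * n) \<le> 2 * energy (\<lambda>x y. (v x - v y)\<^sup>2) n"
proof -
  have mid: "(\<Sum>x\<in>\<Omega>. \<Sum>y\<in>\<Omega>. kp n u x * kp n u y * (v x - v y)\<^sup>2) \<le> 2 * (\<Sum>x\<in>\<Omega>. kp n u x * (v u - v x)\<^sup>2)"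
    if u: "u \<in> \<Omega>" for u
  proof -
    define a where "a x = v u - v x" for x
    have t: "(\<Sum>y\<in>\<Omega>. kp n u y) = 1" using kp_total [OF u] by simp
    have "(\<Sum>x\<in>\<Omega>. \<Sum>y\<in>\<Omega>. kp n u x * kp n u y * (v x - v y)\<^sup>2)
        = (\<Sum>x\<in>\<Omega>. \<Sum>y\<in>\<Omega>. kp n u x * (a x)\<^sup>2 * kp n u y + kp n u x * (kp n u y * (a y)\<^sup>2)
             - 2 * (kp n u x * a x) * (kp n u y * a y))"
      by (intro sum.cong refl) (simp add: a_def power2_eq_square algebra_simps)
    also have "\<dots> = 2 * (\<Sum>x\<in>\<Omega>. kp n u x * (a x)\<^sup>2) - 2 * (\<Sum>x\<in>\<Omega>. kp n u x * a x)\<^sup>2"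
      by (simp add: sum.distrib sum_subtractf t power2_eq_square
            sum_distrib_left [symmetric] sum_distrib_right [symmetric])
    finally show ?thesis by (simp add: a_def)
  qed
  have "energy (\<lambda>x y. (v x - v y)\<^sup>2) (2 * n)
      = (\<Sum>x\<in>\<Omega>. \<Sum>y\<in>\<Omega>. \<Sum>u\<in>\<Omega>. kp n u x * kp n u y * (v x - v y)\<^sup>2)"
    unfolding energy_def mult_2 using kp_sym
    by (intro sum.cong refl) (simp add: kp_add sum_distrib_right)
  also have "\<dots> = (\<Sum>x\<in>\<Omega>. \<Sum>u\<in>\<Omega>. \<Sum>y\<in>\<Omega>. kp n u x * kp n u y * (v x - v y)\<^sup>2)"
    by (intro sum.cong refl sum.swap)
  also have "\<dots> = (\<Sum>u\<in>\<Omega>. \<Sum>x\<in>\<Omega>. \<Sum>y\<in>\<Omega>. kp n u x * kp n u y * (v x - v y)\<^sup>2)"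
    by (rule sum.swap)
  also have "\<dots> \<le> (\<Sum>u\<in>\<Omega>. 2 * (\<Sum>x\<in>\<Omega>. kp n u x * (v u - v x)\<^sup>2))"
    by (intro sum_mono mid)
  finally show ?thesis by (simp add: energy_def sum_distrib_left)
qed

lemma energy_double:
  assumes "L2_kernel \<Omega> \<psi>"
  shows "energy \<psi> (2 * n) \<le> 2 * energy \<psi> n"
proof -
  have eq: "(\<Sum>i\<in>\<Omega>. \<Sum>j\<in>\<Omega>. (2 * kp n i j - kp (2 * n) i j) * \<phi> i j) = 2 * energy \<phi> n - energy \<phi> (2 * n)" for \<phi>
    by (simp add: energy_def left_diff_distrib sum_subtractf sum_distrib_left mult.assoc)
  have "0 \<le> (\<Sum>i\<in>\<Omega>. \<Sum>j\<in>\<Omega>. (2 * kp n i j - kp (2 * n) i j) * \<psi> i j)"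
    by (rule L2_kernel_quadratic [OF assms order_refl]) (use energy_double_real in \<open>simp add: eq\<close>)
  then show ?thesis by (simp add: eq)
qed

lemma energy_pow2:
  assumes "L2_kernel \<Omega> \<psi>"
  shows "energy \<psi> (2 ^ j) \<le> 2 ^ j * energy \<psi> 1"
proof (induction j)
  case (Suc j)
  have "energy \<psi> (2 ^ Suc j) \<le> 2 * energy \<psi> (2 ^ j)"
    using energy_double [OF assms, of "2 ^ j"] by simp
  then show ?case using Suc by simp
qed simp

text \<open>This is the probability of visiting \<open>z\<close> within \<open>n\<close> steps.\<close>

primrec hit :: "'w \<Rightarrow> nat \<Rightarrow> 'w \<Rightarrow> real" where
  "hit z 0 = (\<lambda>x. of_bool (x = z))"
| "hit z (Suc n) = (\<lambda>x. if x = z then 1 else \<Sum>y\<in>\<Omega>. k x y * hit z n y)"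

text \<open>The expected number of visits to \<open>z\<close> is the probability of a first visit times the expected number
  of visits after it.\<close>

lemma green_le_hit:
  assumes "z \<in> \<Omega>" "x \<in> \<Omega>" "n \<le> N"
  shows "(\<Sum>j\<le>n. kp j x z) \<le> hit z n x * (\<Sum>j\<le>N. kp j z z)"
  using assms(2,3)
proof (induction n arbitrary: x)
  case 0
  have "(1::real) \<le> (\<Sum>j\<le>N. kp j z z)"
    using member_le_sum [of 0 "{..N}" "\<lambda>j. kp j z z"] kp_nonneg assms by auto
  then show ?case by auto
next
  case (Suc n)
  show ?case
  proof (cases "x = z")
    case True
    have "(\<Sum>j\<le>Suc n. kp j z z) \<le> (\<Sum>j\<le>N. kp j z z)"
      using Suc.prems kp_nonneg assms by (intro sum_mono2) auto
    then show ?thesis using True by simp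
  next
    case False
    have "(\<Sum>j\<le>Suc n. kp j x z) = (\<Sum>j\<le>n. kp (Suc j) x z)"
      using False by (subst sum.atMost_Suc_shift) simp
    also have "\<dots> = (\<Sum>u\<in>\<Omega>. \<Sum>j\<le>n. k x u * kp j u z)"
      unfolding kpow.simps by (rule sum.swap)
    also have "\<dots> = (\<Sum>u\<in>\<Omega>. k x u * (\<Sum>j\<le>n. kp j u z))"
      by (simp add: sum_distrib_left)
    also have "\<dots> \<le> (\<Sum>u\<in>\<Omega>. k x u * (hit z n u * (\<Sum>j\<le>N. kp j z z)))"
      using Suc by (intro sum_mono mult_left_mono Suc.IH nonneg) auto
    also have "\<dots> = hit z (Suc n) x * (\<Sum>j\<le>N. kp j z z)"
      using False by (simp add: sum_distrib_right mult.assoc)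
    finally show ?thesis .
  qed
qed

lemma sum_hit_ge:
  assumes z: "z \<in> \<Omega>" and G: "(\<Sum>j\<le>N. kp j z z) \<le> G" "0 < G"
  shows "real (N + 1) / G \<le> (\<Sum>x\<in>\<Omega>. hit z N x)"
proof -
  have h: "0 \<le> hit z n x" if "x \<in> \<Omega>" for n x
    using that by (induction n arbitrary: x) (auto intro!: sum_nonneg mult_nonneg_nonneg nonneg)
  have "real (N + 1) = (\<Sum>j\<le>N. \<Sum>x\<in>\<Omega>. kp j x z)"
    using kp_total' [OF z] by simp
  also have "\<dots> = (\<Sum>x\<in>\<Omega>. \<Sum>j\<le>N. kp j x z)" by (rule sum.swap)
  also have "\<dots> \<le> (\<Sum>x\<in>\<Omega>. hit z N x * (\<Sum>j\<le>N. kp j z z))"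
    using z by (intro sum_mono green_le_hit) auto
  also have "\<dots> \<le> (\<Sum>x\<in>\<Omega>. hit z N x * G)"
    using G h by (intro sum_mono mult_left_mono) auto
  also have "\<dots> = (\<Sum>x\<in>\<Omega>. hit z N x) * G" by (rule sum_distrib_right [symmetric])
  finally show ?thesis using G(2) by (simp only: pos_divide_le_eq)
qed

end

section \<open>Mixtures of scales\<close>

text \<open>A step of the mixture first chooses a scale \<open>j\<close> with probability \<open>w j\<close> and then moves according to
  \<open>P j\<close>. Such a step makes all densities at most \<open>v j\<close>, and later steps cannot increase this bound. So
  the density after \<open>n\<close> steps is controlled by the largest scale chosen so far.\<close>

locale scale_mixture =
  fixes Q :: "'w set" and P :: "nat \<Rightarrow> 'w \<Rightarrow> 'w \<Rightarrow> real" and w v :: "nat \<Rightarrow> real" and M :: nat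
  assumes P: "j < M \<Longrightarrow> symmetric_markov Q (P j)"
    and P_le: "j < M \<Longrightarrow> x \<in> Q \<Longrightarrow> y \<in> Q \<Longrightarrow> P j x y \<le> v j"
    and w: "j < M \<Longrightarrow> 0 < w j" and w_total: "(\<Sum>j<M. w j) = 1"
begin

definition mix :: "nat \<Rightarrow> 'w \<Rightarrow> 'w \<Rightarrow> real" where
  "mix m x y = (\<Sum>j<m. w j * P j x y)"

definition wsum :: "nat \<Rightarrow> real" where "wsum m = (\<Sum>j<m. w j)"

lemma mix_kernel:
  assumes "m \<le> M" "finite Q"
  shows "symmetric_kernel Q (mix m) (wsum m)"
proof
  fix x y assume xy: "x \<in> Q" "y \<in> Q"
  have s: "symmetric_kernel Q (P j) 1" if "j < m" for j
    using P [of j] that assms by (simp add: symmetric_markov_def)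
  show "0 \<le> mix m x y"
    unfolding mix_def using s symmetric_kernel.nonneg xy w assms
    by (intro sum_nonneg mult_nonneg_nonneg) (force simp: less_imp_le)+
  show "mix m x y = mix m y x"
    unfolding mix_def using symmetric_kernel.sym [OF s xy] by (intro sum.cong refl) simp
next
  fix x assume x: "x \<in> Q"
  have s: "(\<Sum>y\<in>Q. P j x y) = 1" if "j < m" for j
    using P [of j] that assms x by (auto simp: symmetric_markov_def dest: symmetric_kernel.total)
  have "(\<Sum>y\<in>Q. mix m x y) = (\<Sum>j<m. \<Sum>y\<in>Q. w j * P j x y)"
    unfolding mix_def by (rule sum.swap)
  also have "\<dots> = wsum m"
    unfolding wsum_def using s by (intro sum.cong refl) (simp add: sum_distrib_left [symmetric])
  finally show "(\<Sum>y\<in>Q. mix m x y) = wsum m" .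
qed (use assms in simp)

text \<open>The factor \<open>wsum (Suc m) ^ n - wsum m ^ n\<close> is the probability that \<open>m\<close> is the largest scale in
  \<open>n\<close> steps.\<close>

lemma kpow_mix_Suc_le:
  assumes m: "m < M" and Q: "finite Q" and xz: "x \<in> Q" "z \<in> Q"
  shows "kpow Q (mix (Suc m)) n x z \<le> kpow Q (mix m) n x z + v m * (wsum (Suc m) ^ n - wsum m ^ n)"
  using xz(1)
proof (induction n arbitrary: x)
  case (Suc n)
  interpret A: symmetric_kernel Q "mix m" "wsum m" using mix_kernel m Q by simp
  interpret B: symmetric_kernel Q "mix (Suc m)" "wsum (Suc m)" using mix_kernel m Q by simp
  have "kpow Q (mix (Suc m)) (Suc n) x z
      = (\<Sum>u\<in>Q. mix m x u * B.kp n u z) + w m * (\<Sum>u\<in>Q. P m x u * B.kp n u z)"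
    by (simp add: mix_def distrib_right sum.distrib sum_distrib_left mult.assoc)
  also have "\<dots> \<le> (\<Sum>u\<in>Q. mix m x u * (A.kp n u z + v m * (wsum (Suc m) ^ n - wsum m ^ n)))
      + w m * (\<Sum>u\<in>Q. v m * B.kp n u z)"
    using Suc.prems xz m w [OF m] P_le
    by (intro add_mono sum_mono mult_left_mono mult_right_mono Suc.IH A.nonneg B.kp_nonneg) auto
  also have "\<dots> = (\<Sum>u\<in>Q. mix m x u * A.kp n u z)
      + (\<Sum>u\<in>Q. mix m x u) * (v m * (wsum (Suc m) ^ n - wsum m ^ n))
      + w m * (v m * (\<Sum>u\<in>Q. B.kp n u z))"
    by (simp add: distrib_left sum.distrib sum_distrib_left sum_distrib_right)
  also have "\<dots> = kpow Q (mix m) (Suc n) x z + wsum m * (v m * (wsum (Suc m) ^ n - wsum m ^ n))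
      + w m * (v m * wsum (Suc m) ^ n)"
    using A.total [OF Suc.prems] B.kp_total' [OF xz(2)] by simp
  also have "\<dots> = kpow Q (mix m) (Suc n) x z + v m * (wsum (Suc m) ^ Suc n - wsum m ^ Suc n)"
    by (simp add: wsum_def algebra_simps)
  finally show ?case .
qed simp

lemma v_nonneg:
  assumes "j < M" "x \<in> Q" shows "0 \<le> v j"
proof -
  have "0 \<le> P j x x" using P [OF assms(1)] assms(2)
    by (auto simp: symmetric_markov_def dest: symmetric_kernel.nonneg)
  then show ?thesis using P_le [OF assms(1,2,2)] by simp
qed

lemma green_mix_le:
  assumes m: "m \<le> M" and Q: "finite Q" and z: "z \<in> Q"
  shows "(\<Sum>n\<le>N. kpow Q (mix m) n z z) \<le> 1 + (\<Sum>j<m. v j * (\<Sum>n\<le>N. wsum (Suc j) ^ n))"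
  using m
proof (induction m)
  case 0
  have "kpow Q (mix 0) n z z = of_bool (n = 0)" for n
    by (cases n) (auto simp: mix_def)
  then have "(\<Sum>n\<le>N. kpow Q (mix 0) n z z) = (\<Sum>n\<le>N. if n = 0 then 1 else 0)"
    by (intro sum.cong) auto
  then show ?case by simp
next
  case (Suc m)
  have w0: "0 \<le> wsum m" unfolding wsum_def using w Suc.prems by (intro sum_nonneg) (simp add: less_imp_le)
  have "(\<Sum>n\<le>N. kpow Q (mix (Suc m)) n z z)
      \<le> (\<Sum>n\<le>N. kpow Q (mix m) n z z + v m * wsum (Suc m) ^ n)"
  proof (intro sum_mono)
    fix n
    have "kpow Q (mix (Suc m)) n z z \<le> kpow Q (mix m) n z z + v m * (wsum (Suc m) ^ n - wsum m ^ n)"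
      using Suc.prems Q z by (intro kpow_mix_Suc_le) auto
    moreover have "0 \<le> v m * wsum m ^ n"
      using w0 v_nonneg [of m z] Suc.prems z by simp
    ultimately show "kpow Q (mix (Suc m)) n z z \<le> kpow Q (mix m) n z z + v m * wsum (Suc m) ^ n"
      by (simp add: right_diff_distrib)
  qed
  then show ?case using Suc by (simp add: sum.distrib sum_distrib_left)
qed

end

section \<open>The lamplighter chain\<close>

text \<open>A set \<open>U\<close> of lamps is switched on or off by independent fair coins.\<close>

definition resample :: "'w set \<Rightarrow> 'w set \<Rightarrow> 'w set \<Rightarrow> real" where
  "resample U A A' = of_bool (A - U = A' - U) / 2 ^ card U"

definition lamp_sign :: "'w \<Rightarrow> 'w set \<Rightarrow> real" where
  "lamp_sign z A = (if z \<in> A then - 1 else 1)"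

definition lamp_diff :: "'w set \<times> 'w \<Rightarrow> 'w set \<times> 'w \<Rightarrow> real" where
  "lamp_diff u u' = real (card (fst u - fst u' \<union> (fst u' - fst u)))"

lemma sum_resample:
  assumes "finite Q" "U \<subseteq> Q" "A \<subseteq> Q"
  shows "(\<Sum>A'\<in>Pow Q. resample U A A' * g A') = (\<Sum>B\<in>Pow U. g ((A - U) \<union> B)) / 2 ^ card U"
proof -
  have im: "{A' \<in> Pow Q. A - U = A' - U} = (\<lambda>B. (A - U) \<union> B) ` Pow U"
  proof (intro equalityI subsetI)
    fix A' assume "A' \<in> {A' \<in> Pow Q. A - U = A' - U}"
    then have "A' = (A - U) \<union> (A' \<inter> U)" by auto
    then show "A' \<in> (\<lambda>B. (A - U) \<union> B) ` Pow U" by blast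
  qed (use assms in auto)
  have inj: "inj_on (\<lambda>B. (A - U) \<union> B) (Pow U)" by (rule inj_onI) blast
  have "(\<Sum>A'\<in>Pow Q. resample U A A' * g A') = (\<Sum>A'\<in>Pow Q. if A - U = A' - U then g A' / 2 ^ card U else 0)"
    by (intro sum.cong refl) (simp add: resample_def)
  also have "\<dots> = (\<Sum>A'\<in>{A' \<in> Pow Q. A - U = A' - U}. g A' / 2 ^ card U)"
    using assms by (subst sum.inter_filter) auto
  also have "\<dots> = (\<Sum>B\<in>Pow U. g ((A - U) \<union> B) / 2 ^ card U)"
    unfolding im using inj by (simp add: sum.reindex)
  finally show ?thesis by (simp add: sum_divide_distrib)
qed

lemma sum_resample_one:
  assumes "finite Q" "U \<subseteq> Q" "A \<subseteq> Q"
  shows "(\<Sum>A'\<in>Pow Q. resample U A A') = 1"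
  using sum_resample [OF assms, of "\<lambda>_. 1"] finite_subset [OF assms(2,1)] by (simp add: card_Pow)

lemma sum_resample_sign:
  assumes "finite Q" "U \<subseteq> Q" "A \<subseteq> Q"
  shows "(\<Sum>A'\<in>Pow Q. resample U A A' * lamp_sign z A') = of_bool (z \<notin> U) * lamp_sign z A"
proof (cases "z \<in> U")
  case True
  let ?s = "\<lambda>B. if z \<in> B then B - {z} else insert z B"
  let ?S = "\<Sum>B\<in>Pow U. lamp_sign z ((A - U) \<union> B)"
  have "bij_betw ?s (Pow U) (Pow U)"
    using True by (intro bij_betw_byWitness [where f' = ?s]) (auto split: if_splits)
  then have "?S = (\<Sum>B\<in>Pow U. lamp_sign z ((A - U) \<union> ?s B))"
    by (rule sum.reindex_bij_betw [symmetric])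
  also have "\<dots> = (\<Sum>B\<in>Pow U. - lamp_sign z ((A - U) \<union> B))"
    using True by (intro sum.cong refl) (auto simp: lamp_sign_def)
  finally have "?S = 0" by (simp add: sum_negf)
  then show ?thesis using sum_resample [OF assms, of "lamp_sign z"] True by simp
next
  case False
  have "(\<Sum>B\<in>Pow U. lamp_sign z ((A - U) \<union> B)) = (\<Sum>B\<in>Pow U. lamp_sign z A)"
    using False by (intro sum.cong refl) (auto simp: lamp_sign_def)
  then show ?thesis
    using sum_resample [OF assms, of "lamp_sign z"] False finite_subset [OF assms(2,1)]
    by (simp add: card_Pow)
qed

text \<open>The lamps at both ends of each step are resampled; this makes the kernel symmetric.\<close>

definition lampk :: "('w \<Rightarrow> 'w \<Rightarrow> real) \<Rightarrow> 'w set \<times> 'w \<Rightarrow> 'w set \<times> 'w \<Rightarrow> real" where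
  "lampk p = (\<lambda>(A, x) (A', x'). p x x' * resample {x, x'} A A')"

context symmetric_markov
begin

lemma sum_lampk:
  assumes "A \<subseteq> \<Omega>" "x \<in> \<Omega>"
  shows "(\<Sum>u\<in>Pow \<Omega> \<times> \<Omega>. lampk k (A, x) u * f u)
    = (\<Sum>x'\<in>\<Omega>. k x x' * (\<Sum>A'\<in>Pow \<Omega>. resample {x, x'} A A' * f (A', x')))"
proof -
  have "(\<Sum>u\<in>Pow \<Omega> \<times> \<Omega>. lampk k (A, x) u * f u)
      = (\<Sum>A'\<in>Pow \<Omega>. \<Sum>x'\<in>\<Omega>. k x x' * resample {x, x'} A A' * f (A', x'))"
    by (simp add: sum.cartesian_product lampk_def split_def)
  also have "\<dots> = (\<Sum>x'\<in>\<Omega>. \<Sum>A'\<in>Pow \<Omega>. k x x' * resample {x, x'} A A' * f (A', x'))"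
    by (rule sum.swap)
  finally show ?thesis by (simp add: sum_distrib_left mult.assoc)
qed

lemma symmetric_markov_lampk: "symmetric_markov (Pow \<Omega> \<times> \<Omega>) (lampk k)"
proof
  show "finite (Pow \<Omega> \<times> \<Omega>)" using fin by simp
  fix u u' assume u: "u \<in> Pow \<Omega> \<times> \<Omega>" "u' \<in> Pow \<Omega> \<times> \<Omega>"
  then show "0 \<le> lampk k u u'" by (auto simp: lampk_def resample_def nonneg)
  show "lampk k u u' = lampk k u' u"
    using u sym by (auto simp: lampk_def resample_def insert_commute eq_commute)
next
  fix u assume "u \<in> Pow \<Omega> \<times> \<Omega>"
  then obtain A x where u: "u = (A, x)" "A \<subseteq> \<Omega>" "x \<in> \<Omega>" by auto
  show "(\<Sum>u'\<in>Pow \<Omega> \<times> \<Omega>. lampk k u u') = 1"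
    using sum_lampk [OF u(2,3), of "\<lambda>_. 1"] u total fin
    by (simp add: sum_resample_one cong: sum.cong)
qed

text \<open>This is the probability that neither endpoint of any of the first \<open>n\<close> steps is \<open>z\<close>. It is \<open>1\<close>
  for \<open>n = 0\<close> even at \<open>z\<close> itself.\<close>

primrec avoid :: "'w \<Rightarrow> nat \<Rightarrow> 'w \<Rightarrow> real" where
  "avoid z 0 = (\<lambda>x. 1)"
| "avoid z (Suc n) = (\<lambda>x. \<Sum>x'\<in>\<Omega>. k x x' * (of_bool (z \<notin> {x, x'}) * avoid z n x'))"

text \<open>The sign of a lamp has mean zero as soon as the lamp has been resampled once.\<close>

lemma sum_kpow_lampk_sign:
  assumes "A \<subseteq> \<Omega>" "x \<in> \<Omega>"
  shows "(\<Sum>u\<in>Pow \<Omega> \<times> \<Omega>. kpow (Pow \<Omega> \<times> \<Omega>) (lampk k) n (A, x) u * lamp_sign z (fst u))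
    = lamp_sign z A * avoid z n x"
  using assms
proof (induction n arbitrary: A x)
  case 0
  have "(\<Sum>u\<in>Pow \<Omega> \<times> \<Omega>. kpow (Pow \<Omega> \<times> \<Omega>) (lampk k) 0 (A, x) u * lamp_sign z (fst u))
      = (\<Sum>u\<in>Pow \<Omega> \<times> \<Omega>. if u = (A, x) then lamp_sign z A else 0)"
    by (intro sum.cong) auto
  then show ?case using 0 fin by simp
next
  case (Suc n)
  let ?L = "kpow (Pow \<Omega> \<times> \<Omega>) (lampk k)"
  have "(\<Sum>u\<in>Pow \<Omega> \<times> \<Omega>. ?L (Suc n) (A, x) u * lamp_sign z (fst u))
      = (\<Sum>u\<in>Pow \<Omega> \<times> \<Omega>. \<Sum>y\<in>Pow \<Omega> \<times> \<Omega>. lampk k (A, x) y * (?L n y u * lamp_sign z (fst u)))"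
    by (simp add: sum_distrib_right mult.assoc)
  also have "\<dots> = (\<Sum>y\<in>Pow \<Omega> \<times> \<Omega>. \<Sum>u\<in>Pow \<Omega> \<times> \<Omega>. lampk k (A, x) y * (?L n y u * lamp_sign z (fst u)))"
    by (rule sum.swap)
  also have "\<dots> = (\<Sum>y\<in>Pow \<Omega> \<times> \<Omega>. lampk k (A, x) y * (lamp_sign z (fst y) * avoid z n (snd y)))"
    using Suc.IH by (intro sum.cong refl) (auto simp: sum_distrib_left [symmetric])
  also have "\<dots> = (\<Sum>x'\<in>\<Omega>. k x x' * (\<Sum>A'\<in>Pow \<Omega>. resample {x, x'} A A' * lamp_sign z A') * avoid z n x')"
    unfolding sum_lampk [OF Suc.prems] by (simp add: sum_distrib_right mult.assoc)
  also have "\<dots> = (\<Sum>x'\<in>\<Omega>. k x x' * (of_bool (z \<notin> {x, x'}) * lamp_sign z A) * avoid z n x')"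
    using Suc.prems fin by (intro sum.cong refl arg_cong2 [of _ _ _ _ "(*)"] sum_resample_sign) auto
  also have "\<dots> = lamp_sign z A * avoid z (Suc n) x"
    by (simp add: sum_distrib_left mult_ac)
  finally show ?case .
qed

lemma avoid_le:
  assumes "x \<in> \<Omega>"
  shows "of_bool (x \<noteq> z) * avoid z n x \<le> 1 - hit z n x"
  using assms
proof (induction n arbitrary: x)
  case (Suc n)
  show ?case
  proof (cases "x = z")
    case False
    have "avoid z (Suc n) x \<le> (\<Sum>x'\<in>\<Omega>. k x x' * (1 - hit z n x'))"
      unfolding avoid.simps
    proof (intro sum_mono mult_left_mono)
      fix x' assume x': "x' \<in> \<Omega>"
      show "of_bool (z \<notin> {x, x'}) * avoid z n x' \<le> 1 - hit z n x'"
        using Suc.IH [OF x'] False by (auto simp: of_bool_def split: if_splits)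
      show "0 \<le> k x x'" using nonneg Suc.prems x' by blast
    qed
    then show ?thesis using False total [OF Suc.prems]
      by (simp add: right_diff_distrib sum_subtractf)
  qed simp
qed simp

lemma avoid_Suc_le: "x \<in> \<Omega> \<Longrightarrow> avoid z (Suc n) x \<le> 1 - hit z (Suc n) x"
  using avoid_le [of x z "Suc n"] by (cases "x = z") auto

lemma lamp_diff_eq:
  assumes "u \<in> Pow \<Omega> \<times> \<Omega>" "u' \<in> Pow \<Omega> \<times> \<Omega>"
  shows "lamp_diff u u' = (\<Sum>z\<in>\<Omega>. (1 - lamp_sign z (fst u) * lamp_sign z (fst u')) / 2)"
proof -
  let ?D = "fst u - fst u' \<union> (fst u' - fst u)"
  have D: "?D \<subseteq> \<Omega>" using assms by auto
  have "(\<Sum>z\<in>\<Omega>. (1 - lamp_sign z (fst u) * lamp_sign z (fst u')) / 2) = (\<Sum>z\<in>\<Omega>. if z \<in> ?D then 1 else 0)"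
    by (intro sum.cong refl) (auto simp: lamp_sign_def)
  also have "\<dots> = (\<Sum>z\<in>{z \<in> \<Omega>. z \<in> ?D}. 1)"
    using fin by (rule sum.inter_filter [symmetric])
  also have "{z \<in> \<Omega>. z \<in> ?D} = ?D" using D by blast
  also have "(\<Sum>z\<in>?D. 1) = real (card ?D)" by simp
  finally show ?thesis by (simp add: lamp_diff_def)
qed

text \<open>Every visited lamp ends up changed with probability one half, and each \<open>z\<close> is visited with the
  probability bounded in \<open>sum_hit_ge\<close>.\<close>

lemma sum_lamp_diff_ge:
  assumes G: "\<And>z. z \<in> \<Omega> \<Longrightarrow> (\<Sum>j\<le>Suc n. kp j z z) \<le> G" "0 < G"
  shows "real (card (Pow \<Omega> \<times> \<Omega>)) * (real (Suc n + 1) / (2 * G))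
    \<le> (\<Sum>u\<in>Pow \<Omega> \<times> \<Omega>. \<Sum>u'\<in>Pow \<Omega> \<times> \<Omega>. kpow (Pow \<Omega> \<times> \<Omega>) (lampk k) (Suc n) u u' * lamp_diff u u')"
proof -
  interpret L: symmetric_markov "Pow \<Omega> \<times> \<Omega>" "lampk k" by (rule symmetric_markov_lampk)
  let ?O = "Pow \<Omega> \<times> \<Omega>"
  have cp: "(\<Sum>A\<in>Pow \<Omega>. \<Sum>x\<in>\<Omega>. F x) = (\<Sum>u\<in>?O. F (snd u))" for F :: "'w \<Rightarrow> real"
    unfolding sum.cartesian_product split_def by (rule refl)
  have one: "(\<Sum>z\<in>\<Omega>. hit z (Suc n) (snd u) / 2) \<le> (\<Sum>u'\<in>?O. L.kp (Suc n) u u' * lamp_diff u u')"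
    if u: "u \<in> ?O" for u
  proof -
    obtain A x where Ax: "u = (A, x)" "A \<subseteq> \<Omega>" "x \<in> \<Omega>" using u by auto
    have s2: "lamp_sign z A * lamp_sign z A = 1" for z by (simp add: lamp_sign_def)
    have "(\<Sum>u'\<in>?O. L.kp (Suc n) u u' * lamp_diff u u')
        = (\<Sum>u'\<in>?O. \<Sum>z\<in>\<Omega>. L.kp (Suc n) u u' * ((1 - lamp_sign z A * lamp_sign z (fst u')) / 2))"
      using u Ax by (intro sum.cong refl) (simp add: lamp_diff_eq sum_distrib_left del: kpow.simps)
    also have "\<dots> = (\<Sum>z\<in>\<Omega>. \<Sum>u'\<in>?O. L.kp (Suc n) u u' * ((1 - lamp_sign z A * lamp_sign z (fst u')) / 2))"
      by (rule sum.swap)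
    also have "\<dots> = (\<Sum>z\<in>\<Omega>. ((\<Sum>u'\<in>?O. L.kp (Suc n) u u')
        - lamp_sign z A * (\<Sum>u'\<in>?O. L.kp (Suc n) u u' * lamp_sign z (fst u'))) / 2)"
      by (intro sum.cong refl)
         (simp add: sum_distrib_left sum_subtractf [symmetric] sum_divide_distrib algebra_simps
          diff_divide_distrib del: kpow.simps)
    also have "\<dots> = (\<Sum>z\<in>\<Omega>. (1 - avoid z (Suc n) x) / 2)"
      unfolding L.kp_total [OF u]
      by (simp only: Ax(1) sum_kpow_lampk_sign [OF Ax(2,3)] mult.assoc [symmetric] s2) simp
    also have "\<dots> \<ge> (\<Sum>z\<in>\<Omega>. hit z (Suc n) x / 2)"
      using avoid_Suc_le [OF Ax(3), of _ n] by (intro sum_mono divide_right_mono) (auto simp: algebra_simps simp del: avoid.simps hit.simps)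
    finally show ?thesis using Ax by simp
  qed
  have "real (card ?O) * (real (Suc n + 1) / (2 * G)) = (\<Sum>A\<in>Pow \<Omega>. \<Sum>z\<in>\<Omega>. real (Suc n + 1) / G / 2)"
    by (simp add: card_cartesian_product del: card_Pow)
  also have "\<dots> \<le> (\<Sum>A\<in>Pow \<Omega>. \<Sum>z\<in>\<Omega>. (\<Sum>x\<in>\<Omega>. hit z (Suc n) x) / 2)"
    by (intro sum_mono divide_right_mono sum_hit_ge [OF _ G]) simp_all
  also have "\<dots> = (\<Sum>A\<in>Pow \<Omega>. \<Sum>z\<in>\<Omega>. \<Sum>x\<in>\<Omega>. hit z (Suc n) x / 2)"
    by (simp only: sum_divide_distrib)
  also have "\<dots> = (\<Sum>A\<in>Pow \<Omega>. \<Sum>x\<in>\<Omega>. \<Sum>z\<in>\<Omega>. hit z (Suc n) x / 2)"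
    by (intro sum.cong refl sum.swap)
  also have "\<dots> = (\<Sum>u\<in>?O. \<Sum>z\<in>\<Omega>. hit z (Suc n) (snd u) / 2)"
    by (rule cp)
  also have "\<dots> \<le> (\<Sum>u\<in>?O. \<Sum>u'\<in>?O. L.kp (Suc n) u u' * lamp_diff u u')"
    by (intro sum_mono one)
  finally show ?thesis .
qed

end

text \<open>A linear lower bound that takes the place of Jensen's inequality.\<close>

lemma powr_tangent:
  assumes "0 \<le> (D::real)" "0 < t" "1 \<le> \<sigma>"
  shows "t powr (\<sigma> - 1) * (D - t) \<le> D powr \<sigma>"
proof (cases "t \<le> D")
  case True
  have "t powr (\<sigma> - 1) * (D - t) \<le> D powr (\<sigma> - 1) * D"
    using True assms by (intro mult_mono powr_mono2) auto
  also have "\<dots> = D powr \<sigma>"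
    using True assms powr_add [of D "\<sigma> - 1" 1] by simp
  finally show ?thesis .
next
  case False
  then have "t powr (\<sigma> - 1) * (D - t) \<le> 0" using assms by (intro mult_nonneg_nonpos) auto
  then show ?thesis using powr_ge_zero [of D \<sigma>] by linarith
qed

lemma geometric_le:
  assumes "0 \<le> (W::real)" "W \<le> 1 - d" "0 < d"
  shows "(\<Sum>n\<le>N. W ^ n) \<le> 1 / d"
proof -
  have "d * (\<Sum>n\<le>N. W ^ n) \<le> (1 - W) * (\<Sum>n\<le>N. W ^ n)"
    using assms by (intro mult_right_mono sum_nonneg) auto
  also have "\<dots> = 1 - W ^ Suc N" by (rule sum_gp_basic)
  also have "\<dots> \<le> 1" using assms by simp
  finally show ?thesis using assms by (simp add: field_simps)
qed

text \<open>The weight of scale \<open>j\<close> is proportional to \<open>1 / 4 ^ j\<close>: then each of the \<open>K + 1\<close> scales contributes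
  about the same amount both to the energy of one step and to the expected number of returns. After
  \<open>4 ^ K\<close> steps the energy has grown at most linearly, whereas the expected number of changed lamps is
  \<open>4 ^ K\<close> up to a factor linear in \<open>K\<close>.\<close>

theorem lamplighter_bound:
  fixes Q :: "'w set" and \<psi> :: "'w set \<times> 'w \<Rightarrow> 'w set \<times> 'w \<Rightarrow> real"
  assumes Q: "finite Q"  "Q \<noteq> {}"
    and P: "\<And>j. j \<le> K \<Longrightarrow> symmetric_markov Q (P j)"
    and P_le: "\<And>j x y. j \<le> K \<Longrightarrow> x \<in> Q \<Longrightarrow> y \<in> Q \<Longrightarrow> P j x y \<le> v / 4 ^ j" and v: "0 \<le> v"
    and ker: "L2_kernel (Pow Q \<times> Q) \<psi>"
    and step: "\<And>j A x A' x'. \<lbrakk>j \<le> K; A \<subseteq> Q; A' \<subseteq> Q; x \<in> Q; x' \<in> Q; P j x x' \<noteq> 0;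
      A - {x, x'} = A' - {x, x'}\<rbrakk> \<Longrightarrow> \<psi> (A, x) (A', x') \<le> C * 4 ^ j" and C: "0 \<le> C"
    and low: "\<And>u u'. u \<in> Pow Q \<times> Q \<Longrightarrow> u' \<in> Pow Q \<times> Q \<Longrightarrow> c * lamp_diff u u' powr \<sigma> \<le> \<psi> u u'"
    and c: "0 < c" and \<sigma>: "1 \<le> \<sigma>"
  shows "c * (4 ^ K / (4 * ((1 + 6 * v) * (real K + 1)))) powr \<sigma> \<le> C * (real K + 1) * 4 ^ K"
proof -
  define s :: real where "s = (\<Sum>j<Suc K. 1 / 4 ^ j)"
  have s1: "1 \<le> s" unfolding s_def by (subst sum.lessThan_Suc_shift) (simp add: sum_nonneg)
  have "s = (\<Sum>j\<le>K. (1 / 4) ^ j)" unfolding s_def lessThan_Suc_atMost by (simp add: power_divide)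
  then have s2: "s \<le> 4 / 3" using geometric_le [of "1 / 4" "3 / 4" K] by simp
  define w :: "nat \<Rightarrow> real" where "w j = 1 / (s * 4 ^ j)" for j
  have wpos: "0 < w j" for j using s1 by (simp add: w_def)
  have "(\<Sum>j<Suc K. w j) = s / s"
    unfolding w_def s_def sum_divide_distrib by (intro sum.cong) auto
  then have wt: "(\<Sum>j<Suc K. w j) = 1" using s1 by simp
  interpret mixture: scale_mixture Q P w "\<lambda>j. v / 4 ^ j" "Suc K"
  proof (rule scale_mixture.intro)
    show "(\<Sum>j<Suc K. w j) = 1" by (rule wt)
  qed (use P P_le wpos in \<open>simp_all add: less_Suc_eq_le\<close>)
  define p where "p = mixture.mix (Suc K)"
  have "mixture.wsum (Suc K) = 1" using wt by (simp add: mixture.wsum_def)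
  then interpret p: symmetric_markov Q p
    using mixture.mix_kernel [of "Suc K"] Q by (simp add: symmetric_markov_def p_def)
  define G where "G = (1 + 6 * v) * (real K + 1)"
  have G0: "0 < G" using v by (simp add: G_def add_pos_nonneg)
  define N where "N = (4::nat) ^ K"
  have N: "N = Suc (N - 1)" "real N = 4 ^ K" by (simp_all add: N_def)
  have G: "(\<Sum>j\<le>N. p.kp j z z) \<le> G" if z: "z \<in> Q" for z
  proof -
    have "(\<Sum>j\<le>N. p.kp j z z) \<le> 1 + (\<Sum>j<Suc K. v / 4 ^ j * (\<Sum>n\<le>N. mixture.wsum (Suc j) ^ n))"
      unfolding p_def using z Q by (intro mixture.green_mix_le) auto
    also have "\<dots> \<le> 1 + (\<Sum>j<Suc K. 6 * v)"
    proof (intro add_left_mono sum_mono)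
      fix j assume "j \<in> {..<Suc K}"
      then consider "j < K" | "j = K" by fastforce
      then have "(\<Sum>n\<le>N. mixture.wsum (Suc j) ^ n) \<le> 6 * 4 ^ j"
      proof cases
        case 1
        have "mixture.wsum (Suc j) + w (Suc j) = (\<Sum>i<Suc (Suc j). w i)" by (simp add: mixture.wsum_def)
        also have "\<dots> \<le> (\<Sum>i<Suc K. w i)"
          using 1 wpos by (intro sum_mono2) (auto simp: less_imp_le)
        finally have "mixture.wsum (Suc j) \<le> 1 - w (Suc j)" using wt by simp
        moreover have "0 \<le> mixture.wsum (Suc j)"
          unfolding mixture.wsum_def using wpos by (intro sum_nonneg) (simp add: less_imp_le)
        ultimately have "(\<Sum>n\<le>N. mixture.wsum (Suc j) ^ n) \<le> 1 / w (Suc j)"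
          using wpos by (intro geometric_le)
        also have "\<dots> = 4 * s * 4 ^ j" by (simp add: w_def)
        also have "\<dots> \<le> 6 * 4 ^ j" using s2 by (intro mult_right_mono) auto
        finally show ?thesis .
      next
        case 2
        then have "mixture.wsum (Suc j) = 1" using wt by (simp add: mixture.wsum_def)
        then have "(\<Sum>n\<le>N. mixture.wsum (Suc j) ^ n) = 4 ^ j + 1" using 2 by (simp add: N_def)
        also have "\<dots> \<le> 6 * 4 ^ j" using one_le_power [of "4::real" j] by linarith
        finally show ?thesis .
      qed
      then have "v / 4 ^ j * (\<Sum>n\<le>N. mixture.wsum (Suc j) ^ n) \<le> v / 4 ^ j * (6 * 4 ^ j)"
        using v by (intro mult_left_mono) auto
      then show "v / 4 ^ j * (\<Sum>n\<le>N. mixture.wsum (Suc j) ^ n) \<le> 6 * v" by simp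
    qed
    also have "\<dots> \<le> G" using v by (simp add: G_def algebra_simps)
    finally show ?thesis .
  qed
  let ?O = "Pow Q \<times> Q"
  interpret L: symmetric_markov ?O "lampk p" by (rule p.symmetric_markov_lampk)
  define m where "m = real (card ?O)"
  have "0 < card ?O" using Q by (subst card_gt_0_iff) auto
  then have m0: "0 < m" unfolding m_def by (simp only: of_nat_0_less_iff)
  have e1: "L.energy \<psi> 1 \<le> m * (C * (real K + 1))"
  proof -
    have "L.energy \<psi> 1 = (\<Sum>u\<in>?O. \<Sum>u'\<in>?O. lampk p u u' * \<psi> u u')"
      unfolding L.energy_def by (intro sum.cong refl) (simp only: L.kp_one)
    also have "\<dots> \<le> (\<Sum>u\<in>?O. \<Sum>u'\<in>?O. \<Sum>j<Suc K. C * lampk (P j) u u')"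
    proof (intro sum_mono)
      fix u u' assume "u \<in> ?O" "u' \<in> ?O"
      then obtain A x A' x' where u: "u = (A, x)" "u' = (A', x')" "A \<subseteq> Q" "x \<in> Q" "A' \<subseteq> Q" "x' \<in> Q"
        by auto
      have "lampk p u u' * \<psi> u u' = (\<Sum>j<Suc K. w j * lampk (P j) u u' * \<psi> u u')"
        by (simp add: u p_def mixture.mix_def lampk_def sum_distrib_right distrib_right mult.assoc)
      also have "\<dots> \<le> (\<Sum>j<Suc K. C * lampk (P j) u u')"
      proof (intro sum_mono)
        fix j assume j: "j \<in> {..<Suc K}"
        interpret Pj: symmetric_markov Q "P j" using P j by simp
        have nn: "0 \<le> lampk (P j) u u'" using u Pj.nonneg by (simp add: lampk_def resample_def)
        have "lampk (P j) u u' * \<psi> u u' \<le> lampk (P j) u u' * (C * 4 ^ j)"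
        proof (cases "lampk (P j) u u' = 0")
          case False
          then have "P j x x' \<noteq> 0" "A - {x, x'} = A' - {x, x'}"
            by (auto simp: u lampk_def resample_def)
          then have "\<psi> u u' \<le> C * 4 ^ j" using step u j by auto
          then show ?thesis using nn by (rule mult_left_mono)
        qed simp
        then have "w j * (lampk (P j) u u' * \<psi> u u') \<le> w j * (lampk (P j) u u' * (C * 4 ^ j))"
          by (rule mult_left_mono) (use wpos [of j] in simp)
        also have "\<dots> = (w j * 4 ^ j) * (C * lampk (P j) u u')" by (simp add: mult_ac)
        also have "\<dots> \<le> 1 * (C * lampk (P j) u u')"
          using s1 C nn by (intro mult_right_mono) (auto simp: w_def)
        finally show "w j * lampk (P j) u u' * \<psi> u u' \<le> C * lampk (P j) u u'" by (simp add: mult.assoc)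
      qed
      finally show "lampk p u u' * \<psi> u u' \<le> (\<Sum>j<Suc K. C * lampk (P j) u u')" .
    qed
    also have "\<dots> = (\<Sum>u\<in>?O. \<Sum>j<Suc K. \<Sum>u'\<in>?O. C * lampk (P j) u u')"
      by (intro sum.cong refl sum.swap)
    also have "\<dots> = (\<Sum>u\<in>?O. \<Sum>j<Suc K. C)"
    proof (intro sum.cong refl)
      fix u j assume uj: "u \<in> ?O" "j \<in> {..<Suc K}"
      interpret Lj: symmetric_markov ?O "lampk (P j)"
        using P uj by (intro symmetric_markov.symmetric_markov_lampk) simp
      show "(\<Sum>u'\<in>?O. C * lampk (P j) u u') = C"
        using Lj.total [OF uj(1)] by (simp only: sum_distrib_left [symmetric] mult_1_right)
    qed
    also have "\<dots> = m * (C * (real K + 1))" by (simp add: m_def algebra_simps)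
    finally show ?thesis .
  qed
  define t where "t = real N / (4 * G)"
  have t0: "0 < t" using G0 by (simp add: t_def N(2))
  have "m * (c * t powr \<sigma>) = c * t powr (\<sigma> - 1) * (m * t)"
    using t0 powr_add [of t "\<sigma> - 1" 1] by simp
  also have "\<dots> \<le> c * t powr (\<sigma> - 1) *
      ((\<Sum>u\<in>?O. \<Sum>u'\<in>?O. L.kp N u u' * lamp_diff u u') - m * t)"
  proof (intro mult_left_mono)
    have "m * (2 * t) \<le> m * (real (N + 1) / (2 * G))"
      using m0 G0 by (intro mult_left_mono) (auto simp: t_def field_simps)
    also have "\<dots> \<le> (\<Sum>u\<in>?O. \<Sum>u'\<in>?O. L.kp N u u' * lamp_diff u u')"
      using p.sum_lamp_diff_ge [of "N - 1" G] G G0 N(1) unfolding m_def by (simp only:)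
    finally show "m * t \<le> (\<Sum>u\<in>?O. \<Sum>u'\<in>?O. L.kp N u u' * lamp_diff u u') - m * t" by simp
  qed (use c in simp)
  also have "(\<Sum>u\<in>?O. \<Sum>u'\<in>?O. L.kp N u u' * lamp_diff u u') - m * t
      = (\<Sum>u\<in>?O. \<Sum>u'\<in>?O. L.kp N u u' * (lamp_diff u u' - t))"
  proof -
    have "(\<Sum>u\<in>?O. \<Sum>u'\<in>?O. L.kp N u u' * t) = (\<Sum>u\<in>?O. t)"
      by (intro sum.cong refl) (simp add: sum_distrib_right [symmetric] L.kp_total)
    also have "\<dots> = m * t" by (simp add: m_def)
    finally show ?thesis by (simp add: right_diff_distrib sum_subtractf)
  qed
  also have "c * t powr (\<sigma> - 1) * \<dots>
      = (\<Sum>u\<in>?O. \<Sum>u'\<in>?O. L.kp N u u' * (c * (t powr (\<sigma> - 1) * (lamp_diff u u' - t))))"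
    by (simp only: sum_distrib_left mult_ac)
  also have "\<dots> \<le> L.energy \<psi> N"
    unfolding L.energy_def
  proof (intro sum_mono mult_left_mono)
    fix u u' assume u: "u \<in> ?O" "u' \<in> ?O"
    have "c * (t powr (\<sigma> - 1) * (lamp_diff u u' - t)) \<le> c * lamp_diff u u' powr \<sigma>"
      using t0 \<sigma> c by (intro mult_left_mono powr_tangent) (auto simp: lamp_diff_def)
    also have "\<dots> \<le> \<psi> u u'" using low u by blast
    finally show "c * (t powr (\<sigma> - 1) * (lamp_diff u u' - t)) \<le> \<psi> u u'" .
    show "0 \<le> L.kp N u u'" using L.kp_nonneg u by blast
  qed
  also have "\<dots> \<le> 4 ^ K * L.energy \<psi> 1"
    using L.energy_pow2 [OF ker, of "2 * K"] by (simp add: N_def power_mult)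
  also have "\<dots> \<le> 4 ^ K * (m * (C * (real K + 1)))"
    using e1 by (intro mult_left_mono) auto
  finally have "m * (c * t powr \<sigma>) \<le> m * (C * (real K + 1) * 4 ^ K)" by (simp add: mult_ac)
  then have "c * t powr \<sigma> \<le> C * (real K + 1) * 4 ^ K" using m0 by simp
  then show ?thesis by (simp add: t_def N(2) G_def)
qed

section \<open>Nets and quadratic growth\<close>

context word_metric
begin

text \<open>The image of \<open>\<pi>\<close> is a maximal \<open>r\<close>-separated subset, and its fibres are Voronoi cells: each lies in
  the ball of radius \<open>r\<close> and contains the ball of radius \<open>r / 2\<close> around its net point.\<close>

definition net_map :: "'a set \<Rightarrow> nat \<Rightarrow> ('a \<Rightarrow> 'a) \<Rightarrow> bool" where
  "net_map X r \<pi> \<longleftrightarrow>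
     (\<forall>x\<in>X. \<pi> x \<in> X \<and> dst (\<pi> x) x < r) \<and>
     (\<forall>x\<in>X. \<forall>y\<in>X. 2 * dst (\<pi> x) y < r \<longrightarrow> \<pi> y = \<pi> x) \<and>
     (\<forall>x\<in>X. \<forall>y\<in>X. \<pi> x \<noteq> \<pi> y \<longrightarrow> r \<le> dst (\<pi> x) (\<pi> y))"

lemma net_map_exists:
  assumes X: "X \<subseteq> carrier G" and r: "0 < r"
  shows "\<exists>\<pi>. net_map X r \<pi>"
proof -
  define sep where "sep = {N. N \<subseteq> X \<and> (\<forall>p\<in>N. \<forall>q\<in>N. p \<noteq> q \<longrightarrow> r \<le> dst p q)}"
  have "\<exists>N\<in>sep. \<forall>M\<in>sep. N \<subseteq> M \<longrightarrow> M = N"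
  proof (rule subset_Zorn_nonempty)
    have "{} \<in> sep" by (simp add: sep_def)
    then show "sep \<noteq> {}" by (rule ex_in_conv [THEN iffD1, OF exI])
    fix \<C> assume \<C>: "\<C> \<noteq> {}" "subset.chain sep \<C>"
    have chain: "\<C> \<subseteq> sep" "\<And>A B. A \<in> \<C> \<Longrightarrow> B \<in> \<C> \<Longrightarrow> A \<subseteq> B \<or> B \<subseteq> A"
      using \<C>(2) by (auto simp: subset_chain_def)
    have "r \<le> dst p q" if "p \<in> \<Union>\<C>" "q \<in> \<Union>\<C>" "p \<noteq> q" for p q
    proof -
      obtain M1 M2 where M: "M1 \<in> \<C>" "p \<in> M1" "M2 \<in> \<C>" "q \<in> M2" using \<open>p \<in> \<Union>\<C>\<close> \<open>q \<in> \<Union>\<C>\<close> by auto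
      have "M1 \<union> M2 \<in> \<C>"
        using chain(2) M(1,3) by (metis sup.absorb1 sup.absorb2)
      then have "M1 \<union> M2 \<in> sep" using chain(1) by (rule subsetD [rotated])
      then show ?thesis using M(2,4) that(3) by (simp add: sep_def)
    qed
    moreover have "\<Union>\<C> \<subseteq> X" using chain(1) by (auto simp: sep_def)
    ultimately show "\<Union>\<C> \<in> sep" by (simp add: sep_def)
  qed
  then obtain N where N: "N \<subseteq> X" "\<And>p q. p \<in> N \<Longrightarrow> q \<in> N \<Longrightarrow> p \<noteq> q \<Longrightarrow> r \<le> dst p q"
    and max: "\<And>M. M \<in> sep \<Longrightarrow> N \<subseteq> M \<Longrightarrow> M = N"
    by (auto simp: sep_def)
  have cover: "\<exists>p\<in>N. dst p x < r" if x: "x \<in> X" for x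
  proof (rule ccontr)
    assume "\<not> ?thesis"
    then have far: "r \<le> dst p x" if "p \<in> N" for p using that by force
    have far': "r \<le> dst x p" if "p \<in> N" for p
    proof -
      have "p \<in> carrier G" "x \<in> carrier G" using that x X N(1) by auto
      then show ?thesis using far [OF that] dst_commute [of p x] by simp
    qed
    have "insert x N \<in> sep" using N far far' x by (simp add: sep_def)
    then have "x \<in> N" using max by blast
    then show False using far [of x] x X r by auto
  qed
  define \<pi> where "\<pi> x = arg_min (\<lambda>p. dst p x) (\<lambda>p. p \<in> N)" for x
  have \<pi>: "\<pi> x \<in> N" "\<And>p. p \<in> N \<Longrightarrow> dst (\<pi> x) x \<le> dst p x" if x: "x \<in> X" for x
  proof -
    obtain p where "p \<in> N" using cover [OF x] by blast
    then show "\<pi> x \<in> N" "\<And>p. p \<in> N \<Longrightarrow> dst (\<pi> x) x \<le> dst p x"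
      unfolding \<pi>_def using arg_min_nat_lemma [of "\<lambda>p. p \<in> N" p "\<lambda>p. dst p x"] by auto
  qed
  have "net_map X r \<pi>"
    unfolding net_map_def
  proof (intro conjI ballI impI)
    fix x assume x: "x \<in> X"
    show "\<pi> x \<in> X" using \<pi>(1) [OF x] N(1) by auto
    show "dst (\<pi> x) x < r" using cover [OF x] \<pi>(2) [OF x] by (meson le_less_trans)
    fix y assume y: "y \<in> X"
    show "r \<le> dst (\<pi> x) (\<pi> y)" if "\<pi> x \<noteq> \<pi> y"
      using that N(2) \<pi>(1) x y by blast
    show "\<pi> y = \<pi> x" if "2 * dst (\<pi> x) y < r"
    proof (rule ccontr)
      assume ne: "\<pi> y \<noteq> \<pi> x"
      have c: "\<pi> x \<in> carrier G" "\<pi> y \<in> carrier G" "y \<in> carrier G" using \<pi>(1) x y N(1) X by auto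
      have "r \<le> dst (\<pi> x) (\<pi> y)" using N(2) \<pi>(1) x y ne by metis
      also have "\<dots> \<le> dst (\<pi> x) y + dst (\<pi> y) y"
        using dst_triangle [OF c(1,3,2)] dst_commute [OF c(3,2)] by simp
      also have "\<dots> \<le> 2 * dst (\<pi> x) y" using \<pi>(2) [OF y \<pi>(1) [OF x]] by simp
      finally show False using that by simp
    qed
  qed
  then show ?thesis by blast
qed

lemma net_mapD:
  assumes "net_map X r \<pi>" "x \<in> X"
  shows "\<pi> x \<in> X" "dst (\<pi> x) x < r" "y \<in> X \<Longrightarrow> 2 * dst (\<pi> x) y < r \<Longrightarrow> \<pi> y = \<pi> x"
    "y \<in> X \<Longrightarrow> \<pi> x \<noteq> \<pi> y \<Longrightarrow> r \<le> dst (\<pi> x) (\<pi> y)"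
  using assms unfolding net_map_def by blast+

end

locale quadratic_metric = word_metric +
  fixes a b :: real
  assumes a: "0 < a" and b: "0 < b"
    and growth_ge: "a * (real n + 1)\<^sup>2 \<le> real (card {x \<in> carrier G. len x \<le> n})"
    and growth_le: "real (card {x \<in> carrier G. len x \<le> n}) \<le> b * (real n + 1)\<^sup>2"
begin

text \<open>The balls of radius about \<open>r / 2\<close> around net points are disjoint, so that their volumes add up to at
  most the volume of a ball of radius about \<open>(c + 1) r\<close>.\<close>

lemma net_card_le:
  assumes \<pi>: "net_map (carrier G) r \<pi>" and r: "0 < r" and z: "z \<in> carrier G" and m: "m \<le> c * r"
  shows "finite {p \<in> \<pi> ` carrier G. dst z p \<le> m}"
    and "real (card {p \<in> \<pi> ` carrier G. dst z p \<le> m}) \<le> 4 * b * (real c + 1)\<^sup>2 / a"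
proof -
  let ?N = "{p \<in> \<pi> ` carrier G. dst z p \<le> m}"
  have N: "?N \<subseteq> {x \<in> carrier G. dst z x \<le> m}" using net_mapD(1) [OF \<pi>] by auto
  then show fin: "finite ?N" using card_ball(2) [OF z] finite_subset by blast
  define h where "h = (r - 1) div 2"
  let ?B = "\<lambda>p. {x \<in> carrier G. dst p x \<le> h}"
  have disj: "?B p \<inter> ?B q = {}" if pq: "p \<in> ?N" "q \<in> ?N" "p \<noteq> q" for p q
  proof -
    obtain u v where uv: "p = \<pi> u" "q = \<pi> v" "u \<in> carrier G" "v \<in> carrier G" using pq by auto
    have c: "p \<in> carrier G" "q \<in> carrier G" using N pq by auto
    have "r \<le> dst p q" using net_mapD(4) [OF \<pi>, of u v] uv pq by auto
    moreover have "dst p q \<le> 2 * h" if "x \<in> ?B p" "x \<in> ?B q" for x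
      using that dst_triangle [OF c(1) _ c(2), of x] dst_commute [of x q] c by auto
    ultimately show ?thesis using r by (force simp: h_def)
  qed
  have sub: "(\<Union>p\<in>?N. ?B p) \<subseteq> {x \<in> carrier G. dst z x \<le> m + h}"
  proof
    fix x assume "x \<in> (\<Union>p\<in>?N. ?B p)"
    then obtain p where p: "p \<in> ?N" "x \<in> ?B p" by blast
    then have "p \<in> carrier G" using N by auto
    then show "x \<in> {x \<in> carrier G. dst z x \<le> m + h}" using p dst_triangle [OF z, of p x] by auto
  qed
  have "real (card ?N) * (a * (real h + 1)\<^sup>2) = (\<Sum>p\<in>?N. a * (real h + 1)\<^sup>2)" by simp
  also have "\<dots> \<le> (\<Sum>p\<in>?N. real (card (?B p)))"
  proof (rule sum_mono)
    fix p assume "p \<in> ?N"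
    then have "p \<in> carrier G" using N by auto
    then show "a * (real h + 1)\<^sup>2 \<le> real (card (?B p))" using card_ball(1) growth_ge by simp
  qed
  also have "\<dots> = real (card (\<Union>p\<in>?N. ?B p))"
    using fin disj N card_ball(2) by (subst card_UN_disjoint) auto
  also have "\<dots> \<le> real (card {x \<in> carrier G. dst z x \<le> m + h})"
    using card_mono [OF card_ball(2) [OF z] sub] by simp
  also have "\<dots> \<le> b * (real (m + h) + 1)\<^sup>2" using card_ball(1) [OF z] growth_le [of "m + h"] by simp
  also have "\<dots> \<le> b * ((real c + 1) * real r)\<^sup>2"
  proof -
    have "h + 1 \<le> r" using r by (auto simp: h_def)
    then have "m + h + 1 \<le> (c + 1) * r" using m by simp
    then have "real (m + h) + 1 \<le> (real c + 1) * real r"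
      by (metis of_nat_1 of_nat_add of_nat_le_iff of_nat_mult)
    then show ?thesis using b by (intro mult_left_mono power_mono) auto
  qed
  finally have le: "real (card ?N) * (a * (real h + 1)\<^sup>2) \<le> b * ((real c + 1) * real r)\<^sup>2" .
  have "r \<le> 2 * (h + 1)" using r by (auto simp: h_def)
  then have "real r \<le> real (2 * (h + 1))" by (simp only: of_nat_le_iff)
  then have "real r / 2 \<le> real h + 1" by simp
  then have "(real r / 2)\<^sup>2 \<le> (real h + 1)\<^sup>2" by (intro power_mono) auto
  then have "real (card ?N) * (a * (real r / 2)\<^sup>2) \<le> real (card ?N) * (a * (real h + 1)\<^sup>2)"
    using a by (intro mult_left_mono) auto
  then have "real (card ?N) * (a * (real r / 2)\<^sup>2) \<le> b * ((real c + 1) * real r)\<^sup>2" using le by simp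
  then have "(real (card ?N) * a) * (real r)\<^sup>2 \<le> (4 * b * (real c + 1)\<^sup>2) * (real r)\<^sup>2"
    by (simp add: power_mult_distrib power_divide mult_ac)
  then have "real (card ?N) * a \<le> 4 * b * (real c + 1)\<^sup>2" using r by simp
  then show "real (card ?N) \<le> 4 * b * (real c + 1)\<^sup>2 / a" using a by (simp add: pos_le_divide_eq)
qed

text \<open>If the centre \<open>c\<close> is close to the boundary of the large ball, one passes to a smaller ball around a
  point on a geodesic from \<open>c\<close> to the identity.\<close>

lemma card_inner_ball_ge:
  assumes c: "c \<in> carrier G" "len c \<le> R" and r: "0 < r" "r \<le> R"
  shows "a * (real r)\<^sup>2 / 16 \<le> real (card {y \<in> carrier G. len y \<le> R \<and> 2 * dst c y < r})"
proof -
  define s where "s = (r - 1) div 2"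
  define m where "m = (s + 1) div 2"
  define h where "h = s div 2"
  have mh: "m + h = s" "2 * s < r" "h \<le> R" using r by (auto simp: m_def h_def s_def)
  obtain y where y: "y \<in> carrier G" "dst c y \<le> m" "len y + h \<le> R"
  proof (cases "m \<le> len c")
    case True
    obtain y where "y \<in> carrier G" "dst c y \<le> m" "len y \<le> len c - m"
      using geodesic_point [OF c(1) True] .
    moreover have "h \<le> m" by (auto simp: m_def h_def)
    ultimately show ?thesis using that c True by auto
  next
    case False
    then show ?thesis
      using that [of \<one>] c mh dst_commute [of c \<one>] dst_one by auto
  qed
  have "{x \<in> carrier G. dst y x \<le> h} \<subseteq> {y \<in> carrier G. len y \<le> R \<and> 2 * dst c y < r}"
  proof
    fix x assume x: "x \<in> {x \<in> carrier G. dst y x \<le> h}"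
    then have "len x \<le> len y + h" using dst_triangle [of \<one> y x] y dst_one by auto
    moreover have "dst c x \<le> s" using dst_triangle [of c y x] x y c mh by auto
    ultimately show "x \<in> {y \<in> carrier G. len y \<le> R \<and> 2 * dst c y < r}" using x y mh by auto
  qed
  moreover have "finite {y \<in> carrier G. len y \<le> R \<and> 2 * dst c y < r}"
    by (rule finite_subset [OF _ finite_ball [of R]]) auto
  ultimately have "card {x \<in> carrier G. dst y x \<le> h} \<le> card {y \<in> carrier G. len y \<le> R \<and> 2 * dst c y < r}"
    by (intro card_mono)
  then have "a * (real h + 1)\<^sup>2 \<le> real (card {y \<in> carrier G. len y \<le> R \<and> 2 * dst c y < r})"
    using card_ball(1) [OF y(1), of h] growth_ge [of h] by simp
  moreover have "a * (real r)\<^sup>2 / 16 \<le> a * (real h + 1)\<^sup>2"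
  proof -
    have "r \<le> 4 * (h + 1)" using r by (auto simp: h_def s_def)
    then have "real r \<le> real (4 * (h + 1))" by (simp only: of_nat_le_iff)
    then have "real r / 4 \<le> real h + 1" by simp
    then have "(real r / 4)\<^sup>2 \<le> (real h + 1)\<^sup>2" by (intro power_mono) auto
    then have "a * (real r / 4)\<^sup>2 \<le> a * (real h + 1)\<^sup>2" using a by (intro mult_left_mono) auto
    then show ?thesis by (simp add: power_divide)
  qed
  ultimately show ?thesis by simp
qed

end

text \<open>Up to a change of constants \<open>n\<^sup>2\<close> can be replaced by \<open>(n + 1)\<^sup>2\<close>, which makes the bounds hold at
  radius zero as well.\<close>

lemma quadratic_growth_metric:
  assumes "group G" "quadratic_growth G"
  obtains S a b where "quadratic_metric G S a b"
proof -
  obtain S a b where S: "fin_sym_generating G S" and ab: "a > 0" "b > 0"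
    and gr: "\<And>r::real. r \<ge> 1 \<Longrightarrow>
      a * r\<^sup>2 \<le> real (card {x \<in> carrier G. real (word_dist G S \<one>\<^bsub>G\<^esub> x) \<le> r}) \<and>
      real (card {x \<in> carrier G. real (word_dist G S \<one>\<^bsub>G\<^esub> x) \<le> r}) \<le> b * r\<^sup>2"
    using assms(2) unfolding quadratic_growth_def by blast
  interpret word_metric G S using assms(1) S by (simp add: word_metric_def word_metric_axioms_def)
  have g: "a * (real n)\<^sup>2 \<le> real (card {x \<in> carrier G. len x \<le> n})"
    "real (card {x \<in> carrier G. len x \<le> n}) \<le> b * (real n)\<^sup>2" if "n \<ge> 1" for n
  proof -
    have "{x \<in> carrier G. real (word_dist G S \<one>\<^bsub>G\<^esub> x) \<le> real n} = {x \<in> carrier G. len x \<le> n}"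
      using dst_one by auto
    then show "a * (real n)\<^sup>2 \<le> real (card {x \<in> carrier G. len x \<le> n})"
      "real (card {x \<in> carrier G. len x \<le> n}) \<le> b * (real n)\<^sup>2"
      using gr [of "real n"] that by auto
  qed
  have "quadratic_metric G S (min 1 a / 4) b"
  proof
    fix n :: nat
    show "min 1 a / 4 * (real n + 1)\<^sup>2 \<le> real (card {x \<in> carrier G. len x \<le> n})"
    proof (cases "n = 0")
      case True
      have "card {\<one>\<^bsub>G\<^esub>} \<le> card {x \<in> carrier G. len x \<le> n}"
        by (intro card_mono finite_ball) auto
      then show ?thesis using True ab by simp
    next
      case False
      then have "(real n + 1)\<^sup>2 \<le> (2 * real n)\<^sup>2" by (intro power_mono) auto
      then have "min 1 a / 4 * (real n + 1)\<^sup>2 \<le> min 1 a / 4 * (2 * real n)\<^sup>2"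
        using ab by (intro mult_left_mono) auto
      also have "\<dots> \<le> a * (real n)\<^sup>2" by (simp add: mult_right_mono)
      finally show ?thesis using g [of n] False by simp
    qed
    have "card {x \<in> carrier G. len x \<le> n} \<le> card {x \<in> carrier G. len x \<le> n + 1}"
      by (intro card_mono finite_ball) auto
    then show "real (card {x \<in> carrier G. len x \<le> n}) \<le> b * (real n + 1)\<^sup>2"
      using g(2) [of "n + 1"] by (simp add: add.commute)
  qed (use ab in auto)
  then show thesis by (rule that)
qed

section \<open>Upper bounds\<close>

lemma exponential_beats_polynomial:
  fixes c C B \<sigma> :: real
  assumes "0 < c" "0 < B" "1 < \<sigma>"
  shows "\<exists>K::nat. C * (real K + 1) * 4 ^ K < c * (4 ^ K / (B * (real K + 1))) powr \<sigma>"
proof -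
  have "filterlim (\<lambda>K::nat. c * (4 ^ K / (B * (real K + 1))) powr \<sigma> / ((real K + 1) * 4 ^ K)) at_top at_top"
    using assms by real_asymp
  then have "eventually (\<lambda>K::nat. C < c * (4 ^ K / (B * (real K + 1))) powr \<sigma> / ((real K + 1) * 4 ^ K)) at_top"
    by (simp add: filterlim_at_top_dense)
  then obtain K :: nat where "C < c * (4 ^ K / (B * (real K + 1))) powr \<sigma> / ((real K + 1) * 4 ^ K)"
    by (meson eventually_happens trivial_limit_sequentially)
  then have "C * ((real K + 1) * 4 ^ K) < c * (4 ^ K / (B * (real K + 1))) powr \<sigma>"
    by (subst (asm) pos_less_divide_eq) (auto simp: add_pos_pos)
  then show ?thesis by (auto simp: mult.assoc)
qed

lemma symmetric_markov_partition:
  assumes Q: "finite Q"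
  shows "symmetric_markov Q (\<lambda>x y. if \<pi> x = \<pi> y then 1 / real (card {u \<in> Q. \<pi> u = \<pi> x}) else 0)"
proof
  fix x assume x: "x \<in> Q"
  then have c: "card {u \<in> Q. \<pi> u = \<pi> x} \<noteq> 0" using Q by auto
  have "(\<Sum>y\<in>Q. if \<pi> x = \<pi> y then 1 / real (card {u \<in> Q. \<pi> u = \<pi> x}) else 0)
      = (\<Sum>y\<in>{y \<in> Q. \<pi> x = \<pi> y}. 1 / real (card {u \<in> Q. \<pi> u = \<pi> x}))"
    using Q by (rule sum.inter_filter [symmetric])
  also have "{y \<in> Q. \<pi> x = \<pi> y} = {u \<in> Q. \<pi> u = \<pi> x}" by auto
  finally show "(\<Sum>y\<in>Q. if \<pi> x = \<pi> y then 1 / real (card {u \<in> Q. \<pi> u = \<pi> x}) else 0) = 1"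
    using c by simp
qed (use Q in auto)

context wreath_metric
begin

lemma W_dst_lamp:
  assumes "g \<in> carrier G" "g' \<in> carrier G"
  shows "W.dst (lamp g, \<one>\<^bsub>H\<^esub>) (lamp g', \<one>\<^bsub>H\<^esub>) = G.dst g g'"
proof -
  have c: "(lamp g, \<one>\<^bsub>H\<^esub>) \<in> carrier W" "(lamp g', \<one>\<^bsub>H\<^esub>) \<in> carrier W" using W_lamp assms by auto
  have d: "diff (lamp g) (lamp g') \<subseteq> {\<one>\<^bsub>H\<^esub>}" by (auto simp: diff_def lamp_def)
  have l: "lamp_dist (lamp g) (lamp g') = G.dst g g'"
    by (subst lamp_dist_eq_sum [OF c _ d]) (auto simp: lamp_def)
  show ?thesis
    using W_dst_le_salesman [OF c H.tour_start d] lamp_dist_le_W_dst [OF c] l by simp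
qed

lemma compression_admissible_base:
  assumes "compression_admissible W SW \<alpha>"
  shows "compression_admissible G S \<alpha>"
proof -
  obtain \<psi> C c where k: "L2_kernel (carrier W) \<psi>" and c: "0 < c"
    and up: "\<forall>x\<in>carrier W. \<forall>y\<in>carrier W. \<psi> x y \<le> C * (real (W.dst x y))\<^sup>2"
    and low: "\<forall>x\<in>carrier W. \<forall>y\<in>carrier W. x \<noteq> y \<longrightarrow> c * real (W.dst x y) powr (2 * \<alpha>) \<le> \<psi> x y"
    using assms unfolding W.compression_admissible_iff by (elim exE conjE)
  let ?h = "\<lambda>g. (lamp g, \<one>\<^bsub>H\<^esub>)"
  have h: "?h ` carrier G \<subseteq> carrier W" using W_lamp by auto
  have ne: "?h x \<noteq> ?h y" if "x \<noteq> y" for x y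
  proof
    assume "?h x = ?h y"
    then have "lamp x \<one>\<^bsub>H\<^esub> = lamp y \<one>\<^bsub>H\<^esub>" by simp
    then show False using that by (simp add: lamp_def)
  qed
  have "L2_kernel (carrier G) (\<lambda>x y. \<psi> (?h x) (?h y))" by (rule L2_kernel_pullback [OF k h])
  moreover have "\<forall>x\<in>carrier G. \<forall>y\<in>carrier G. \<psi> (?h x) (?h y) \<le> C * (real (G.dst x y))\<^sup>2"
    using up W_lamp W_dst_lamp by (metis (no_types, lifting))
  moreover have "\<forall>x\<in>carrier G. \<forall>y\<in>carrier G. x \<noteq> y \<longrightarrow>
      c * real (G.dst x y) powr (2 * \<alpha>) \<le> \<psi> (?h x) (?h y)"
    using low W_lamp W_dst_lamp ne by (metis (no_types, lifting))
  ultimately show ?thesis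
    unfolding G.compression_admissible_iff using c by (intro exI conjI)
qed

end

locale quadratic_wreath = wreath_metric G S H T + H: quadratic_metric H T a b
  for G :: "('a, 'm) monoid_scheme" and S and H :: "('b, 'n) monoid_scheme" and T and a b
begin

definition lights :: "'a \<Rightarrow> 'b set \<Rightarrow> 'b \<Rightarrow> 'a" where
  "lights s A = (\<lambda>z\<in>carrier H. if z \<in> A then s else \<one>\<^bsub>G\<^esub>)"

lemma W_lights:
  assumes "s \<in> carrier G" "finite A" "x \<in> carrier H"
  shows "(lights s A, x) \<in> carrier W"
proof -
  have "{z \<in> carrier H. lights s A z \<noteq> \<one>\<^bsub>G\<^esub>} \<subseteq> A" by (auto simp: lights_def)
  then have "finite {z \<in> carrier H. lights s A z \<noteq> \<one>\<^bsub>G\<^esub>}" using assms finite_subset by blast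
  moreover have "lights s A \<in> carrier H \<rightarrow>\<^sub>E carrier G" using assms by (auto simp: lights_def)
  ultimately show ?thesis using assms by (simp only: W_carrier_iff)
qed

lemma diff_lights:
  assumes "s \<noteq> \<one>\<^bsub>G\<^esub>" "A \<subseteq> carrier H" "A' \<subseteq> carrier H"
  shows "diff (lights s A) (lights s A') = A - A' \<union> (A' - A)"
  using assms by (auto simp: diff_def lights_def)

text \<open>The lamplighter chain runs on a ball of radius \<open>2 ^ K\<close> in \<open>H\<close> with the lamp states \<open>\<one>\<close> and \<open>s\<close>; a
  step of scale \<open>j\<close> resamples the position in a Voronoi cell of diameter about \<open>2 ^ j\<close>. Since the cells
  have at least about \<open>4 ^ j\<close> points, \<open>lamplighter_bound\<close> applies. Distances are at least the number of changed
  lamps; an exponent above one half would make the energy grow faster than linearly.\<close>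

theorem compression_admissible_le_half:
  assumes s: "s \<in> carrier G" "s \<noteq> \<one>\<^bsub>G\<^esub>" and adm: "compression_admissible W SW \<alpha>"
  shows "\<alpha> \<le> 1 / 2"
proof (rule ccontr)
  assume "\<not> \<alpha> \<le> 1 / 2"
  then have \<sigma>: "1 < 2 * \<alpha>" by simp
  obtain \<psi> C c where k: "L2_kernel (carrier W) \<psi>" and c: "0 < c"
    and up: "\<forall>x\<in>carrier W. \<forall>y\<in>carrier W. \<psi> x y \<le> C * (real (W.dst x y))\<^sup>2"
    and low: "\<forall>x\<in>carrier W. \<forall>y\<in>carrier W. x \<noteq> y \<longrightarrow> c * real (W.dst x y) powr (2 * \<alpha>) \<le> \<psi> x y"
    using adm unfolding W.compression_admissible_iff by (elim exE conjE)
  define D where "D = \<bar>C\<bar> * (6 + 2 * real (G.len s))\<^sup>2"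
  define v where "v = 16 / a"
  have v: "0 \<le> v" using H.a by (simp add: v_def)
  have main: "c * (4 ^ K / (4 * ((1 + 6 * v) * (real K + 1)))) powr (2 * \<alpha>) \<le> D * (real K + 1) * 4 ^ K" for K
  proof -
    define Q where "Q = {x \<in> carrier H. H.len x \<le> 2 ^ K}"
    have Q: "finite Q" "Q \<subseteq> carrier H" "\<one>\<^bsub>H\<^esub> \<in> Q" using H.finite_ball by (auto simp: Q_def)
    have "\<exists>\<pi>. H.net_map Q (2 ^ j) \<pi>" for j using H.net_map_exists [OF Q(2), of "2 ^ j"] by simp
    then obtain \<pi> where \<pi>: "\<And>j. H.net_map Q (2 ^ j) (\<pi> j)" by metis
    define P where "P j x y = (if \<pi> j x = \<pi> j y then 1 / real (card {u \<in> Q. \<pi> j u = \<pi> j x}) else 0)" for j x y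
    define emb where "emb u = (lights s (fst u), snd u)" for u :: "'b set \<times> 'b"
    have emb: "emb u \<in> carrier W" if "u \<in> Pow Q \<times> Q" for u
      using that Q finite_subset [of _ Q] by (auto simp: emb_def intro!: W_lights s)
    show ?thesis
    proof (rule lamplighter_bound [where Q = Q and P = P and v = v and \<psi> = "\<lambda>u u'. \<psi> (emb u) (emb u')"])
      show "finite Q" "Q \<noteq> {}" using Q by auto
      show "symmetric_markov Q (P j)" for j
        unfolding P_def by (rule symmetric_markov_partition [OF Q(1)])
      show "P j x y \<le> v / 4 ^ j" if j: "j \<le> K" and x: "x \<in> Q" for j x y
      proof -
        have c: "\<pi> j x \<in> Q" using H.net_mapD(1) [OF \<pi> x] .
        have "2 ^ j \<le> (2::nat) ^ K" using j by (intro power_increasing) auto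
        then have "a * (real (2 ^ j))\<^sup>2 / 16 \<le> real (card {y \<in> carrier H. H.len y \<le> 2 ^ K \<and> 2 * H.dst (\<pi> j x) y < 2 ^ j})"
          using c by (intro H.card_inner_ball_ge) (auto simp: Q_def)
        also have "\<dots> \<le> real (card {u \<in> Q. \<pi> j u = \<pi> j x})"
        proof -
          have "{y \<in> carrier H. H.len y \<le> 2 ^ K \<and> 2 * H.dst (\<pi> j x) y < 2 ^ j} \<subseteq> {u \<in> Q. \<pi> j u = \<pi> j x}"
          proof
            fix y assume y: "y \<in> {y \<in> carrier H. H.len y \<le> 2 ^ K \<and> 2 * H.dst (\<pi> j x) y < 2 ^ j}"
            then have "y \<in> Q" by (simp add: Q_def)
            moreover have "\<pi> j y = \<pi> j x" using H.net_mapD(3) [OF \<pi> x \<open>y \<in> Q\<close>] y by auto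
            ultimately show "y \<in> {u \<in> Q. \<pi> j u = \<pi> j x}" by simp
          qed
          then show ?thesis using Q(1) by (intro of_nat_mono card_mono) auto
        qed
        finally have le: "a * 4 ^ j / 16 \<le> real (card {u \<in> Q. \<pi> j u = \<pi> j x})"
          by (simp add: power_mult [symmetric] mult.commute [of j 2]) (simp add: power_mult)
        have pos: "0 < a * 4 ^ j / 16" using H.a by simp
        have "P j x y \<le> 1 / real (card {u \<in> Q. \<pi> j u = \<pi> j x})" by (simp add: P_def)
        also have "\<dots> \<le> 1 / (a * 4 ^ j / 16)" using le pos by (intro divide_left_mono mult_pos_pos) auto
        finally show ?thesis by (simp add: v_def)
      qed
      show "L2_kernel (Pow Q \<times> Q) (\<lambda>u u'. \<psi> (emb u) (emb u'))"
        using emb by (intro L2_kernel_pullback [OF k]) auto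
      show "\<psi> (emb (A, x)) (emb (A', x')) \<le> D * 4 ^ j"
        if "A \<subseteq> Q" "A' \<subseteq> Q" "x \<in> Q" "x' \<in> Q" "P j x x' \<noteq> 0" "A - {x, x'} = A' - {x, x'}" for j A x A' x'
      proof -
        have w: "emb (A, x) \<in> carrier W" "emb (A', x') \<in> carrier W" using emb that by auto
        have xc: "x \<in> carrier H" "x' \<in> carrier H" using that Q by auto
        have "\<pi> j x = \<pi> j x'" using that(5) by (auto simp: P_def split: if_splits)
        then have "H.dst (\<pi> j x) x < 2 ^ j" "H.dst (\<pi> j x) x' < 2 ^ j" "\<pi> j x \<in> carrier H"
          using H.net_mapD(1,2) [OF \<pi>] that Q by (auto, metis)
        then have dx: "H.dst x x' \<le> 2 * 2 ^ j"
          using H.dst_triangle [of x "\<pi> j x" x'] H.dst_commute [of x "\<pi> j x"] xc by simp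
        have d: "diff (lights s A) (lights s A') \<subseteq> {x, x'}"
          using that(6) Q(2) that(1,2) diff_lights [OF s(2), of A A'] by auto
        have "H.tour x (insert x' {x}) (0 + 2 * H.dst x x')"
          by (rule H.tour_insert [OF H.tour_start _ xc]) simp
        then have "W.dst (emb (A, x)) (emb (A', x'))
            \<le> 2 * H.dst x x' + H.dst x x' + lamp_dist (lights s A) (lights s A')"
          using w d unfolding emb_def fst_conv snd_conv
          by (intro W_dst_le_salesman [where A = "{x, x'}"]) (auto simp: insert_commute)
        also have "lamp_dist (lights s A) (lights s A') \<le> 2 * G.len s"
        proof -
          have "lamp_dist (lights s A) (lights s A') = (\<Sum>z\<in>{x, x'}. G.dst (lights s A z) (lights s A' z))"
            using w xc d unfolding emb_def fst_conv snd_conv by (intro lamp_dist_eq_sum) auto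
          also have "\<dots> \<le> (\<Sum>z\<in>{x, x'}. G.len s)"
            using s xc G.dst_one [of s] G.dst_commute [of s "\<one>\<^bsub>G\<^esub>"] by (intro sum_mono) (auto simp: lights_def)
          also have "\<dots> \<le> 2 * G.len s" by (simp add: card_insert_if)
          finally show ?thesis .
        qed
        finally have "W.dst (emb (A, x)) (emb (A', x')) \<le> 6 * 2 ^ j + 2 * G.len s" using dx by simp
        also have "\<dots> \<le> (6 + 2 * G.len s) * 2 ^ j" by (simp add: add_mult_distrib)
        finally have "real (W.dst (emb (A, x)) (emb (A', x'))) \<le> real ((6 + 2 * G.len s) * 2 ^ j)"
          by (simp only: of_nat_le_iff)
        then have r: "(real (W.dst (emb (A, x)) (emb (A', x'))))\<^sup>2 \<le> (real ((6 + 2 * G.len s) * 2 ^ j))\<^sup>2"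
          by (intro power_mono) auto
        have "\<psi> (emb (A, x)) (emb (A', x')) \<le> C * (real (W.dst (emb (A, x)) (emb (A', x'))))\<^sup>2"
          using up w by blast
        also have "\<dots> \<le> \<bar>C\<bar> * (real ((6 + 2 * G.len s) * 2 ^ j))\<^sup>2"
          using r by (intro mult_mono) auto
        also have "\<dots> = D * 4 ^ j"
          by (simp add: D_def power_mult_distrib power_mult [symmetric] mult.commute [of j 2])
             (simp add: power_mult)
        finally show ?thesis .
      qed
      show "0 \<le> D" by (simp add: D_def)
      show "c * lamp_diff u u' powr (2 * \<alpha>) \<le> \<psi> (emb u) (emb u')"
        if u: "u \<in> Pow Q \<times> Q" "u' \<in> Pow Q \<times> Q" for u u'
      proof (cases "lamp_diff u u' = 0")
        case True
        then show ?thesis using L2_kernel_nonneg [OF k emb [OF u(1)] emb [OF u(2)]] by simp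
      next
        case False
        obtain A x A' x' where uu: "u = (A, x)" "u' = (A', x')" by (cases u, cases u')
        have AA: "A \<subseteq> carrier H" "A' \<subseteq> carrier H" using u uu Q by auto
        have w: "(lights s A, x) \<in> carrier W" "(lights s A', x') \<in> carrier W"
          using emb [OF u(1)] emb [OF u(2)] by (auto simp: emb_def uu)
        let ?d = "diff (lights s A) (lights s A')"
        have ld: "lamp_diff u u' = real (card ?d)"
          using diff_lights [OF s(2) AA] by (simp add: lamp_diff_def uu)
        then have ne: "emb u \<noteq> emb u'" using False by (auto simp: emb_def uu diff_def)
        have "card ?d = (\<Sum>z\<in>?d. 1)" by simp
        also have "\<dots> \<le> lamp_dist (lights s A) (lights s A')"
          unfolding lamp_dist_def
        proof (rule sum_mono)
          fix z assume "z \<in> ?d"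
          then have "z \<in> carrier H" "lights s A z \<noteq> lights s A' z" by (auto simp: diff_def)
          then have "G.dst (lights s A z) (lights s A' z) \<noteq> 0"
            using G.dst_eq_0_iff W_carrierD(2) [OF w(1)] W_carrierD(2) [OF w(2)] by blast
          then show "1 \<le> G.dst (lights s A z) (lights s A' z)" by simp
        qed
        also have "\<dots> \<le> W.dst (emb u) (emb u')"
          using lamp_dist_le_W_dst [OF w] by (simp add: emb_def uu)
        finally have "lamp_diff u u' \<le> real (W.dst (emb u) (emb u'))" using ld by simp
        then have "lamp_diff u u' powr (2 * \<alpha>) \<le> real (W.dst (emb u) (emb u')) powr (2 * \<alpha>)"
          using \<sigma> by (intro powr_mono2) (auto simp: lamp_diff_def)
        then have "c * lamp_diff u u' powr (2 * \<alpha>) \<le> c * real (W.dst (emb u) (emb u')) powr (2 * \<alpha>)"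
          using c by (intro mult_left_mono) auto
        also have "\<dots> \<le> \<psi> (emb u) (emb u')" using low emb [OF u(1)] emb [OF u(2)] ne by blast
        finally show ?thesis .
      qed
    qed (use v c \<sigma> in auto)
  qed
  have "0 < 4 * (1 + 6 * v)" using v by simp
  from exponential_beats_polynomial [OF c this \<sigma>, of D] obtain K
    where "D * (real K + 1) * 4 ^ K < c * (4 ^ K / (4 * (1 + 6 * v) * (real K + 1))) powr (2 * \<alpha>)" ..
  with main [of K] show False unfolding mult.assoc by linarith
qed

end

section \<open>The embedding\<close>

lemma L2_kernel_add:
  assumes "L2_kernel X \<psi>1" "L2_kernel X \<psi>2"
  shows "L2_kernel X (\<lambda>x y. \<psi>1 x y + \<psi>2 x y)"
proof -
  define \<psi> where "\<psi> i = (if i = 0 then \<psi>1 else if i = 1 then \<psi>2 else (\<lambda>x y. 0))" for i :: nat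
  have sums: "(\<lambda>i. \<psi> i x y) sums (\<psi>1 x y + \<psi>2 x y)" for x y
    using sums_finite [of "{0, 1}" "\<lambda>i. \<psi> i x y"] by (simp add: \<psi>_def)
  have "L2_kernel X (\<lambda>x y. \<Sum>i. \<psi> i x y)"
  proof (rule L2_kernel_suminf)
    show "L2_kernel X (\<psi> i)" for i
      using assms L2_kernel_scalar [of X "\<lambda>_. 0"] by (simp add: \<psi>_def)
  qed (use sums in \<open>auto simp: sums_iff\<close>)
  then show ?thesis by (rule L2_kernel_cong) (use sums in \<open>auto simp: sums_iff\<close>)
qed

lemma powr_subadditive:
  fixes x y s :: real
  assumes "0 \<le> x" "0 \<le> y" "0 \<le> s" "s \<le> 1"
  shows "(x + y) powr s \<le> x powr s + y powr s"
proof (cases "x + y = 0")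
  case False
  then have xy: "0 < x + y" using assms by simp
  have *: "u * (x + y) powr s \<le> (u * (x + y)) powr s" if "0 \<le> u" "u \<le> 1" for u
  proof (cases "u = 0")
    case False
    have "u powr 1 \<le> u powr s" using that False assms by (intro powr_mono') auto
    then have "u \<le> u powr s" using that False by simp
    then show ?thesis using that xy by (simp add: powr_mult mult_right_mono)
  qed simp
  have "(x + y) powr s = (x / (x + y)) * (x + y) powr s + (y / (x + y)) * (x + y) powr s"
  proof -
    have "x / (x + y) + y / (x + y) = 1" using xy by (simp add: add_divide_distrib [symmetric])
    then show ?thesis by (metis distrib_right mult_1)
  qed
  also have "\<dots> \<le> (x / (x + y) * (x + y)) powr s + (y / (x + y) * (x + y)) powr s"
    using assms xy by (intro add_mono *) (auto simp: divide_le_eq)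
  also have "\<dots> = x powr s + y powr s" using xy by simp
  finally show ?thesis .
qed (use assms in \<open>simp add: add_nonneg_eq_0_iff\<close>)

lemma powr_sum_subadditive:
  fixes f :: "'i \<Rightarrow> real"
  assumes "finite I" "\<And>i. i \<in> I \<Longrightarrow> 0 \<le> f i" "0 \<le> s" "s \<le> 1"
  shows "(\<Sum>i\<in>I. f i) powr s \<le> (\<Sum>i\<in>I. f i powr s)"
  using assms(1,2)
proof (induction I rule: finite_induct)
  case (insert i I)
  have "(\<Sum>i\<in>insert i I. f i) powr s \<le> f i powr s + (\<Sum>i\<in>I. f i) powr s"
    using insert assms by (simp add: powr_subadditive sum_nonneg)
  also have "\<dots> \<le> (\<Sum>i\<in>insert i I. f i powr s)" using insert by simp
  finally show ?case .
qed simp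

lemma powr_mult_le:
  fixes x y s :: real
  assumes "1 \<le> c" "0 \<le> y" "0 \<le> s" "s \<le> 1"
  shows "(c * y) powr s \<le> c * y powr s"
proof -
  have "c powr s \<le> c powr 1" using assms by (intro powr_mono) auto
  then have "c powr s \<le> c" using assms by simp
  then show ?thesis using assms by (simp add: powr_mult mult_right_mono)
qed

context quadratic_wreath
begin

text \<open>Scale \<open>k\<close> of the embedding has \<open>0\<close>-\<open>1\<close> coordinates \<open>(p, None, j)\<close> and \<open>(p, Some c, j)\<close> for net points
  \<open>p\<close>, lamp configurations \<open>c\<close> of the cell of \<open>p\<close>, and thresholds \<open>j\<close>. Those of the first kind locate the
  lamplighter. Those of the second kind show the lamps of the cell with multiplicity \<open>weight k p x\<close>.
  This weight vanishes as long as the lamplighter is in the cell, so that switching a lamp changes no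
  coordinate. Away from the cell it is constantly \<open>2 ^ k\<close>, so that a move affects only the boundedly many
  cells close to the lamplighter.\<close>

definition weight :: "nat \<Rightarrow> 'b \<Rightarrow> 'b \<Rightarrow> nat" where
  "weight k p x = min (2 ^ k) (H.dst p x + 1 - 2 ^ k)"

definition cell :: "('b \<Rightarrow> 'b) \<Rightarrow> ('b \<Rightarrow> 'a) \<Rightarrow> 'b \<Rightarrow> 'b \<Rightarrow> 'a" where
  "cell \<pi> \<eta> p = restrict \<eta> {z \<in> carrier H. \<pi> z = p}"

definition coord :: "nat \<Rightarrow> ('b \<Rightarrow> 'b) \<Rightarrow> 'b \<times> ('b \<Rightarrow> 'a) option \<times> nat \<Rightarrow> ('b \<Rightarrow> 'a) \<times> 'b \<Rightarrow> bool" where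
  "coord k \<pi> i u = (case i of (p, c, j) \<Rightarrow> p \<in> \<pi> ` carrier H \<and>
     (case c of None \<Rightarrow> j + H.dst p (snd u) < 2 * 2 ^ k
      | Some c' \<Rightarrow> c' = cell \<pi> (fst u) p \<and> j < weight k p (snd u)))"

definition coord_diff :: "nat \<Rightarrow> ('b \<Rightarrow> 'b) \<Rightarrow> ('b \<Rightarrow> 'a) \<times> 'b \<Rightarrow> ('b \<Rightarrow> 'a) \<times> 'b \<Rightarrow>
    ('b \<times> ('b \<Rightarrow> 'a) option \<times> nat) set" where
  "coord_diff k \<pi> u u' = {i. coord k \<pi> i u \<noteq> coord k \<pi> i u'}"

definition near :: "nat \<Rightarrow> ('b \<Rightarrow> 'b) \<Rightarrow> 'b \<Rightarrow> 'b set" where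
  "near k \<pi> x = {p \<in> \<pi> ` carrier H. H.dst x p \<le> 2 * 2 ^ k}"

text \<open>This bounds the number of net points near a position at every scale; the value is that of
  \<open>net_card_le\<close> for \<open>c = 2\<close>.\<close>

definition M :: real where "M = 36 * b / a"

lemma M_nonneg: "0 \<le> M" using H.a H.b by (simp add: M_def)

lemma coord_None [simp]: "coord k \<pi> (p, None, j) (\<eta>, x) \<longleftrightarrow> p \<in> \<pi> ` carrier H \<and> j + H.dst p x < 2 * 2 ^ k"
  by (simp add: coord_def)

lemma coord_Some [simp]: "coord k \<pi> (p, Some c, j) (\<eta>, x) \<longleftrightarrow>
    p \<in> \<pi> ` carrier H \<and> c = cell \<pi> \<eta> p \<and> j < weight k p x"
  by (simp add: coord_def)

lemma cell_eqI: "p \<notin> \<pi> ` diff \<eta> \<eta>' \<Longrightarrow> cell \<pi> \<eta> p = cell \<pi> \<eta>' p"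
  unfolding cell_def by (rule restrict_ext) (auto simp: diff_def)

lemma cell_neqI: "z \<in> diff \<eta> \<eta>' \<Longrightarrow> cell \<pi> \<eta> (\<pi> z) \<noteq> cell \<pi> \<eta>' (\<pi> z)"
proof
  assume z: "z \<in> diff \<eta> \<eta>'" and e: "cell \<pi> \<eta> (\<pi> z) = cell \<pi> \<eta>' (\<pi> z)"
  from e have "cell \<pi> \<eta> (\<pi> z) z = cell \<pi> \<eta>' (\<pi> z) z" by simp
  with z show False by (simp add: cell_def diff_def)
qed

context
  fixes k :: nat and \<pi> :: "'b \<Rightarrow> 'b"
  assumes \<pi>: "H.net_map (carrier H) (2 ^ k) \<pi>"
begin

lemma net_point: "p \<in> \<pi> ` carrier H \<Longrightarrow> p \<in> carrier H"
  using H.net_mapD(1) [OF \<pi>] by auto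

lemma near_finite: "x \<in> carrier H \<Longrightarrow> finite (near k \<pi> x)"
  unfolding near_def by (rule H.net_card_le(1) [OF \<pi>, where c = 2]) auto

lemma near_card: "x \<in> carrier H \<Longrightarrow> real (card (near k \<pi> x)) \<le> M"
  using H.net_card_le(2) [OF \<pi>, of x "2 * 2 ^ k" 2] by (simp add: near_def M_def power2_eq_square)

lemma finite_coord_diff:
  assumes "(\<eta>, x) \<in> carrier W" "(\<eta>', x') \<in> carrier W"
  shows "finite (coord_diff k \<pi> (\<eta>, x) (\<eta>', x'))"
proof (rule finite_subset)
  have x: "x \<in> carrier H" "x' \<in> carrier H" using assms W_carrierD by auto
  let ?F = "near k \<pi> x \<union> near k \<pi> x' \<union> \<pi> ` diff \<eta> \<eta>'"
  let ?B = "\<Union>p\<in>?F. {p} \<times> {None, Some (cell \<pi> \<eta> p), Some (cell \<pi> \<eta>' p)} \<times> {..<2 * 2 ^ k :: nat}"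
  show "finite ?B" using near_finite x finite_diff [OF assms] by auto
  show "coord_diff k \<pi> (\<eta>, x) (\<eta>', x') \<subseteq> ?B"
  proof
    fix i assume i: "i \<in> coord_diff k \<pi> (\<eta>, x) (\<eta>', x')"
    obtain p c j where ij: "i = (p, c, j)" by (cases i)
    have ne: "coord k \<pi> (p, c, j) (\<eta>, x) \<noteq> coord k \<pi> (p, c, j) (\<eta>', x')"
      using i by (simp add: coord_diff_def ij)
    then have p: "p \<in> \<pi> ` carrier H" by (auto simp: coord_def)
    have pc: "p \<in> carrier H" using net_point [OF p] .
    note cm = H.dst_commute [OF x(1) pc] H.dst_commute [OF x(2) pc]
    have "p \<in> ?F"
    proof (rule ccontr)
      assume "p \<notin> ?F"
      then have d: "2 * 2 ^ k < H.dst p x" "2 * 2 ^ k < H.dst p x'" "cell \<pi> \<eta> p = cell \<pi> \<eta>' p"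
        using p cm cell_eqI by (auto simp: near_def)
      then have "weight k p x = weight k p x'" by (simp add: weight_def)
      then show False using ne d by (cases c) auto
    qed
    moreover have "c \<in> {None, Some (cell \<pi> \<eta> p), Some (cell \<pi> \<eta>' p)}"
      using ne by (cases c) auto
    moreover have "j < 2 * 2 ^ k"
      using ne by (cases c) (auto simp: weight_def)
    ultimately show "i \<in> ?B" unfolding ij by blast
  qed
qed

lemma coord_diff_move:
  assumes x: "x \<in> carrier H" "x' \<in> carrier H" and d: "H.dst x x' \<le> 1"
  shows "real (card (coord_diff k \<pi> (\<eta>, x) (\<eta>, x'))) \<le> 2 * M"
proof -
  define f where "f = (\<lambda>(p, z). if z then (p, None, 2 * 2 ^ k - 1 - min (H.dst p x) (H.dst p x'))
    else (p, Some (cell \<pi> \<eta> p), min (weight k p x) (weight k p x')))"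
  have "coord_diff k \<pi> (\<eta>, x) (\<eta>, x') \<subseteq> f ` (near k \<pi> x \<times> UNIV)"
  proof
    fix i assume i: "i \<in> coord_diff k \<pi> (\<eta>, x) (\<eta>, x')"
    obtain p c j where ij: "i = (p, c, j)" by (cases i)
    have ne: "coord k \<pi> (p, c, j) (\<eta>, x) \<noteq> coord k \<pi> (p, c, j) (\<eta>, x')"
      using i by (simp add: coord_diff_def ij)
    then have p: "p \<in> \<pi> ` carrier H" by (auto simp: coord_def)
    have pc: "p \<in> carrier H" using net_point [OF p] .
    have dd: "H.dst p x \<le> H.dst p x' + 1" "H.dst p x' \<le> H.dst p x + 1"
      using H.dst_triangle [OF pc x(2,1)] H.dst_triangle [OF pc x] d H.dst_commute [OF x] by auto
    show "i \<in> f ` (near k \<pi> x \<times> UNIV)"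
    proof (cases c)
      case None
      have "H.dst p x \<le> 2 * 2 ^ k" "j = 2 * 2 ^ k - 1 - min (H.dst p x) (H.dst p x')"
        using ne dd unfolding None by auto
      then have "p \<in> near k \<pi> x" "i = f (p, True)"
        using p H.dst_commute [OF x(1) pc] by (auto simp: near_def ij None f_def)
      then show ?thesis by blast
    next
      case (Some c')
      have w: "weight k p x \<le> weight k p x' + 1" "weight k p x' \<le> weight k p x + 1"
        using dd by (auto simp: weight_def min_def)
      have c': "c' = cell \<pi> \<eta> p" "(j < weight k p x) \<noteq> (j < weight k p x')"
        using ne unfolding Some by auto
      then have "H.dst p x \<le> 2 * 2 ^ k" "j = min (weight k p x) (weight k p x')"
        using dd w by (auto simp: weight_def min_def split: if_splits)
      then have "p \<in> near k \<pi> x" "i = f (p, False)"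
        using p c' H.dst_commute [OF x(1) pc] by (auto simp: near_def ij Some f_def)
      then show ?thesis by blast
    qed
  qed
  then have "card (coord_diff k \<pi> (\<eta>, x) (\<eta>, x')) \<le> card (near k \<pi> x \<times> (UNIV :: bool set))"
    using near_finite [OF x(1)] by (intro surj_card_le) auto
  also have "\<dots> = 2 * card (near k \<pi> x)" by (simp add: card_cartesian_product)
  finally show ?thesis using near_card [OF x(1)] by linarith
qed

lemma coord_diff_lamp:
  assumes x: "x \<in> carrier H"
  shows "coord_diff k \<pi> (\<eta>, x) (\<eta>(x := g), x) = {}"
proof -
  have "coord k \<pi> (p, c, j) (\<eta>, x) = coord k \<pi> (p, c, j) (\<eta>(x := g), x)" for p c j
  proof (cases c)
    case (Some c')
    show ?thesis
    proof (cases "p = \<pi> x")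
      case True
      then have "weight k p x = 0" using H.net_mapD(2) [OF \<pi> x] by (simp add: weight_def)
      then show ?thesis unfolding Some by simp
    next
      case False
      then have "cell \<pi> \<eta> p = cell \<pi> (\<eta>(x := g)) p" by (intro cell_eqI) (auto simp: diff_def)
      then show ?thesis unfolding Some by simp
    qed
  qed simp
  then show ?thesis by (auto simp: coord_diff_def)
qed

lemma far_box_coords:
  assumes z: "z \<in> diff \<eta> \<eta>'" and far: "2 * 2 ^ k \<le> H.dst (\<pi> z) x + 1" and j: "j < 2 ^ k"
  shows "(\<pi> z, Some (cell \<pi> \<eta> (\<pi> z)), j) \<in> coord_diff k \<pi> (\<eta>, x) (\<eta>', x')"
proof -
  have "weight k (\<pi> z) x = 2 ^ k" using far by (simp add: weight_def)
  moreover have "z \<in> carrier H" using z by (simp add: diff_def)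
  ultimately show ?thesis using cell_neqI [OF z, of \<pi>] j by (simp add: coord_diff_def)
qed

text \<open>Each cell with a changed lamp contributes its full weight \<open>2 ^ k\<close>, unless the lamplighter is close.\<close>

lemma coord_diff_boxes:
  assumes "(\<eta>, x) \<in> carrier W" "(\<eta>', x') \<in> carrier W"
  shows "2 ^ k * card (\<pi> ` diff \<eta> \<eta>') \<le> card (coord_diff k \<pi> (\<eta>, x) (\<eta>', x')) + 2 ^ k * card (near k \<pi> x)"
proof -
  have x: "x \<in> carrier H" using assms W_carrierD by auto
  let ?B = "\<pi> ` diff \<eta> \<eta>' - near k \<pi> x"
  have fin: "finite (\<pi> ` diff \<eta> \<eta>')" using finite_diff [OF assms] by simp
  have "card (\<pi> ` diff \<eta> \<eta>') \<le> card ?B + card (near k \<pi> x)"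
  proof -
    have "card (\<pi> ` diff \<eta> \<eta>') \<le> card (?B \<union> near k \<pi> x)"
      using fin near_finite [OF x] by (intro card_mono) auto
    then show ?thesis using card_Un_le [of ?B "near k \<pi> x"] by (rule order_trans)
  qed
  then have "2 ^ k * card (\<pi> ` diff \<eta> \<eta>') \<le> 2 ^ k * (card ?B + card (near k \<pi> x))"
    by (rule mult_le_mono2)
  moreover have "2 ^ k * card ?B \<le> card (coord_diff k \<pi> (\<eta>, x) (\<eta>', x'))"
  proof -
    let ?f = "\<lambda>(p, j :: nat). (p, Some (cell \<pi> \<eta> p), j)"
    have "inj_on ?f (?B \<times> {..<2 ^ k})" by (auto simp: inj_on_def)
    then have "card (?B \<times> {..<(2::nat) ^ k}) = card (?f ` (?B \<times> {..<2 ^ k}))" by (rule card_image [symmetric])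
    also have "\<dots> \<le> card (coord_diff k \<pi> (\<eta>, x) (\<eta>', x'))"
    proof (rule card_mono [OF finite_coord_diff [OF assms]], clarify)
      fix z and j :: nat assume z: "z \<in> diff \<eta> \<eta>'" "\<pi> z \<notin> near k \<pi> x" and j: "j < 2 ^ k"
      have zc: "z \<in> carrier H" using z by (simp add: diff_def)
      then have "2 * 2 ^ k < H.dst x (\<pi> z)" using z by (auto simp: near_def)
      also have "\<dots> = H.dst (\<pi> z) x" using H.dst_commute [OF x] H.net_mapD(1) [OF \<pi> zc] by simp
      finally show "(\<pi> z, Some (cell \<pi> \<eta> (\<pi> z)), j) \<in> coord_diff k \<pi> (\<eta>, x) (\<eta>', x')"
        using z j by (intro far_box_coords) auto
    qed
    finally show ?thesis by (simp add: mult.commute card_cartesian_product)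
  qed
  ultimately show ?thesis by (simp add: distrib_left)
qed

lemma coord_diff_far_lamp:
  assumes w: "(\<eta>, x) \<in> carrier W" "(\<eta>', x') \<in> carrier W"
    and z: "z \<in> diff \<eta> \<eta>'" "3 * 2 ^ k \<le> H.dst x z + 2"
  shows "2 ^ k \<le> card (coord_diff k \<pi> (\<eta>, x) (\<eta>', x'))"
proof -
  have x: "x \<in> carrier H" "z \<in> carrier H" using w z W_carrierD by (auto simp: diff_def)
  have p: "\<pi> z \<in> carrier H" "H.dst (\<pi> z) z < 2 ^ k" using H.net_mapD [OF \<pi> x(2)] by auto
  have "H.dst x z \<le> H.dst (\<pi> z) x + H.dst (\<pi> z) z"
    using H.dst_triangle [OF x(1) p(1) x(2)] H.dst_commute [OF x(1) p(1)] by simp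
  then have far: "2 * 2 ^ k \<le> H.dst (\<pi> z) x + 1" using z p by simp
  let ?f = "\<lambda>j :: nat. (\<pi> z, Some (cell \<pi> \<eta> (\<pi> z)), j)"
  have "card {..<(2::nat) ^ k} = card (?f ` {..<2 ^ k})"
    by (intro card_image [symmetric]) (auto simp: inj_on_def)
  also have "\<dots> \<le> card (coord_diff k \<pi> (\<eta>, x) (\<eta>', x'))"
    using far_box_coords [OF z(1) far] by (intro card_mono [OF finite_coord_diff [OF w]]) auto
  finally show ?thesis by simp
qed

lemma coord_diff_far_move:
  assumes w: "(\<eta>, x) \<in> carrier W" "(\<eta>', x') \<in> carrier W" and far: "3 * 2 ^ k \<le> H.dst x x' + 2"
  shows "2 ^ k \<le> card (coord_diff k \<pi> (\<eta>, x) (\<eta>', x'))"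
proof -
  have x: "x \<in> carrier H" "x' \<in> carrier H" using w W_carrierD by auto
  have p: "\<pi> x \<in> carrier H" "H.dst (\<pi> x) x < 2 ^ k" using H.net_mapD [OF \<pi> x(1)] by auto
  have "H.dst x x' \<le> H.dst (\<pi> x) x + H.dst (\<pi> x) x'"
    using H.dst_triangle [OF x(1) p(1) x(2)] H.dst_commute [OF x(1) p(1)] by simp
  then have far': "2 * 2 ^ k \<le> H.dst (\<pi> x) x' + 1" using far p by simp
  let ?f = "\<lambda>j :: nat. (\<pi> x, None :: ('b \<Rightarrow> 'a) option, j)"
  have "card {1..(2::nat) ^ k} = card (?f ` {1..2 ^ k})"
    by (intro card_image [symmetric]) (auto simp: inj_on_def)
  also have "\<dots> \<le> card (coord_diff k \<pi> (\<eta>, x) (\<eta>', x'))"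
    using far' p x by (intro card_mono [OF finite_coord_diff [OF w]]) (auto simp: coord_diff_def)
  finally show ?thesis by simp
qed

end


context
  fixes \<pi> :: "nat \<Rightarrow> 'b \<Rightarrow> 'b"
  assumes \<pi>s: "\<And>k. H.net_map (carrier H) (2 ^ k) (\<pi> k)"
begin

text \<open>From a tour through the cells at scale \<open>k + 1\<close> one obtains a tour through the cells at scale
  \<open>k\<close> by one detour of length at most \<open>6 * 2 ^ k\<close> for each of the latter.\<close>

lemma tour_refine:
  assumes A: "finite A" "A \<subseteq> carrier H" and x: "x \<in> carrier H" and t: "H.tour x (\<pi> K ` A) n"
  shows "H.tour x A (n + (\<Sum>k<K. 6 * 2 ^ k * card (\<pi> k ` A)))"
  using t
proof (induction K arbitrary: n)
  case 0
  have "\<pi> 0 z = z" if "z \<in> A" for z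
  proof -
    have z: "z \<in> carrier H" using that A by auto
    show ?thesis using H.net_mapD(1,2) [OF \<pi>s [of 0] z] H.dst_eq_0_iff [of "\<pi> 0 z" z] z by simp
  qed
  then have "\<pi> 0 ` A = A" by simp
  then show ?case using 0 by simp
next
  case (Suc K)
  have sub: "\<pi> k ` A \<subseteq> carrier H" for k using H.net_mapD(1) [OF \<pi>s] A by blast
  have "H.tour x (\<pi> K ` A \<union> \<pi> (Suc K) ` A) (n + 2 * (3 * 2 ^ K) * card (\<pi> K ` A))"
  proof (rule H.tour_extend [OF _ Suc.prems sub sub])
    show "finite (\<pi> K ` A)" using A by simp
    fix p assume "p \<in> \<pi> K ` A"
    then obtain z where z: "z \<in> A" "p = \<pi> K z" by blast
    have c: "z \<in> carrier H" "\<pi> K z \<in> carrier H" "\<pi> (Suc K) z \<in> carrier H" using z A sub by auto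
    have "H.dst (\<pi> (Suc K) z) p \<le> H.dst (\<pi> (Suc K) z) z + H.dst (\<pi> K z) z"
      using H.dst_triangle [OF c(3,1,2)] H.dst_commute [OF c(1,2)] z by simp
    also have "\<dots> \<le> 3 * 2 ^ K"
      using H.net_mapD(2) [OF \<pi>s [of K] c(1)] H.net_mapD(2) [OF \<pi>s [of "Suc K"] c(1)] by simp
    finally show "\<exists>q\<in>\<pi> (Suc K) ` A. H.dst q p \<le> 3 * 2 ^ K" using z by blast
  qed
  then have "H.tour x (\<pi> K ` A) (n + 2 * (3 * 2 ^ K) * card (\<pi> K ` A))"
    by (rule H.tour_mono) auto
  from Suc.IH [OF this] show ?case by (simp add: add_ac)
qed

lemma tour_top:
  assumes A: "finite A" "A \<subseteq> carrier H" and x: "x \<in> carrier H" and D: "\<And>z. z \<in> A \<Longrightarrow> H.dst x z < 2 ^ K"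
  shows "H.tour x (\<pi> K ` A) (4 * 2 ^ K * card (near K (\<pi> K) x))"
proof -
  have d: "H.dst x p \<le> 2 * 2 ^ K" "p \<in> carrier H" "p \<in> \<pi> K ` carrier H" if p: "p \<in> \<pi> K ` A" for p
  proof -
    obtain z where z: "z \<in> A" "p = \<pi> K z" using p by blast
    have c: "z \<in> carrier H" using z A by auto
    note n = H.net_mapD(1,2) [OF \<pi>s [of K] c]
    show "H.dst x p \<le> 2 * 2 ^ K"
      using H.dst_triangle [OF x c n(1)] H.dst_commute [OF c n(1)] n(2) D [OF z(1)] z by simp
    show "p \<in> carrier H" "p \<in> \<pi> K ` carrier H" using n z c by auto
  qed
  have "\<pi> K ` A \<subseteq> near K (\<pi> K) x" using d by (auto simp: near_def)
  then have "card (\<pi> K ` A) \<le> card (near K (\<pi> K) x)" by (rule card_mono [OF near_finite [OF \<pi>s x]])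
  moreover have "H.tour x (\<pi> K ` A \<union> {x}) (0 + 2 * (2 * 2 ^ K) * card (\<pi> K ` A))"
    using A x d by (intro H.tour_extend H.tour_start) auto
  ultimately show ?thesis by (elim H.tour_mono) auto
qed

text \<open>\<open>2 ^ K\<close> is about the largest distance \<open>D\<close> from \<open>x\<close> that has to be travelled. A point at this distance
  is detected at scale \<open>K - 3\<close>; if \<open>K < 3\<close> then at scale \<open>0\<close>, the truncated difference.\<close>

lemma salesman_scales:
  assumes w: "(\<eta>, x) \<in> carrier W" "(\<eta>', x') \<in> carrier W" and ne: "(\<eta>, x) \<noteq> (\<eta>', x')"
  obtains K where "W.dst (\<eta>, x) (\<eta>', x') \<le> (4 * card (near K (\<pi> K) x) + 1) * 2 ^ K
      + (\<Sum>k<K. 6 * 2 ^ k * card (\<pi> k ` diff \<eta> \<eta>')) + lamp_dist \<eta> \<eta>'"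
    and "K = 0 \<and> diff \<eta> \<eta>' \<noteq> {} \<or>
      (\<exists>k. 2 ^ K \<le> 8 * (2 :: nat) ^ k \<and> 2 ^ k \<le> card (coord_diff k (\<pi> k) (\<eta>, x) (\<eta>', x')))"
proof -
  let ?A = "diff \<eta> \<eta>'"
  have A: "finite ?A" "?A \<subseteq> carrier H" using finite_diff [OF w] by (auto simp: diff_def)
  have x: "x \<in> carrier H" "x' \<in> carrier H" using w W_carrierD by auto
  define D where "D = Max (insert (H.dst x x') (H.dst x ` ?A))"
  have Dge: "H.dst x x' \<le> D" "\<And>z. z \<in> ?A \<Longrightarrow> H.dst x z \<le> D"
    unfolding D_def using A by (auto intro: Max_ge)
  have "D \<in> insert (H.dst x x') (H.dst x ` ?A)"
    unfolding D_def using A by (intro Max_in) auto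
  then have Din: "D = H.dst x x' \<or> (\<exists>z\<in>?A. D = H.dst x z)" by auto
  define K where "K = (LEAST K. D < 2 ^ K)"
  have K: "D < 2 ^ K" unfolding K_def by (rule LeastI [of _ D]) (rule less_exp)
  have "H.tour x ?A (4 * 2 ^ K * card (near K (\<pi> K) x) + (\<Sum>k<K. 6 * 2 ^ k * card (\<pi> k ` ?A)))"
    using K Dge by (intro tour_refine [OF A x(1)] tour_top [OF A x(1)]) (meson le_less_trans)
  from W_dst_le_salesman [OF w this order_refl]
  have 1: "W.dst (\<eta>, x) (\<eta>', x') \<le> (4 * card (near K (\<pi> K) x) + 1) * 2 ^ K
      + (\<Sum>k<K. 6 * 2 ^ k * card (\<pi> k ` ?A)) + lamp_dist \<eta> \<eta>'"
    using K Dge(1) by (simp add: algebra_simps)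
  show thesis
  proof (cases "D = 0")
    case True
    then have "K = 0" unfolding K_def by (intro Least_equality) auto
    moreover have "x = x'" using True Dge(1) H.dst_eq_0_iff [OF x] by simp
    then have "\<eta> \<noteq> \<eta>'" using ne by simp
    then have "?A \<noteq> {}" using diff_empty_iff [OF w] by simp
    ultimately show ?thesis using that 1 by blast
  next
    case False
    have "K \<noteq> 0" using K False by (intro notI) simp
    then have "\<not> D < 2 ^ (K - 1)" unfolding K_def by (intro not_less_Least) simp
    then have D2: "2 ^ (K - 1) \<le> D" by simp
    define k where "k = K - 3"
    have k8: "2 ^ K \<le> 8 * (2::nat) ^ k"
    proof -
      have "(2::nat) ^ K \<le> 2 ^ (k + 3)" unfolding k_def by (intro power_increasing) auto
      then show ?thesis by (simp add: power_add)
    qed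
    have k3: "3 * 2 ^ k \<le> D + 2"
    proof (cases "K \<le> 3")
      case True
      then show ?thesis using False by (simp add: k_def)
    next
      case False
      then have "K - 1 = 2 + k" by (simp add: k_def)
      then have "(2::nat) ^ (K - 1) = 4 * 2 ^ k" by (simp add: power_add)
      then show ?thesis using D2 by linarith
    qed
    from Din have "2 ^ k \<le> card (coord_diff k (\<pi> k) (\<eta>, x) (\<eta>', x'))"
    proof
      assume "D = H.dst x x'"
      then show ?thesis using k3 by (intro coord_diff_far_move [OF \<pi>s w]) simp
    next
      assume "\<exists>z\<in>?A. D = H.dst x z"
      then show ?thesis using k3 by (auto intro: coord_diff_far_lamp [OF \<pi>s w])
    qed
    then show ?thesis using that [OF 1] k8 by blast
  qed
qed

text \<open>Since all exponents are at most one, powers of sums are bounded by sums of powers; with the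
  exponent \<open>\<tau> > 0\<close> the contribution of the largest scale dominates a geometric sum.\<close>

lemma W_dst_powr_le:
  assumes w: "(\<eta>, x) \<in> carrier W" "(\<eta>', x') \<in> carrier W" and ne: "(\<eta>, x) \<noteq> (\<eta>', x')"
    and s: "0 \<le> \<sigma>" "\<sigma> \<le> \<tau>" "0 < \<tau>" "\<tau> \<le> 1"
    and sm: "summable (\<lambda>k. (2 powr (\<tau> - 1)) ^ k * real (card (coord_diff k (\<pi> k) (\<eta>, x) (\<eta>', x'))))"
  shows "real (W.dst (\<eta>, x) (\<eta>', x')) powr \<sigma> \<le>
    (8 * (4 * M + 1) + 6 + 48 * M / (2 powr \<tau> - 1)) *
      (\<Sum>k. (2 powr (\<tau> - 1)) ^ k * real (card (coord_diff k (\<pi> k) (\<eta>, x) (\<eta>', x'))))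
    + (4 * M + 2) * (\<Sum>z\<in>diff \<eta> \<eta>'. real (G.dst (\<eta> z) (\<eta>' z)) powr \<sigma>)"
proof -
  define q where "q = 2 powr (\<tau> - 1)"
  define \<Psi> where "\<Psi> k = real (card (coord_diff k (\<pi> k) (\<eta>, x) (\<eta>', x')))" for k
  define F where "F = (\<Sum>k. q ^ k * \<Psi> k)"
  define e where "e k = (2 powr \<tau>) ^ k" for k :: nat
  let ?A = "diff \<eta> \<eta>'"
  have x: "x \<in> carrier H" using w W_carrierD by auto
  have q0: "0 < q" by (simp add: q_def)
  have qe: "q ^ k * 2 ^ k = e k" for k
    by (simp add: q_def e_def power_mult_distrib [symmetric] powr_diff)
  have e0: "0 < e k" for k by (simp add: e_def)
  have pe: "(2 ^ k) powr \<tau> = e k" for k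
    by (induction k) (simp_all add: e_def powr_mult)
  have sm': "summable (\<lambda>k. q ^ k * \<Psi> k)" using sm by (simp add: q_def \<Psi>_def)
  have nn: "0 \<le> q ^ k * \<Psi> k" for k using q0 by (simp add: \<Psi>_def)
  have F0: "0 \<le> F" unfolding F_def using nn sm' by (intro suminf_nonneg) auto
  obtain K where K: "W.dst (\<eta>, x) (\<eta>', x') \<le> (4 * card (near K (\<pi> K) x) + 1) * 2 ^ K
      + (\<Sum>k<K. 6 * 2 ^ k * card (\<pi> k ` ?A)) + lamp_dist \<eta> \<eta>'"
    and alt: "K = 0 \<and> ?A \<noteq> {} \<or>
      (\<exists>k. 2 ^ K \<le> 8 * (2 :: nat) ^ k \<and> 2 ^ k \<le> card (coord_diff k (\<pi> k) (\<eta>, x) (\<eta>', x')))"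
    using salesman_scales [OF w ne] .
  define t where "t = (4 * card (near K (\<pi> K) x) + 1) * 2 ^ K + (\<Sum>k<K. 6 * 2 ^ k * card (\<pi> k ` ?A))"
  define L where "L = (\<Sum>z\<in>?A. real (G.dst (\<eta> z) (\<eta>' z)) powr \<sigma>)"
  have L0: "0 \<le> L" unfolding L_def by (intro sum_nonneg) simp
  define E where "E = 1 / (2 powr \<tau> - 1)"
  have "1 < 2 powr \<tau>" using s powr_less_mono [of 0 \<tau> 2] by simp
  then have "0 < E" "E * (2 powr \<tau> - 1) = 1" using s by (simp_all add: E_def)
  then have E: "0 < E" "E * 2 powr \<tau> = E + 1" by (simp_all add: right_diff_distrib)
  have geo: "(\<Sum>k<m. e k) \<le> E * e m" for m
  proof (induction m)
    case 0
    then show ?case using E by (simp add: e_def)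
  next
    case (Suc m)
    have "(\<Sum>k<Suc m. e k) \<le> (E + 1) * e m" using Suc by (simp add: algebra_simps)
    also have "\<dots> = E * e (Suc m)" by (simp add: e_def E(2) [symmetric])
    finally show ?case .
  qed
  \<comment> \<open>The detours at scale \<open>k\<close> are paid for by coordinates at scale \<open>k\<close>, up to the few cells close to
    the lamplighter; the latter form a geometric sum.\<close>
  have tb: "real t powr \<tau> \<le> (4 * M + 1) * e K + 6 * (F + M * (E * e K))"
  proof -
    have "real t powr \<tau> = ((4 * real (card (near K (\<pi> K) x)) + 1) * 2 ^ K
        + (\<Sum>k<K. 6 * (2 ^ k * real (card (\<pi> k ` ?A))))) powr \<tau>"
      by (simp add: t_def algebra_simps)
    also have "\<dots> \<le> ((4 * real (card (near K (\<pi> K) x)) + 1) * 2 ^ K) powr \<tau>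
        + (\<Sum>k<K. 6 * (2 ^ k * real (card (\<pi> k ` ?A)))) powr \<tau>"
      using s by (intro powr_subadditive) (auto intro!: sum_nonneg)
    also have "\<dots> \<le> (4 * M + 1) * e K + (\<Sum>k<K. 6 * (q ^ k * \<Psi> k + M * e k))"
    proof (rule add_mono)
      have "((4 * real (card (near K (\<pi> K) x)) + 1) * 2 ^ K) powr \<tau>
          \<le> (4 * real (card (near K (\<pi> K) x)) + 1) * e K"
        using powr_mult_le [of "4 * real (card (near K (\<pi> K) x)) + 1" "2 ^ K" \<tau>] s by (simp add: pe)
      also have "\<dots> \<le> (4 * M + 1) * e K"
        using near_card [OF \<pi>s x] e0 [of K] by (intro mult_right_mono) auto
      finally show "((4 * real (card (near K (\<pi> K) x)) + 1) * 2 ^ K) powr \<tau> \<le> (4 * M + 1) * e K" .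
      have "(\<Sum>k<K. 6 * (2 ^ k * real (card (\<pi> k ` ?A)))) powr \<tau>
          \<le> (\<Sum>k<K. (6 * (2 ^ k * real (card (\<pi> k ` ?A)))) powr \<tau>)"
        using s by (intro powr_sum_subadditive) auto
      also have "\<dots> \<le> (\<Sum>k<K. 6 * (q ^ k * \<Psi> k + M * e k))"
      proof (rule sum_mono)
        fix k
        define c where "c = real (card (\<pi> k ` ?A))"
        have "(6 * (2 ^ k * c)) powr \<tau> \<le> 6 * (2 ^ k * c) powr \<tau>"
          using s by (intro powr_mult_le) (auto simp: c_def)
        also have "(2 ^ k * c) powr \<tau> = e k * c powr \<tau>" by (simp add: powr_mult pe)
        also have "c powr \<tau> \<le> c"
        proof (cases "c = 0")
          case False
          then have "1 \<le> c" by (simp add: c_def)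
          then have "c powr \<tau> \<le> c powr 1" using s by (intro powr_mono) auto
          then show ?thesis using \<open>1 \<le> c\<close> by simp
        qed simp
        then have "6 * (e k * c powr \<tau>) \<le> 6 * (e k * c)" using e0 [of k] by simp
        also have "e k * c = q ^ k * (2 ^ k * c)" by (simp add: qe [symmetric])
        also have "q ^ k * (2 ^ k * c) \<le> q ^ k * (\<Psi> k + 2 ^ k * M)"
        proof (rule mult_left_mono)
          have "real (2 ^ k * card (\<pi> k ` ?A)) \<le>
            real (card (coord_diff k (\<pi> k) (\<eta>, x) (\<eta>', x')) + 2 ^ k * card (near k (\<pi> k) x))"
            using coord_diff_boxes [OF \<pi>s w, of k] by (simp only: of_nat_le_iff)
          then have "2 ^ k * c \<le> \<Psi> k + 2 ^ k * real (card (near k (\<pi> k) x))"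
            by (simp add: c_def \<Psi>_def)
          also have "\<dots> \<le> \<Psi> k + 2 ^ k * M"
            using near_card [OF \<pi>s x] by (intro add_left_mono mult_left_mono) auto
          finally show "2 ^ k * c \<le> \<Psi> k + 2 ^ k * M" .
        qed (use q0 in simp)
        also have "q ^ k * (\<Psi> k + 2 ^ k * M) = q ^ k * \<Psi> k + M * e k"
          by (simp add: qe [symmetric] algebra_simps)
        finally show "(6 * (2 ^ k * real (card (\<pi> k ` ?A)))) powr \<tau> \<le> 6 * (q ^ k * \<Psi> k + M * e k)"
          by (simp add: c_def)
      qed
      finally show "(\<Sum>k<K. 6 * (2 ^ k * real (card (\<pi> k ` ?A)))) powr \<tau>
          \<le> (\<Sum>k<K. 6 * (q ^ k * \<Psi> k + M * e k))" .
    qed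
    also have "(\<Sum>k<K. 6 * (q ^ k * \<Psi> k + M * e k)) = 6 * ((\<Sum>k<K. q ^ k * \<Psi> k) + M * (\<Sum>k<K. e k))"
      by (simp add: sum.distrib sum_distrib_left [symmetric])
    also have "\<dots> \<le> 6 * (F + M * (E * e K))"
      using sum_le_suminf [OF sm', of "{..<K}"] nn geo [of K] M_nonneg
      by (intro mult_left_mono add_mono) (auto simp: F_def)
    finally show ?thesis by simp
  qed
  have te: "real t powr \<tau> \<le> (8 * (4 * M + 1) + 6 + 48 * M * E) * F + (4 * M + 1) * L"
    using alt
  proof
    assume K0: "K = 0 \<and> ?A \<noteq> {}"
    then obtain z where z: "z \<in> ?A" by auto
    have "G.dst (\<eta> z) (\<eta>' z) \<noteq> 0"
      using z G.dst_eq_0_iff W_carrierD(2) [OF w(1)] W_carrierD(2) [OF w(2)] unfolding diff_def by blast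
    then have "1 \<le> real (G.dst (\<eta> z) (\<eta>' z)) powr \<sigma>" using s by (intro ge_one_powr_ge_zero) auto
    also have "\<dots> \<le> L" unfolding L_def
      using z finite_diff [OF w] by (intro member_le_sum) auto
    finally have L1: "(4 * M + 1) * 1 \<le> (4 * M + 1) * L" using M_nonneg by (intro mult_left_mono) auto
    have "real t powr \<tau> \<le> (4 * M + 1) * 1"
    proof -
      have "real t powr \<tau> \<le> (4 * real (card (near K (\<pi> K) x)) + 1) * 1 powr \<tau>"
        using K0 powr_mult_le [of "4 * real (card (near K (\<pi> K) x)) + 1" 1 \<tau>] s by (simp add: t_def add.commute)
      then show ?thesis using near_card [OF \<pi>s x, of K] by simp
    qed
    then have "real t powr \<tau> \<le> (4 * M + 1) * L" using L1 by (rule order_trans)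
    moreover have "0 \<le> (8 * (4 * M + 1) + 6 + 48 * M * E) * F"
      using M_nonneg E F0 by (intro mult_nonneg_nonneg add_nonneg_nonneg) auto
    ultimately show ?thesis by (rule add_increasing [rotated])
  next
    assume "\<exists>k. 2 ^ K \<le> 8 * (2 :: nat) ^ k \<and> 2 ^ k \<le> card (coord_diff k (\<pi> k) (\<eta>, x) (\<eta>', x'))"
    then obtain k where k: "2 ^ K \<le> 8 * (2 :: nat) ^ k"
      "2 ^ k \<le> card (coord_diff k (\<pi> k) (\<eta>, x) (\<eta>', x'))" by blast
    have "real (2 ^ K) \<le> real (8 * 2 ^ k)" using k(1) by (simp only: of_nat_le_iff)
    then have "e K \<le> (8 * 2 ^ k) powr \<tau>" unfolding pe [symmetric] using s by (intro powr_mono2) auto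
    also have "\<dots> \<le> 8 * e k" using powr_mult_le [of 8 "2 ^ k" \<tau>] s by (simp add: pe)
    also have "e k = q ^ k * 2 ^ k" by (simp add: qe)
    also have "q ^ k * 2 ^ k \<le> q ^ k * \<Psi> k"
    proof (rule mult_left_mono)
      have "real (2 ^ k) \<le> \<Psi> k" unfolding \<Psi>_def using k(2) by (simp only: of_nat_le_iff)
      then show "2 ^ k \<le> \<Psi> k" by simp
    qed (use q0 in simp)
    also have "\<dots> \<le> F"
      unfolding F_def using sum_le_suminf [OF sm', of "{k}"] nn by simp
    finally have eF: "e K \<le> 8 * F" by simp
    have "real t powr \<tau> \<le> (4 * M + 1 + 6 * M * E) * e K + 6 * F" using tb by (simp add: algebra_simps)
    also have "\<dots> \<le> (4 * M + 1 + 6 * M * E) * (8 * F) + 6 * F"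
      using eF M_nonneg E by (intro add_right_mono mult_left_mono) auto
    also have "\<dots> = (8 * (4 * M + 1) + 6 + 48 * M * E) * F" by (simp add: algebra_simps)
    also have "\<dots> \<le> (8 * (4 * M + 1) + 6 + 48 * M * E) * F + (4 * M + 1) * L"
      using M_nonneg L0 by simp
    finally show ?thesis .
  qed
  have "real (W.dst (\<eta>, x) (\<eta>', x')) \<le> real (t + lamp_dist \<eta> \<eta>')"
    using K unfolding t_def by (simp only: of_nat_le_iff)
  then have "real (W.dst (\<eta>, x) (\<eta>', x')) powr \<sigma> \<le> (real t + real (lamp_dist \<eta> \<eta>')) powr \<sigma>"
    using s by (intro powr_mono2) auto
  also have "\<dots> \<le> real t powr \<sigma> + real (lamp_dist \<eta> \<eta>') powr \<sigma>"
    using s by (intro powr_subadditive) auto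
  also have "\<dots> \<le> real t powr \<tau> + L"
  proof (rule add_mono)
    show "real t powr \<sigma> \<le> real t powr \<tau>"
    proof (cases "t = 0")
      case False
      then show ?thesis using s by (intro powr_mono) auto
    qed simp
    show "real (lamp_dist \<eta> \<eta>') powr \<sigma> \<le> L"
      unfolding lamp_dist_def L_def of_nat_sum
      using s finite_diff [OF w] by (intro powr_sum_subadditive) auto
  qed
  also have "\<dots> \<le> (8 * (4 * M + 1) + 6 + 48 * M * E) * F + (4 * M + 2) * L"
    using te by (simp add: algebra_simps)
  finally show ?thesis by (simp add: F_def E_def L_def \<Psi>_def q_def)
qed

end

end

context quadratic_wreath
begin

lemma coord_diff_generator:
  assumes \<pi>: "H.net_map (carrier H) (2 ^ k) \<pi>" and u: "u \<in> carrier W" "w \<in> SW"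
  shows "real (card (coord_diff k \<pi> u (u \<otimes>\<^bsub>W\<^esub> w))) \<le> 2 * M"
proof -
  obtain \<eta> x where ux: "u = (\<eta>, x)" by (cases u)
  have x: "x \<in> carrier H" "(\<eta>, x) \<in> carrier W" using W_carrierD(1) u ux by auto
  from u(2) consider s where "s \<in> S" "w = (lamp s, \<one>\<^bsub>H\<^esub>)" | t where "t \<in> T" "w = (no_lamps, t)"
    by (auto simp: SW_def)
  then show ?thesis
  proof cases
    case (1 s)
    then have "u \<otimes>\<^bsub>W\<^esub> w = (\<eta>(x := \<eta> x \<otimes>\<^bsub>G\<^esub> s), x)"
      using mult_lamp [OF x(2)] G.S_carrier ux by auto
    then show ?thesis using coord_diff_lamp [OF \<pi> x(1)] M_nonneg by (simp add: ux)
  next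
    case (2 t)
    then have t: "t \<in> carrier H" using H.S_carrier by auto
    have "u \<otimes>\<^bsub>W\<^esub> w = (\<eta>, x \<otimes>\<^bsub>H\<^esub> t)" using mult_move [OF x(2) t] ux 2 by simp
    then show ?thesis
      using coord_diff_move [OF \<pi> x(1) _ H.dst_gen_le [OF x(1) 2(1)]] x t ux by simp
  qed
qed

definition lamp_kernel :: "('a \<Rightarrow> 'a \<Rightarrow> real) \<Rightarrow> ('b \<Rightarrow> 'a) \<times> 'b \<Rightarrow> ('b \<Rightarrow> 'a) \<times> 'b \<Rightarrow> real" where
  "lamp_kernel \<psi> u u' = (\<Sum>z\<in>diff (fst u) (fst u'). \<psi> (fst u z) (fst u' z))"

lemma L2_kernel_lamp_kernel:
  assumes k: "L2_kernel (carrier G) \<psi>"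
  shows "L2_kernel (carrier W) (lamp_kernel \<psi>)"
proof -
  define \<phi> where "\<phi> z u u' = (if z \<in> carrier H then \<psi> (fst u z) (fst u' z) else 0)"
    for z and u u' :: "('b \<Rightarrow> 'a) \<times> 'b"
  have val: "fst u z \<in> carrier G" if "u \<in> carrier W" "z \<in> carrier H" for u z
    using that W_carrierD(2) [of "fst u" "snd u"] by simp
  have sub: "{z. \<phi> z u u' \<noteq> 0} \<subseteq> diff (fst u) (fst u')" if u: "u \<in> carrier W" "u' \<in> carrier W" for u u'
    using L2_kernel_refl [OF k val [OF u(2)]] by (auto simp: \<phi>_def diff_def)
  have fin: "finite (diff (fst u) (fst u'))" if u: "u \<in> carrier W" "u' \<in> carrier W" for u u'
    using finite_diff [of "fst u" "snd u" "fst u'" "snd u'"] u by simp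
  have "L2_kernel (carrier W) (\<lambda>u u'. \<Sum>z | \<phi> z u u' \<noteq> 0. \<phi> z u u')"
  proof (rule L2_kernel_sum_finite_support [OF W.countable_carrier])
    show "L2_kernel (carrier W) (\<phi> z)" for z
    proof (cases "z \<in> carrier H")
      case True
      then show ?thesis unfolding \<phi>_def using val by (simp, intro L2_kernel_pullback [OF k]) auto
    next
      case False
      then show ?thesis using L2_kernel_scalar [of "carrier W" "\<lambda>_. 0"] by (simp add: \<phi>_def [abs_def])
    qed
    show "finite {z. \<phi> z u u' \<noteq> 0}" if "u \<in> carrier W" "u' \<in> carrier W" for u u'
      using sub [OF that] fin [OF that] by (rule finite_subset)
  qed
  then show ?thesis
  proof (rule L2_kernel_cong)
    fix u u' assume u: "u \<in> carrier W" "u' \<in> carrier W"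
    have "(\<Sum>z | \<phi> z u u' \<noteq> 0. \<phi> z u u') = (\<Sum>z\<in>diff (fst u) (fst u'). \<phi> z u u')"
      using sub [OF u] fin [OF u] by (intro sum.mono_neutral_left) auto
    also have "\<dots> = lamp_kernel \<psi> u u'"
      unfolding lamp_kernel_def by (intro sum.cong refl) (simp add: \<phi>_def diff_def)
    finally show "(\<Sum>z | \<phi> z u u' \<noteq> 0. \<phi> z u u') = lamp_kernel \<psi> u u'" .
  qed
qed

lemma lamp_kernel_generator:
  assumes C: "\<forall>x\<in>carrier G. \<forall>y\<in>carrier G. \<psi> x y \<le> C * (real (G.dst x y))\<^sup>2"
    and u: "u \<in> carrier W" "w \<in> SW"
  shows "lamp_kernel \<psi> u (u \<otimes>\<^bsub>W\<^esub> w) \<le> \<bar>C\<bar>"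
proof -
  obtain \<eta> x where ux: "u = (\<eta>, x)" by (cases u)
  have x: "x \<in> carrier H" "(\<eta>, x) \<in> carrier W" "\<eta> x \<in> carrier G" using W_carrierD(1,2) u ux by auto
  from u(2) consider s where "s \<in> S" "w = (lamp s, \<one>\<^bsub>H\<^esub>)" | t where "t \<in> T" "w = (no_lamps, t)"
    by (auto simp: SW_def)
  then show ?thesis
  proof cases
    case (1 s)
    then have s: "s \<in> carrier G" using G.S_carrier by auto
    let ?g = "\<eta> x \<otimes>\<^bsub>G\<^esub> s"
    have e: "u \<otimes>\<^bsub>W\<^esub> w = (\<eta>(x := ?g), x)" using mult_lamp [OF x(2) s] ux 1 by simp
    show ?thesis
    proof (cases "\<eta> x = ?g")
      case True
      then have "diff \<eta> (\<eta>(x := ?g)) = {}" by (auto simp: diff_def)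
      then show ?thesis unfolding lamp_kernel_def e unfolding ux fst_conv by simp
    next
      case False
      then have "diff \<eta> (\<eta>(x := ?g)) = {x}" using x by (auto simp: diff_def)
      then have "lamp_kernel \<psi> u (u \<otimes>\<^bsub>W\<^esub> w) = \<psi> (\<eta> x) ?g"
        unfolding lamp_kernel_def e unfolding ux fst_conv by simp
      also have "\<dots> \<le> C * (real (G.dst (\<eta> x) ?g))\<^sup>2" using C x s by simp
      also have "\<dots> \<le> \<bar>C\<bar> * 1\<^sup>2"
        using G.dst_gen_le [OF x(3) 1(1)] by (intro mult_mono power_mono) auto
      finally show ?thesis by simp
    qed
  next
    case (2 t)
    then have t: "t \<in> carrier H" using H.S_carrier by auto
    have "u \<otimes>\<^bsub>W\<^esub> w = (\<eta>, x \<otimes>\<^bsub>H\<^esub> t)" using mult_move [OF x(2) t] ux 2 by simp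
    moreover have "diff \<eta> \<eta> = {}" by (simp add: diff_def)
    ultimately show ?thesis by (simp add: lamp_kernel_def ux)
  qed
qed

text \<open>The embedding is the Hilbert sum of the given one at each lamp and of the scales \<open>k\<close> with weights
  \<open>q ^ k\<close>. A generator changes boundedly many coordinates at each scale, so that the weights make the sum
  finite; and \<open>q ^ k * 2 ^ k = (2 ^ k) powr \<tau>\<close>. Taking \<open>\<tau> \<ge> 1 / 2\<close> rather than \<open>\<tau> = 2 * \<alpha>\<close> keeps the sums
  over scales geometric when \<open>\<alpha> = 0\<close>.\<close>

theorem compression_admissible_wreath:
  assumes adm: "compression_admissible G S \<alpha>" and \<alpha>: "0 \<le> \<alpha>" "\<alpha> < 1 / 2"
  shows "compression_admissible W SW \<alpha>"
proof -
  define \<tau> where "\<tau> = max (2 * \<alpha>) (1 / 2)"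
  have \<tau>: "2 * \<alpha> \<le> \<tau>" "0 < \<tau>" "\<tau> \<le> 1" "\<tau> < 1" using \<alpha> by (auto simp: \<tau>_def)
  define q where "q = 2 powr (\<tau> - 1)"
  have q: "0 < q" "q < 1" using \<tau> powr_less_mono [of "\<tau> - 1" 0 2] by (auto simp: q_def)
  obtain \<psi> C c where k: "L2_kernel (carrier G) \<psi>" and c: "0 < c"
    and up: "\<forall>x\<in>carrier G. \<forall>y\<in>carrier G. \<psi> x y \<le> C * (real (G.dst x y))\<^sup>2"
    and low: "\<forall>x\<in>carrier G. \<forall>y\<in>carrier G. x \<noteq> y \<longrightarrow> c * real (G.dst x y) powr (2 * \<alpha>) \<le> \<psi> x y"
    using adm unfolding G.compression_admissible_iff by (elim exE conjE)
  have "\<exists>\<pi>. H.net_map (carrier H) (2 ^ k) \<pi>" for k by (rule H.net_map_exists) auto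
  then obtain \<pi> where \<pi>: "\<And>k. H.net_map (carrier H) (2 ^ k) (\<pi> k)" by metis
  define \<Psi> where "\<Psi> k u u' = real (card (coord_diff k (\<pi> k) u u'))" for k u u'
  define F where "F u u' = (\<Sum>k. q ^ k * \<Psi> k u u')" for u u'
  define \<Phi> where "\<Phi> u u' = F u u' + lamp_kernel \<psi> u u'" for u u'
  have k\<Psi>: "L2_kernel (carrier W) (\<Psi> k)" for k
  proof -
    have "L2_kernel (carrier W) (\<lambda>u u'. real (card {i. coord k (\<pi> k) i u \<noteq> coord k (\<pi> k) i u'}))"
    proof (rule L2_kernel_card [OF W.countable_carrier])
      fix u u' assume "u \<in> carrier W" "u' \<in> carrier W"
      then show "finite {i. coord k (\<pi> k) i u \<noteq> coord k (\<pi> k) i u'}"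
        using finite_coord_diff [OF \<pi>, of "fst u" "snd u" "fst u'" "snd u'"] by (simp add: coord_diff_def)
    qed
    then show ?thesis by (simp add: \<Psi>_def [abs_def] coord_diff_def)
  qed
  have \<Psi>gen: "\<Psi> k u (u \<otimes>\<^bsub>W\<^esub> w) \<le> 2 * M" if "u \<in> carrier W" "w \<in> SW" for k u w
    unfolding \<Psi>_def by (rule coord_diff_generator [OF \<pi> that])
  have geo: "summable (\<lambda>k. q ^ k * B)" for B using q by (intro summable_mult2 summable_geometric) simp
  have sm: "summable (\<lambda>k. q ^ k * \<Psi> k u u')" if u: "u \<in> carrier W" "u' \<in> carrier W" for u u'
  proof (rule summable_comparison_test [OF _ geo [of "2 * M * (real (W.dst u u'))\<^sup>2"]])
    have "norm (q ^ k * \<Psi> k u u') \<le> q ^ k * (2 * M * (real (W.dst u u'))\<^sup>2)" for k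
      using W.L2_kernel_lipschitz [OF k\<Psi> \<Psi>gen u, of k] q
      by (simp add: \<Psi>_def mult_left_mono)
    then show "\<exists>N. \<forall>k\<ge>N. norm (q ^ k * \<Psi> k u u') \<le> q ^ k * (2 * M * (real (W.dst u u'))\<^sup>2)" by blast
  qed
  have kF: "L2_kernel (carrier W) F"
    unfolding F_def using q sm by (intro L2_kernel_suminf L2_kernel_mult k\<Psi>) auto
  have k\<Phi>: "L2_kernel (carrier W) \<Phi>"
    unfolding \<Phi>_def by (intro L2_kernel_add kF L2_kernel_lamp_kernel k)
  have gen: "\<Phi> u (u \<otimes>\<^bsub>W\<^esub> w) \<le> (\<Sum>k. q ^ k * (2 * M)) + \<bar>C\<bar>" if u: "u \<in> carrier W" "w \<in> SW" for u w
    unfolding \<Phi>_def F_def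
  proof (rule add_mono)
    have uw: "u \<otimes>\<^bsub>W\<^esub> w \<in> carrier W" using u SW_carrier by (intro W.m_closed) auto
    show "(\<Sum>k. q ^ k * \<Psi> k u (u \<otimes>\<^bsub>W\<^esub> w)) \<le> (\<Sum>k. q ^ k * (2 * M))"
      using q \<Psi>gen [OF u] by (intro suminf_le sm u(1) uw geo mult_left_mono) auto
    show "lamp_kernel \<psi> u (u \<otimes>\<^bsub>W\<^esub> w) \<le> \<bar>C\<bar>" by (rule lamp_kernel_generator [OF up u])
  qed
  define B where "B = 8 * (4 * M + 1) + 6 + 48 * M / (2 powr \<tau> - 1)"
  define B' where "B' = (4 * M + 2) / c"
  have "1 < 2 powr \<tau>" using \<tau> powr_less_mono [of 0 \<tau> 2] by simp
  then have B: "0 < B" "0 < B'" using M_nonneg c by (auto simp: B_def B'_def intro!: add_pos_nonneg divide_nonneg_pos)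
  have lower: "1 / (B + B') * real (W.dst u u') powr (2 * \<alpha>) \<le> \<Phi> u u'"
    if u: "u \<in> carrier W" "u' \<in> carrier W" "u \<noteq> u'" for u u'
  proof -
    obtain \<eta> x \<eta>' x' where uu: "u = (\<eta>, x)" "u' = (\<eta>', x')" by (cases u, cases u')
    note w = u [unfolded uu]
    have F0: "0 \<le> F u u'" and L0: "0 \<le> lamp_kernel \<psi> u u'"
      by (rule L2_kernel_nonneg [OF kF u(1,2)], rule L2_kernel_nonneg [OF L2_kernel_lamp_kernel [OF k] u(1,2)])
    have "(4 * M + 2) * (\<Sum>z\<in>diff \<eta> \<eta>'. real (G.dst (\<eta> z) (\<eta>' z)) powr (2 * \<alpha>))
        = B' * (\<Sum>z\<in>diff \<eta> \<eta>'. c * real (G.dst (\<eta> z) (\<eta>' z)) powr (2 * \<alpha>))"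
      using c by (simp add: B'_def sum_distrib_left [symmetric])
    also have "\<dots> \<le> B' * lamp_kernel \<psi> u u'"
      unfolding lamp_kernel_def uu fst_conv
    proof (intro mult_left_mono sum_mono)
      fix z assume "z \<in> diff \<eta> \<eta>'"
      then have "\<eta> z \<in> carrier G" "\<eta>' z \<in> carrier G" "\<eta> z \<noteq> \<eta>' z"
        using W_carrierD(2) [OF w(1)] W_carrierD(2) [OF w(2)] by (auto simp: diff_def)
      then show "c * real (G.dst (\<eta> z) (\<eta>' z)) powr (2 * \<alpha>) \<le> \<psi> (\<eta> z) (\<eta>' z)" using low by blast
    qed (use B in simp)
    finally have 1: "(4 * M + 2) * (\<Sum>z\<in>diff \<eta> \<eta>'. real (G.dst (\<eta> z) (\<eta>' z)) powr (2 * \<alpha>))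
        \<le> B' * lamp_kernel \<psi> u u'" .
    have "summable (\<lambda>k. (2 powr (\<tau> - 1)) ^ k * real (card (coord_diff k (\<pi> k) (\<eta>, x) (\<eta>', x'))))"
      using sm [OF u(1,2)] by (simp add: \<Psi>_def q_def uu)
    from W_dst_powr_le [OF \<pi> w _ \<tau>(1,2,3) this] \<alpha>
    have "real (W.dst u u') powr (2 * \<alpha>) \<le> B * F u u' +
        (4 * M + 2) * (\<Sum>z\<in>diff \<eta> \<eta>'. real (G.dst (\<eta> z) (\<eta>' z)) powr (2 * \<alpha>))"
      by (simp add: B_def F_def \<Psi>_def q_def uu)
    also have "\<dots> \<le> B * F u u' + B' * lamp_kernel \<psi> u u'" using 1 by simp
    also have "\<dots> \<le> (B + B') * \<Phi> u u'"
      using B F0 L0 by (simp add: \<Phi>_def algebra_simps)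
    finally show ?thesis using B by (simp add: field_simps)
  qed
  show ?thesis
    unfolding W.compression_admissible_iff
  proof (intro exI conjI ballI impI)
    show "L2_kernel (carrier W) \<Phi>" by (rule k\<Phi>)
    show "0 < 1 / (B + B')" using B by simp
    show "\<Phi> u u' \<le> ((\<Sum>k. q ^ k * (2 * M)) + \<bar>C\<bar>) * (real (W.dst u u'))\<^sup>2"
      if "u \<in> carrier W" "u' \<in> carrier W" for u u'
      by (rule W.L2_kernel_lipschitz [OF k\<Phi> gen that])
  qed (rule lower)
qed

end

section \<open>The compression exponent of a wreath product\<close>

theorem hilbert_compression_wreath:
  fixes G :: "('a, 'm) monoid_scheme" and H :: "('b, 'n) monoid_scheme"
  assumes G: "group G" "finitely_generated G" and s: "s \<in> carrier G" "s \<noteq> \<one>\<^bsub>G\<^esub>"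
    and H: "group H" "quadratic_growth H"
  shows "hilbert_compression (G \<wr> H) = min (ereal (1 / 2)) (hilbert_compression G)"
proof -
  obtain S where S: "fin_sym_generating G S" using group.finitely_generated_iff [OF G(1)] G(2) by blast
  obtain T a b where T: "quadratic_metric H T a b" using quadratic_growth_metric [OF H] .
  interpret G: word_metric G S using G S by (simp add: word_metric_def word_metric_axioms_def)
  interpret H: quadratic_metric H T a b by (rule T)
  interpret quadratic_wreath G S H T a b ..
  let ?A = "{\<alpha>. 0 \<le> \<alpha> \<and> compression_admissible W SW \<alpha>}"
  let ?B = "{\<alpha>. 0 \<le> \<alpha> \<and> compression_admissible G S \<alpha>}"
  show ?thesis
    unfolding W.hilbert_compression_SUP G.hilbert_compression_SUP
  proof (rule antisym)
    show "(SUP \<alpha>\<in>?A. ereal \<alpha>) \<le> min (ereal (1 / 2)) (SUP \<alpha>\<in>?B. ereal \<alpha>)"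
      using compression_admissible_le_half [OF s] compression_admissible_base
      by (intro SUP_least) (auto intro: SUP_upper)
    show "min (ereal (1 / 2)) (SUP \<alpha>\<in>?B. ereal \<alpha>) \<le> (SUP \<alpha>\<in>?A. ereal \<alpha>)"
      unfolding le_SUP_iff
    proof (intro allI impI)
      fix y assume y: "y < min (ereal (1 / 2)) (SUP \<alpha>\<in>?B. ereal \<alpha>)"
      then obtain \<alpha> where \<alpha>: "0 \<le> \<alpha>" "compression_admissible G S \<alpha>" "y < ereal \<alpha>"
        by (auto simp: less_SUP_iff)
      show "\<exists>\<alpha>\<in>?A. y < ereal \<alpha>"
      proof (cases "\<alpha> < 1 / 2")
        case True
        then show ?thesis using compression_admissible_wreath \<alpha> by blast
      next
        case False
        have "max y 0 < ereal (1 / 2)" using y by (simp add: zero_ereal_def)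
        then obtain z where z: "max y 0 < ereal z" "ereal z < ereal (1 / 2)" using ereal_dense2 by blast
        have "0 \<le> z" using z(1) by (simp add: zero_ereal_def)
        moreover have "compression_admissible G S z"
          using z False by (intro G.compression_admissible_antimono [OF \<alpha>(2)]) simp
        ultimately show ?thesis using compression_admissible_wreath [of z] z by (intro bexI [of _ z]) auto
      qed
    qed
  qed
qed

section \<open>The groups \<open>\<int>\<close>, \<open>\<int>\<^sup>2\<close> and \<open>C\<^sub>2\<close>\<close>

text \<open>The function \<open>h\<close>, read as a map into the constants in \<open>L\<^sub>2\<close>, shows that exponent one is admissible.\<close>

lemma (in word_metric) half_le_hilbert_compression:
  fixes h :: "'a \<Rightarrow> real"
  assumes low: "\<And>x y. x \<in> carrier G \<Longrightarrow> y \<in> carrier G \<Longrightarrow> real (dst x y) \<le> \<bar>h x - h y\<bar>"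
    and up: "\<And>x s. x \<in> carrier G \<Longrightarrow> s \<in> S \<Longrightarrow> \<bar>h x - h (x \<otimes> s)\<bar> \<le> 1"
  shows "ereal (1 / 2) \<le> hilbert_compression G"
proof -
  have k: "L2_kernel (carrier G) (\<lambda>x y. (h x - h y)\<^sup>2)" by (rule L2_kernel_scalar)
  have "compression_admissible G S 1"
    unfolding compression_admissible_iff
  proof (intro exI conjI ballI impI)
    show "L2_kernel (carrier G) (\<lambda>x y. (h x - h y)\<^sup>2)" by (rule k)
    show "(0::real) < 1" by simp
    show "(h x - h y)\<^sup>2 \<le> 1 * (real (dst x y))\<^sup>2" if "x \<in> carrier G" "y \<in> carrier G" for x y
      using up by (intro L2_kernel_lipschitz [OF k _ that]) (simp add: abs_square_le_1)
    show "1 * real (dst x y) powr (2 * 1) \<le> (h x - h y)\<^sup>2" if "x \<in> carrier G" "y \<in> carrier G" for x y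
      using power_mono [OF low [OF that], of 2] by (simp add: powr_numeral)
  qed
  then have "ereal 1 \<le> hilbert_compression G"
    unfolding hilbert_compression_SUP by (intro SUP_upper) simp
  moreover have "ereal (1 / 2) \<le> ereal 1" by simp
  ultimately show ?thesis by (rule order_trans [rotated])
qed

lemma word_metric_integer: "word_metric integer_group {1, -1}"
proof -
  interpret group integer_group by simp
  have "carrier integer_group \<subseteq> generate integer_group {1, -1}"
  proof
    fix x :: int
    have pos: "int n \<in> generate integer_group {1, -1}" "- int n \<in> generate integer_group {1, -1}" for n
    proof (induction n)
      case 0
      show "int 0 \<in> generate integer_group {1, -1}" "- int 0 \<in> generate integer_group {1, -1}"
        using generate.one [of integer_group "{1, -1}"] by auto
    next
      case (Suc n)
      show "int (Suc n) \<in> generate integer_group {1, -1}"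
        using generate.eng [OF Suc.IH(1) generate.incl [of 1]] by (simp add: add.commute)
      show "- int (Suc n) \<in> generate integer_group {1, -1}"
        using generate.eng [OF Suc.IH(2) generate.incl [of "-1"]] by (simp add: algebra_simps)
    qed
    show "x \<in> generate integer_group {1, -1}" using pos by (cases x rule: int_cases2) auto
  qed
  then show ?thesis
    by unfold_locales (auto simp: fin_sym_generating_def)
qed

lemma dst_integer_le: "word_dist integer_group {1, -1} x y \<le> nat \<bar>x - y\<bar>"
proof -
  interpret word_metric integer_group "{1, -1}" by (rule word_metric_integer)
  have f: "foldr (\<otimes>\<^bsub>integer_group\<^esub>) (replicate n s) \<one>\<^bsub>integer_group\<^esub> = int n * s" for n s
    by (induction n) (auto simp: algebra_simps)
  let ?s = "if x \<le> y then 1 else - 1 :: int"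
  have "foldr (\<otimes>\<^bsub>integer_group\<^esub>) (replicate (nat \<bar>x - y\<bar>) ?s) \<one>\<^bsub>integer_group\<^esub> = - x + y"
    unfolding f by auto
  then have "word_length integer_group {1, -1} (- x + y) \<le> length (replicate (nat \<bar>x - y\<bar>) ?s)"
    by (intro word_length_le) auto
  then show ?thesis by (simp add: word_dist_def)
qed

lemma half_le_hilbert_compression_integer: "ereal (1 / 2) \<le> hilbert_compression integer_group"
proof -
  interpret word_metric integer_group "{1, -1}" by (rule word_metric_integer)
  show ?thesis
  proof (rule half_le_hilbert_compression [of real_of_int])
    fix x y :: int
    have "real (dst x y) \<le> real (nat \<bar>x - y\<bar>)" using dst_integer_le by (simp only: of_nat_le_iff)
    then show "real (dst x y) \<le> \<bar>real_of_int x - real_of_int y\<bar>" by simp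
  qed auto
qed

lemma fin_sym_generating_carrier:
  assumes "group G" "finite (carrier G)"
  shows "fin_sym_generating G (carrier G)"
proof -
  interpret group G by fact
  show ?thesis
    using assms(2) generate_incl [of "carrier G"] by (auto simp: fin_sym_generating_def intro: generate.incl)
qed

lemma half_le_hilbert_compression_C2: "ereal (1 / 2) \<le> hilbert_compression (integer_mod_group 2)"
proof -
  have c: "carrier (integer_mod_group 2) = {0, 1}" by (auto simp: carrier_integer_mod_group)
  interpret word_metric "integer_mod_group 2" "carrier (integer_mod_group 2)"
    unfolding word_metric_def word_metric_axioms_def
    using fin_sym_generating_carrier [of "integer_mod_group 2"] c by simp
  show ?thesis
  proof (rule half_le_hilbert_compression [of real_of_int])
    fix x y :: int assume xy: "x \<in> carrier (integer_mod_group 2)" "y \<in> carrier (integer_mod_group 2)"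
    show "real (dst x y) \<le> \<bar>real_of_int x - real_of_int y\<bar>"
    proof (cases "x = y")
      case False
      have "dst x y \<le> 1" unfolding word_dist_def using xy by (intro len_gen_le m_closed inv_closed)
      moreover have "\<bar>real_of_int x - real_of_int y\<bar> = 1" using xy False unfolding c by auto
      ultimately show ?thesis by simp
    qed (use xy in simp)
  next
    fix x s assume "x \<in> carrier (integer_mod_group 2)" "s \<in> carrier (integer_mod_group 2)"
    then show "\<bar>real_of_int x - real_of_int (x \<otimes>\<^bsub>integer_mod_group 2\<^esub> s)\<bar> \<le> 1"
      unfolding c by auto
  qed
qed

abbreviation Z2 where "Z2 \<equiv> integer_group \<times>\<times> integer_group"

definition Z2_gens :: "(int \<times> int) set" where
  "Z2_gens = {(1, 0), (-1, 0), (0, 1), (0, -1)}"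

lemma mult_Z2 [simp]: "p \<otimes>\<^bsub>Z2\<^esub> q = (fst p + fst q, snd p + snd q)"
  by (simp add: DirProd_def split_def)

lemma foldr_Z2:
  "foldr (\<otimes>\<^bsub>Z2\<^esub>) (replicate m (s, 0) @ replicate n (0, t)) \<one>\<^bsub>Z2\<^esub> = (int m * s, int n * t)"
proof -
  have "foldr (\<otimes>\<^bsub>Z2\<^esub>) (replicate n (0, t)) \<one>\<^bsub>Z2\<^esub> = (0, int n * t)"
    by (induction n) (auto simp: algebra_simps)
  then show ?thesis by (induction m) (auto simp: algebra_simps)
qed

lemma Z2_word:
  obtains ws where "set ws \<subseteq> Z2_gens" "length ws = nat \<bar>fst p\<bar> + nat \<bar>snd p\<bar>"
    "foldr (\<otimes>\<^bsub>Z2\<^esub>) ws \<one>\<^bsub>Z2\<^esub> = p"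
proof
  let ?s = "if 0 \<le> fst p then 1 else - 1 :: int" and ?t = "if 0 \<le> snd p then 1 else - 1 :: int"
  let ?ws = "replicate (nat \<bar>fst p\<bar>) (?s, 0) @ replicate (nat \<bar>snd p\<bar>) (0, ?t)"
  show "set ?ws \<subseteq> Z2_gens" by (auto simp: Z2_gens_def set_replicate_conv_if)
  show "length ?ws = nat \<bar>fst p\<bar> + nat \<bar>snd p\<bar>" by simp
  show "foldr (\<otimes>\<^bsub>Z2\<^esub>) ?ws \<one>\<^bsub>Z2\<^esub> = p" unfolding foldr_Z2 by (cases p) auto
qed

lemma group_Z2: "group Z2"
  by (intro DirProd_group) auto

lemma word_metric_Z2: "word_metric Z2 Z2_gens"
proof -
  interpret group Z2 by (rule group_Z2)
  have inv: "inv\<^bsub>Z2\<^esub> (x, y) = (- x, - y)" for x y by (rule inv_equality) auto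
  have "foldr (\<otimes>\<^bsub>Z2\<^esub>) ws \<one>\<^bsub>Z2\<^esub> \<in> generate Z2 Z2_gens" if "set ws \<subseteq> Z2_gens" for ws
    using that
  proof (induction ws)
    case Nil
    then show ?case by (simp only: foldr.simps id_apply generate.one)
  next
    case (Cons w ws)
    then have w: "w \<in> Z2_gens" "set ws \<subseteq> Z2_gens" by simp_all
    from generate.eng [OF generate.incl [OF w(1)] Cons.IH [OF w(2)]] show ?case
      by (simp only: foldr.simps o_apply)
  qed
  then have "p \<in> generate Z2 Z2_gens" for p by (metis Z2_word)
  then have "generate Z2 Z2_gens = carrier Z2" by auto
  then show ?thesis
    unfolding word_metric_def word_metric_axioms_def fin_sym_generating_def
    using group_Z2 by (auto simp: Z2_gens_def inv)
qed

lemma quadratic_growth_Z2: "quadratic_growth Z2"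
proof -
  interpret word_metric Z2 Z2_gens by (rule word_metric_Z2)
  have len_le: "len p \<le> nat \<bar>fst p\<bar> + nat \<bar>snd p\<bar>" for p
    using Z2_word [of p] word_length_le by metis
  have len_ge: "\<bar>fst p\<bar> \<le> int (len p) \<and> \<bar>snd p\<bar> \<le> int (len p)" for p
  proof -
    have *: "\<bar>fst (foldr (\<otimes>\<^bsub>Z2\<^esub>) ws \<one>\<^bsub>Z2\<^esub>)\<bar> \<le> int (length ws) \<and>
        \<bar>snd (foldr (\<otimes>\<^bsub>Z2\<^esub>) ws \<one>\<^bsub>Z2\<^esub>)\<bar> \<le> int (length ws)" if "set ws \<subseteq> Z2_gens" for ws
      using that by (induction ws) (auto simp: Z2_gens_def)
    obtain ws where "set ws \<subseteq> Z2_gens" "length ws = len p" "foldr (\<otimes>\<^bsub>Z2\<^esub>) ws \<one>\<^bsub>Z2\<^esub> = p"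
      using word_length_attained [OF gen, of p] by auto
    then show ?thesis using * [of ws] by simp
  qed
  have main: "1 / 16 * r\<^sup>2 \<le> real (card {x \<in> carrier Z2. real (dst \<one>\<^bsub>Z2\<^esub> x) \<le> r}) \<and>
      real (card {x \<in> carrier Z2. real (dst \<one>\<^bsub>Z2\<^esub> x) \<le> r}) \<le> 9 * r\<^sup>2" if r: "r \<ge> 1" for r :: real
  proof -
    define n where "n = nat \<lfloor>r\<rfloor>"
    have n: "real n \<le> r" "r < real n + 1" "1 \<le> real n"
      using r by (auto simp: n_def le_nat_iff le_floor_iff)
    have le_n: "real m \<le> r \<longleftrightarrow> m \<le> n" for m :: nat
    proof
      assume "real m \<le> r"
      then have "real m < real (n + 1)" using n by simp
      then show "m \<le> n" by (simp only: of_nat_less_iff)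
    next
      assume "m \<le> n"
      then have "real m \<le> real n" by simp
      then show "real m \<le> r" using n by simp
    qed
    have B: "{x \<in> carrier Z2. real (dst \<one>\<^bsub>Z2\<^esub> x) \<le> r} = {x. len x \<le> n}"
      using dst_one by (auto simp: le_n)
    have fin: "finite {x. len x \<le> n}" using finite_ball [of n] by simp
    define h where "h = n div 2"
    have "{0..int h} \<times> {0..int h} \<subseteq> {x. len x \<le> n}"
    proof
      fix p assume "p \<in> {0..int h} \<times> {0..int h}"
      then have "nat \<bar>fst p\<bar> + nat \<bar>snd p\<bar> \<le> h + h" by (cases p) auto
      also have "\<dots> \<le> n" by (simp add: h_def)
      finally show "p \<in> {x. len x \<le> n}" using len_le [of p] by simp
    qed
    then have "card ({0..int h} \<times> {0..int h}) \<le> card {x. len x \<le> n}" by (rule card_mono [OF fin])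
    then have lo: "(h + 1)\<^sup>2 \<le> card {x. len x \<le> n}"
      by (simp add: card_cartesian_product power2_eq_square nat_add_distrib)
    have "{x. len x \<le> n} \<subseteq> {- int n..int n} \<times> {- int n..int n}"
    proof
      fix p assume "p \<in> {x. len x \<le> n}"
      then have "\<bar>fst p\<bar> \<le> int n" "\<bar>snd p\<bar> \<le> int n" using len_ge [of p] by auto
      then show "p \<in> {- int n..int n} \<times> {- int n..int n}" by (cases p) auto
    qed
    then have "card {x. len x \<le> n} \<le> card ({- int n..int n} \<times> {- int n..int n})"
      by (intro card_mono) auto
    also have "\<dots> = (2 * n + 1)\<^sup>2"
    proof -
      have "nat (1 + int n + int n) = 2 * n + 1" by linarith
      then show ?thesis by (simp add: card_cartesian_product power2_eq_square algebra_simps)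
    qed
    finally have hi: "card {x. len x \<le> n} \<le> (2 * n + 1)\<^sup>2" .
    have "r / 4 \<le> real (h + 1)"
    proof -
      have "n \<le> 2 * h + 1" by (simp add: h_def)
      then have "real n \<le> 2 * real h + 1" by linarith
      then show ?thesis using n by simp
    qed
    then have "(r / 4)\<^sup>2 \<le> (real (h + 1))\<^sup>2" using r by (intro power_mono) auto
    also have "\<dots> = real ((h + 1)\<^sup>2)" by simp
    also have "\<dots> \<le> real (card {x. len x \<le> n})" using lo by (simp only: of_nat_le_iff)
    finally have 1: "1 / 16 * r\<^sup>2 \<le> real (card {x. len x \<le> n})" by (simp add: power_divide)
    have "real (card {x. len x \<le> n}) \<le> real ((2 * n + 1)\<^sup>2)" using hi by (simp only: of_nat_le_iff)
    also have "\<dots> = (2 * real n + 1)\<^sup>2" by simp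
    also have "\<dots> \<le> (3 * r)\<^sup>2" using n by (intro power_mono) auto
    finally show ?thesis using 1 unfolding B by (simp add: power_mult_distrib)
  qed
  show ?thesis
    unfolding quadratic_growth_def
  proof (intro exI conjI allI impI)
    show "fin_sym_generating Z2 Z2_gens" by (rule gen)
    show "(0::real) < 1 / 16" "(0::real) < 9" by simp_all
  qed (use main in blast)+
qed

theorem mainTheorem8:
  shows "(\<forall>(G :: ('a, 'm) monoid_scheme) (H :: ('b, 'n) monoid_scheme).
            group G \<longrightarrow> infinite (carrier G) \<longrightarrow> finitely_generated G \<longrightarrow> amenable G \<longrightarrow>
            group H \<longrightarrow> finitely_generated H \<longrightarrow> quadratic_growth H \<longrightarrow>
            hilbert_compression (G \<wr> H) = min (ereal (1/2)) (hilbert_compression G))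
       \<and> hilbert_compression (integer_mod_group 2 \<wr> (integer_group \<times>\<times> integer_group)) = ereal (1/2)
       \<and> hilbert_compression (integer_group \<wr> (integer_group \<times>\<times> integer_group)) = ereal (1/2)"
proof (intro conjI allI impI)
  fix G :: "('a, 'm) monoid_scheme" and H :: "('b, 'n) monoid_scheme"
  assume G: "group G" "infinite (carrier G)" "finitely_generated G"
    and H: "group H" "quadratic_growth H"
  have "\<not> carrier G \<subseteq> {\<one>\<^bsub>G\<^esub>}" using G(2) finite_subset by blast
  then obtain s where s: "s \<in> carrier G" "s \<noteq> \<one>\<^bsub>G\<^esub>" by blast
  show "hilbert_compression (G \<wr> H) = min (ereal (1/2)) (hilbert_compression G)"
    by (rule hilbert_compression_wreath [OF G(1,3) s H])
next
  have "fin_sym_generating (integer_mod_group 2) (carrier (integer_mod_group 2))"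
    by (rule fin_sym_generating_carrier) (simp_all add: carrier_integer_mod_group)
  then have "finitely_generated (integer_mod_group 2)"
    using group.finitely_generated_iff [OF group_integer_mod_group] by blast
  then have "hilbert_compression (integer_mod_group 2 \<wr> Z2) = min (ereal (1/2)) (hilbert_compression (integer_mod_group 2))"
    by (intro hilbert_compression_wreath [where s = 1] group_Z2 quadratic_growth_Z2) auto
  then show "hilbert_compression (integer_mod_group 2 \<wr> Z2) = ereal (1/2)"
    using half_le_hilbert_compression_C2 by (simp add: min_absorb1)
next
  have "finitely_generated integer_group"
    using group.finitely_generated_iff [OF group_integer_group] word_metric.gen [OF word_metric_integer] by blast
  then have "hilbert_compression (integer_group \<wr> Z2) = min (ereal (1/2)) (hilbert_compression integer_group)"
    by (intro hilbert_compression_wreath [where s = 1] group_Z2 quadratic_growth_Z2) auto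
  then show "hilbert_compression (integer_group \<wr> Z2) = ereal (1/2)"
    using half_le_hilbert_compression_integer by (simp add: min_absorb1)
qed

end
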